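(* (a) Let $J$ be an indecomposable module in category $\mathcal{J}$, let $\lambda\in\mathbb{C}^n$ be a weight of $J$, and let $U=J_\lambda$ (a finite-dimensional space). Define $D_j(s)\in\mathrm{End}\,U$ by $D_j(s)u=e_{-s}(d_j(s)u)$. The operators $D_j(s)$ depend polynomially on $s$ and can be written uniquely as a finite sum $$D_j(s)=\lambda_j\,\mathrm{Id}+\sum_{\alpha\in\mathbb{Z}_+^n\setminus\{0\}}\frac{s^\alpha}{\alpha!}D_j^{(\alpha)},$$ with $D_j^{(\alpha)}\in\mathrm{End}\,U$ independent of $s$. Then $\rho\big(z^\alpha\frac{\partial}{\partial z_j}\big)=D_j^{(\alpha)}$ defines a finite-dimensional representation $\rho$ of $W_n^+$ on $U$. (b) For every finite-dimensional representation $\rho$ of $W_n^+$ on a space $U$, one has $\rho\big(z^\beta\frac{\partial}{\partial z_j}\big)=0$ for all but finitely many $\beta$. There is a one-to-one correspondence between indecomposable modules in category $\mathcal{J}$ and pairs $(\lambda,U)$, where $\lambda\in\mathbb{C}^n/\mathbb{Z}^n$ and $U$ is an indecomposable finite-dimensional $W_n^+$-module. To the pair $(\lambda,U)$ corresponds the module $J=\mathcal{F}(\mathbb{T}^n)\otimes U$, where $\mathcal{F}(\mathbb{T}^n)$ acts by multiplication on the first factor and $W_n$ acts by $$d_j(s)(e_m\otimes v)=(m_j+\lambda_j)\,e_{m+s}\otimes v+\sum_{\beta\in\mathbb{Z}_+^n\setminus\{0\}}\frac{s^\beta}{\beta!}\,e_{m+s}\otimes\rho\Big(z^\beta\frac{\partial}{\partial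 z_j}\Big)v .$$ Here $\lambda$ is any representative of its class. (c) There is a one-to-one correspondence between irreducible modules in category $\mathcal{J}$ and pairs $(\lambda,V)$, where $\lambda\in\mathbb{C}^n/\mathbb{Z}^n$ and $V$ is a finite-dimensional irreducible $\mathfrak{gl}_n(\mathbb{C})$-module. To the pair $(\lambda,V)$ corresponds the module $J=\mathcal{F}(\mathbb{T}^n)\otimes V$, where $\mathcal{F}(\mathbb{T}^n)$ acts by multiplication on the first factor and $W_n$ acts by $$d_j(s)(e_m\otimes v)=(m_j+\lambda_j)\,e_{m+s}\otimes v+\sum_{p=1}^n s_p\,e_{m+s}\otimes E^p_j v .$$
   Context: Let $n\ge 1$. Let $\mathcal{F}(\mathbb{T}^n)$ be the commutative algebra with $\mathbb{C}$-basis $e_m=e^{2\pi i m\cdot x}$, $m\in\mathbb{Z}^n$, and $e_me_k=e_{m+k}$. Let $W_n$ be the Lie algebra with $\mathbb{C}$-basis $d_j(s)=\frac{1}{2\pi i}e^{2\pi i s\cdot x}\frac{\partial}{\partial x^j}$, for $j=1,\dots,n$ and $s\in\mathbb{Z}^n$, and bracket $$[d_j(s),d_k(m)]=m_jd_k(s+m)-s_kd_j(s+m).$$ $W_n$ acts on $\mathcal{F}(\mathbb{T}^n)$ by derivations via $d_j(s)e_m=m_je_{m+s}$. Write $d_j=d_j(0)$. Category $\mathcal{J}$ consists of $W_n$-modules $J$ that are also $\mathcal{F}(\mathbb{T}^n)$-modules and satisfy: (J1) each $d_j$ acts diagonalizably on $J$; (J2) $J$ is a free $\mathcal{F}(\mathbb{T}^n)$-module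 of finite rank; (J3) $u(fw)=(uf)w+f(uw)$ for all $u\in W_n$, $f\in\mathcal{F}(\mathbb{T}^n)$, $w\in J$. Weight spaces are $J_\mu=\{w: d_jw=\mu_jw \text{ for all } j\}$. Submodules are invariant under both $W_n$ and $\mathcal{F}(\mathbb{T}^n)$. Indecomposable modules are nonzero. Correspondences are understood up to isomorphism. Notation: $\mathbb{Z}_+$ denotes the nonnegative integers, $\epsilon_j$ the standard basis of $\mathbb{Z}^n$, $s^\alpha=\prod_i s_i^{\alpha_i}$ and $\alpha!=\prod_i\alpha_i!$. $W_n^+$ is the Lie algebra of derivations of $\mathbb{C}[z_1,\dots,z_n]$ spanned by $z^\alpha\frac{\partial}{\partial z_j}$ with $\alpha\in\mathbb{Z}_+^n\setminus\{0\}$, $j=1,\dots,n$, with bracket $$\Big[z^\alpha\frac{\partial}{\partial z_j},z^\beta\frac{\partial}{\partial z_k}\Big]=\beta_jz^{\alpha+\beta-\epsilon_j}\frac{\partial}{\partial z_k}-\alpha_kz^{\alpha+\beta-\epsilon_k}\frac{\partial}{\partial z_j}.$$ $E^p_q\in\mathfrak{gl}_n(\mathbb{C})$ denotes the matrix with $1$ in position $(p,q)$ and $0$ elsewhere. *)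

theory Defs
  imports Complex_Main "HOL-Library.Function_Algebras"
begin

text \<open>Conventions.  The index set {1..n} is a finite type 'n; Z^n is 'n \<Rightarrow> int,
  C^n is 'n \<Rightarrow> complex, multi-indices in Z_+^n are 'n \<Rightarrow> nat.
  A complex vector space is a carrier set V inside a type 'v with the (global) additive
  group structure of 'v and a scalar multiplication sc satisfying the axioms on V.
  A module over a family of operators (indexed by a set I) is given by the
  operators ops i :: 'v \<Rightarrow> 'v.\<close>

definition cvs :: "(complex \<Rightarrow> 'v::ab_group_add \<Rightarrow> 'v) \<Rightarrow> 'v set \<Rightarrow> bool" where
  "cvs sc V \<longleftrightarrow> 0 \<in> V \<and> (\<forall>x\<in>V. \<forall>y\<in>V. x + y \<in> V) \<and> (\<forall>c. \<forall>x\<in>V. sc c x \<in> V)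
    \<and> (\<forall>c. \<forall>x\<in>V. \<forall>y\<in>V. sc c (x + y) = sc c x + sc c y)
    \<and> (\<forall>a b. \<forall>x\<in>V. sc (a + b) x = sc a x + sc b x)
    \<and> (\<forall>a b. \<forall>x\<in>V. sc a (sc b x) = sc (a * b) x)
    \<and> (\<forall>x\<in>V. sc 1 x = x)"

definition clin_on :: "(complex \<Rightarrow> 'v::ab_group_add \<Rightarrow> 'v) \<Rightarrow> 'v set
    \<Rightarrow> (complex \<Rightarrow> 'w::ab_group_add \<Rightarrow> 'w) \<Rightarrow> ('v \<Rightarrow> 'w) \<Rightarrow> bool" where
  "clin_on sc V sc' f \<longleftrightarrow> (\<forall>x\<in>V. \<forall>y\<in>V. f (x + y) = f x + f y) \<and> (\<forall>c. \<forall>x\<in>V. f (sc c x) = sc' c (f x))"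

definition cspan :: "(complex \<Rightarrow> 'v::ab_group_add \<Rightarrow> 'v) \<Rightarrow> 'v set \<Rightarrow> 'v set" where
  "cspan sc S = {y. \<exists>F c. finite F \<and> F \<subseteq> S \<and> y = (\<Sum>x\<in>F. sc (c x) x)}"

definition findim :: "(complex \<Rightarrow> 'v::ab_group_add \<Rightarrow> 'v) \<Rightarrow> 'v set \<Rightarrow> bool" where
  "findim sc V \<longleftrightarrow> (\<exists>S. finite S \<and> S \<subseteq> V \<and> V \<subseteq> cspan sc S)"

definition ops_sub :: "(complex \<Rightarrow> 'v::ab_group_add \<Rightarrow> 'v) \<Rightarrow> 'v set \<Rightarrow> 'i set \<Rightarrow> ('i \<Rightarrow> 'v \<Rightarrow> 'v) \<Rightarrow> 'v set \<Rightarrow> bool" where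
  "ops_sub sc V I ops W \<longleftrightarrow> W \<subseteq> V \<and> cvs sc W \<and> (\<forall>i\<in>I. \<forall>x\<in>W. ops i x \<in> W)"

definition ops_indecomposable :: "(complex \<Rightarrow> 'v::ab_group_add \<Rightarrow> 'v) \<Rightarrow> 'v set \<Rightarrow> 'i set \<Rightarrow> ('i \<Rightarrow> 'v \<Rightarrow> 'v) \<Rightarrow> bool" where
  "ops_indecomposable sc V I ops \<longleftrightarrow> V \<noteq> {0} \<and>
     \<not> (\<exists>A B. ops_sub sc V I ops A \<and> ops_sub sc V I ops B \<and> A \<noteq> {0} \<and> B \<noteq> {0}
            \<and> A \<inter> B = {0} \<and> V = {a + b |a b. a \<in> A \<and> b \<in> B})"

definition ops_irreducible :: "(complex \<Rightarrow> 'v::ab_group_add \<Rightarrow> 'v) \<Rightarrow> 'v set \<Rightarrow> 'i set \<Rightarrow> ('i \<Rightarrow> 'v \<Rightarrow> 'v) \<Rightarrow> bool" where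
  "ops_irreducible sc V I ops \<longleftrightarrow> V \<noteq> {0} \<and> (\<forall>W. ops_sub sc V I ops W \<longrightarrow> W = {0} \<or> W = V)"

definition ops_iso :: "(complex \<Rightarrow> 'v::ab_group_add \<Rightarrow> 'v) \<Rightarrow> 'v set \<Rightarrow> 'i set \<Rightarrow> ('i \<Rightarrow> 'v \<Rightarrow> 'v)
    \<Rightarrow> (complex \<Rightarrow> 'w::ab_group_add \<Rightarrow> 'w) \<Rightarrow> 'w set \<Rightarrow> ('i \<Rightarrow> 'w \<Rightarrow> 'w) \<Rightarrow> bool" where
  "ops_iso sc V I ops sc' V' ops' \<longleftrightarrow> (\<exists>f. bij_betw f V V' \<and> clin_on sc V sc' f
      \<and> (\<forall>i\<in>I. \<forall>x\<in>V. f (ops i x) = ops' i (f x)))"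

definition Jops :: "('n \<Rightarrow> ('n \<Rightarrow> int) \<Rightarrow> 'v \<Rightarrow> 'v) \<Rightarrow> (('n \<Rightarrow> int) \<Rightarrow> 'v \<Rightarrow> 'v)
    \<Rightarrow> ('n \<times> ('n \<Rightarrow> int)) + ('n \<Rightarrow> int) \<Rightarrow> 'v \<Rightarrow> 'v" where
  "Jops d e = case_sum (\<lambda>(j, s). d j s) e"

definition is_Jmod :: "(complex \<Rightarrow> 'v::ab_group_add \<Rightarrow> 'v) \<Rightarrow> 'v set
    \<Rightarrow> ('n::finite \<Rightarrow> ('n \<Rightarrow> int) \<Rightarrow> 'v \<Rightarrow> 'v) \<Rightarrow> (('n \<Rightarrow> int) \<Rightarrow> 'v \<Rightarrow> 'v) \<Rightarrow> bool" where
  "is_Jmod sc V d e \<longleftrightarrow> cvs sc V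
    \<and> (\<forall>j s. (\<forall>x\<in>V. d j s x \<in> V) \<and> clin_on sc V sc (d j s))
    \<and> (\<forall>m. (\<forall>x\<in>V. e m x \<in> V) \<and> clin_on sc V sc (e m))
    \<and> (\<forall>x\<in>V. e 0 x = x) \<and> (\<forall>m k. \<forall>x\<in>V. e m (e k x) = e (m + k) x)
    \<and> (\<forall>j s k m. \<forall>x\<in>V. d j s (d k m x) - d k m (d j s x)
          = sc (of_int (m j)) (d k (s + m) x) - sc (of_int (s k)) (d j (s + m) x))
    \<and> (\<forall>j s m. \<forall>x\<in>V. d j s (e m x) = sc (of_int (m j)) (e (m + s) x) + e m (d j s x))
    \<and> (\<forall>j. V \<subseteq> cspan sc {x\<in>V. \<exists>c. d j 0 x = sc c x})
    \<and> (\<exists>B. finite B \<and> B \<subseteq> V \<and> (\<forall>x\<in>V. \<exists>!c :: 'v \<Rightarrow> ('n \<Rightarrow> int) \<Rightarrow> complex.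
          (\<forall>b m. c b m \<noteq> 0 \<longrightarrow> b \<in> B) \<and> (\<forall>b. finite {m. c b m \<noteq> 0})
          \<and> x = (\<Sum>b\<in>B. \<Sum>m\<in>{m. c b m \<noteq> 0}. sc (c b m) (e m b))))"

definition weight_space :: "(complex \<Rightarrow> 'v::ab_group_add \<Rightarrow> 'v) \<Rightarrow> 'v set
    \<Rightarrow> ('n \<Rightarrow> ('n \<Rightarrow> int) \<Rightarrow> 'v \<Rightarrow> 'v) \<Rightarrow> ('n \<Rightarrow> complex) \<Rightarrow> 'v set" where
  "weight_space sc V d lam = {x\<in>V. \<forall>j. d j 0 x = sc (lam j) x}"

definition eps :: "'n \<Rightarrow> 'n \<Rightarrow> nat" where
  "eps j = (\<lambda>i. if i = j then 1 else 0)"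

definition mono :: "('n::finite \<Rightarrow> int) \<Rightarrow> ('n \<Rightarrow> nat) \<Rightarrow> complex" where
  "mono s \<alpha> = (\<Prod>i\<in>UNIV. (of_int (s i)) ^ (\<alpha> i))"

definition mfact :: "('n::finite \<Rightarrow> nat) \<Rightarrow> complex" where
  "mfact \<alpha> = (\<Prod>i\<in>UNIV. fact (\<alpha> i))"

text \<open>Representations of W_n^+: rho j alpha is the action of z^alpha d/dz_j (alpha \<noteq> 0).\<close>

definition Wp_idx :: "('n \<times> ('n \<Rightarrow> nat)) set" where
  "Wp_idx = {(j, \<alpha>). \<alpha> \<noteq> 0}"

definition Wp_ops :: "('n \<Rightarrow> ('n \<Rightarrow> nat) \<Rightarrow> 'u \<Rightarrow> 'u) \<Rightarrow> 'n \<times> ('n \<Rightarrow> nat) \<Rightarrow> 'u \<Rightarrow> 'u" where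
  "Wp_ops \<rho> = (\<lambda>(j, \<alpha>). \<rho> j \<alpha>)"

definition Wplus_rep :: "(complex \<Rightarrow> 'u::ab_group_add \<Rightarrow> 'u) \<Rightarrow> 'u set
    \<Rightarrow> ('n \<Rightarrow> ('n \<Rightarrow> nat) \<Rightarrow> 'u \<Rightarrow> 'u) \<Rightarrow> bool" where
  "Wplus_rep sc U \<rho> \<longleftrightarrow> cvs sc U
    \<and> (\<forall>j \<alpha>. \<alpha> \<noteq> 0 \<longrightarrow> (\<forall>u\<in>U. \<rho> j \<alpha> u \<in> U) \<and> clin_on sc U sc (\<rho> j \<alpha>))
    \<and> (\<forall>j k \<alpha> \<beta>. \<alpha> \<noteq> 0 \<longrightarrow> \<beta> \<noteq> 0 \<longrightarrow> (\<forall>u\<in>U.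
          \<rho> j \<alpha> (\<rho> k \<beta> u) - \<rho> k \<beta> (\<rho> j \<alpha> u)
          = sc (of_nat (\<beta> j)) (\<rho> k (\<alpha> + \<beta> - eps j) u) - sc (of_nat (\<alpha> k)) (\<rho> j (\<alpha> + \<beta> - eps k) u)))"

definition Wp_supp :: "'u::zero set \<Rightarrow> ('n \<Rightarrow> ('n \<Rightarrow> nat) \<Rightarrow> 'u \<Rightarrow> 'u) \<Rightarrow> 'n \<Rightarrow> ('n \<Rightarrow> nat) set" where
  "Wp_supp U \<rho> j = {\<beta>. \<beta> \<noteq> 0 \<and> (\<exists>u\<in>U. \<rho> j \<beta> u \<noteq> 0)}"

text \<open>Representations of gl_n: g p q is the action of E^p_q.\<close>

definition gl_ops :: "('n \<Rightarrow> 'n \<Rightarrow> 'u \<Rightarrow> 'u) \<Rightarrow> 'n \<times> 'n \<Rightarrow> 'u \<Rightarrow> 'u" where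
  "gl_ops g = (\<lambda>(p, q). g p q)"

definition gl_rep :: "(complex \<Rightarrow> 'u::ab_group_add \<Rightarrow> 'u) \<Rightarrow> 'u set \<Rightarrow> ('n \<Rightarrow> 'n \<Rightarrow> 'u \<Rightarrow> 'u) \<Rightarrow> bool" where
  "gl_rep sc V g \<longleftrightarrow> cvs sc V
    \<and> (\<forall>p q. (\<forall>v\<in>V. g p q v \<in> V) \<and> clin_on sc V sc (g p q))
    \<and> (\<forall>p q r s. \<forall>v\<in>V. g p q (g r s v) - g r s (g p q v)
          = (if q = r then g p s v else 0) - (if s = p then g r q v else 0))"

text \<open>The module F(T^n) \<otimes> U, realised as finitely supported functions Z^n \<Rightarrow> U
  (the element e_m \<otimes> v is the function that is v at m and 0 elsewhere).\<close>

definition FU :: "'u::zero set \<Rightarrow> (('n \<Rightarrow> int) \<Rightarrow> 'u) set" where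
  "FU U = {f. finite {m. f m \<noteq> 0} \<and> (\<forall>m. f m \<in> U)}"

definition scF :: "(complex \<Rightarrow> 'u \<Rightarrow> 'u) \<Rightarrow> complex \<Rightarrow> (('n \<Rightarrow> int) \<Rightarrow> 'u) \<Rightarrow> ('n \<Rightarrow> int) \<Rightarrow> 'u" where
  "scF sc c f = (\<lambda>m. sc c (f m))"

definition shiftE :: "('n \<Rightarrow> int) \<Rightarrow> (('n \<Rightarrow> int) \<Rightarrow> 'u) \<Rightarrow> ('n \<Rightarrow> int) \<Rightarrow> 'u" where
  "shiftE m f = (\<lambda>k. f (k - m))"

definition Jind :: "('n::finite \<Rightarrow> complex) \<Rightarrow> (complex \<Rightarrow> 'u::ab_group_add \<Rightarrow> 'u) \<Rightarrow> 'u set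
    \<Rightarrow> ('n \<Rightarrow> ('n \<Rightarrow> nat) \<Rightarrow> 'u \<Rightarrow> 'u) \<Rightarrow> 'n \<Rightarrow> ('n \<Rightarrow> int) \<Rightarrow> (('n \<Rightarrow> int) \<Rightarrow> 'u) \<Rightarrow> ('n \<Rightarrow> int) \<Rightarrow> 'u" where
  "Jind lam sc U \<rho> j s f = (\<lambda>k. sc (of_int ((k - s) j) + lam j) (f (k - s))
      + (\<Sum>\<beta>\<in>Wp_supp U \<rho> j. sc (mono s \<beta> / mfact \<beta>) (\<rho> j \<beta> (f (k - s)))))"

definition Jgl :: "('n::finite \<Rightarrow> complex) \<Rightarrow> (complex \<Rightarrow> 'u::ab_group_add \<Rightarrow> 'u)
    \<Rightarrow> ('n \<Rightarrow> 'n \<Rightarrow> 'u \<Rightarrow> 'u) \<Rightarrow> 'n \<Rightarrow> ('n \<Rightarrow> int) \<Rightarrow> (('n \<Rightarrow> int) \<Rightarrow> 'u) \<Rightarrow> ('n \<Rightarrow> int) \<Rightarrow> 'u" where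
  "Jgl lam sc g j s f = (\<lambda>k. sc (of_int ((k - s) j) + lam j) (f (k - s))
      + (\<Sum>p\<in>UNIV. sc (of_int (s p)) (g p j (f (k - s)))))"

definition lat_equiv :: "('n \<Rightarrow> complex) \<Rightarrow> ('n \<Rightarrow> complex) \<Rightarrow> bool" where
  "lat_equiv lam lam' \<longleftrightarrow> (\<exists>k :: 'n \<Rightarrow> int. \<forall>i. lam i - lam' i = of_int (k i))"

definition D_expansion :: "(complex \<Rightarrow> 'v::ab_group_add \<Rightarrow> 'v) \<Rightarrow> ('n::finite \<Rightarrow> ('n \<Rightarrow> int) \<Rightarrow> 'v \<Rightarrow> 'v)
    \<Rightarrow> (('n \<Rightarrow> int) \<Rightarrow> 'v \<Rightarrow> 'v) \<Rightarrow> ('n \<Rightarrow> complex) \<Rightarrow> 'v set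
    \<Rightarrow> ('n \<Rightarrow> ('n \<Rightarrow> nat) \<Rightarrow> 'v \<Rightarrow> 'v) \<Rightarrow> bool" where
  "D_expansion sc d e lam U D \<longleftrightarrow>
     (\<forall>j \<alpha>. \<alpha> \<noteq> 0 \<longrightarrow> (\<forall>u\<in>U. D j \<alpha> u \<in> U))
   \<and> (\<exists>A. finite A \<and> 0 \<notin> A \<and> (\<forall>j \<alpha>. \<alpha> \<notin> A \<longrightarrow> \<alpha> \<noteq> 0 \<longrightarrow> (\<forall>u\<in>U. D j \<alpha> u = 0))
        \<and> (\<forall>j s. \<forall>u\<in>U. e (- s) (d j s u) = sc (lam j) u + (\<Sum>\<alpha>\<in>A. sc (mono s \<alpha> / mfact \<alpha>) (D j \<alpha> u))))"

end

theory Submission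
  imports Defs "HOL-Library.Poly_Mapping" "HOL-Library.FuncSet" "HOL-Library.Infinite_Set"
begin

text \<open>On a weight space \<open>U\<close>, the operators \<open>u \<mapsto> e_{-s} (d_j(s) u) - \<lambda>_j u\<close> satisfy the commutation
  relations of the vector fields \<open>(e_s - 1) \<partial>_j\<close>, which vanish at the identity of the torus.  Extending
  linearly from \<open>e_s\<close> to Laurent polynomials \<open>f\<close>, one obtains a finite-dimensional representation of the
  vector fields \<open>f \<partial>_j\<close> with \<open>f\<close> in the augmentation ideal.  In the coordinates \<open>z_i = t_i - 1\<close> the fields
  \<open>z_i \<partial>/\<partial>z_i\<close> act on \<open>z_i^a \<partial>/\<partial>z_j\<close> with eigenvalue growing with \<open>a\<close>, so the latter act by zero for
  large \<open>a\<close>, and a short bracket computation shows that all of \<open>z_i^a f \<partial>/\<partial>z_j\<close> do.  Modulo a power of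
  \<open>z_i\<close> the monomial \<open>t_i^s = (1 + z_i)^s\<close> is polynomial in \<open>s\<close>, whence the polynomial dependence on \<open>s\<close>.
  Comparing coefficients identifies the commutation relations of the vector fields with those of
  \<open>W_n\<^sup>+\<close>, in both directions.  Submodules and isomorphisms are graded by weights, so they are determined on
  a single weight space.  Finally, on an irreducible \<open>W_n\<^sup>+\<close>-module the vectors killed by all fields of
  degree at least two form a nonzero submodule, hence the action factors through \<open>gl_n\<close>.\<close>

section \<open>Linear algebra: eigencomponents, polynomial coefficients, finite dimension\<close>

section \<open>Vector spaces on carrier sets\<close>

text \<open>Two coordinates at the identity of the torus are at work. With t_i = exp w_i the field
  e_s \<partial>_j becomes exp(s.w) d/dw_j, whose Taylor series is the sum of s^\<alpha>/\<alpha>!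
  w^\<alpha> d/dw_j. This is the origin of the divided powers in the expansion, and it makes the
  relations of W_n^+ the coefficients of the relations between torus fields. But w_i is not a
  Laurent polynomial, so no operator w^\<alpha> d/dw_j is available beforehand; t_i - 1 is a Laurent
  polynomial with the same order of vanishing, and it serves to show that only finitely many
  coefficients survive. A second theme is the separation of eigencomponents: weights of the d_j,
  monomials in s under doubling of a coordinate, and eigenvalues of ad T are all isolated by the
  interpolation argument \<open>separate_coeffs\<close>. The grading of submodules, the uniqueness
  of coefficients and the finiteness bounds come from it.\<close>

locale cvec =
  fixes sc :: "complex \<Rightarrow> 'v::ab_group_add \<Rightarrow> 'v" and V :: "'v set"
  assumes cvs: "cvs sc V"
begin

lemma zero_mem [simp]: "0 \<in> V"
  and add_mem [simp]: "x \<in> V \<Longrightarrow> y \<in> V \<Longrightarrow> x + y \<in> V"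
  and scale_mem [simp]: "x \<in> V \<Longrightarrow> sc c x \<in> V"
  and scale_add: "x \<in> V \<Longrightarrow> y \<in> V \<Longrightarrow> sc c (x + y) = sc c x + sc c y"
  and scale_left_add: "x \<in> V \<Longrightarrow> sc (a + b) x = sc a x + sc b x"
  and scale_scale [simp]: "x \<in> V \<Longrightarrow> sc a (sc b x) = sc (a * b) x"
  and scale_one [simp]: "x \<in> V \<Longrightarrow> sc 1 x = x"
  using cvs unfolding cvs_def by simp_all

lemma scale_zero_left [simp]: "x \<in> V \<Longrightarrow> sc 0 x = 0"
  using scale_left_add[of x 0 0] by simp

lemma scale_zero_right [simp]: "sc c 0 = 0"
  using scale_add[of 0 0 c] by simp

lemma scale_minus_left [simp]: "x \<in> V \<Longrightarrow> sc (- a) x = - sc a x"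
  using scale_left_add[of x a "- a"] by (simp add: eq_neg_iff_add_eq_0 add.commute)

lemma minus_mem [simp]: "x \<in> V \<Longrightarrow> - x \<in> V"
  using scale_mem[of x "- 1"] by simp

lemma scale_minus_right [simp]: "x \<in> V \<Longrightarrow> sc a (- x) = - sc a x"
  using scale_add[of x "- x" a] by (simp add: eq_neg_iff_add_eq_0 add.commute)

lemma diff_mem [simp]: "x \<in> V \<Longrightarrow> y \<in> V \<Longrightarrow> x - y \<in> V"
  using add_mem[of x "- y"] by simp

lemma scale_diff: "x \<in> V \<Longrightarrow> y \<in> V \<Longrightarrow> sc c (x - y) = sc c x - sc c y"
  using scale_add[of x "- y" c] by simp

lemma scale_left_diff: "x \<in> V \<Longrightarrow> sc (a - b) x = sc a x - sc b x"
  using scale_left_add[of x a "- b"] by simp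

lemma sum_mem [simp]: "(\<And>i. i \<in> I \<Longrightarrow> f i \<in> V) \<Longrightarrow> sum f I \<in> V"
  by (induction I rule: infinite_finite_induct) auto

lemma scale_sum: "(\<And>i. i \<in> I \<Longrightarrow> f i \<in> V) \<Longrightarrow> sc c (sum f I) = (\<Sum>i\<in>I. sc c (f i))"
  by (induction I rule: infinite_finite_induct) (auto simp: scale_add)

lemma sum_scale: "x \<in> V \<Longrightarrow> sc (sum a I) x = (\<Sum>i\<in>I. sc (a i) x)"
  by (induction I rule: infinite_finite_induct) (auto simp: scale_left_add)

lemma scale_eq_0D: "x \<in> V \<Longrightarrow> sc c x = 0 \<Longrightarrow> c \<noteq> 0 \<Longrightarrow> x = 0"
  using scale_scale[of x "inverse c" c] by simp

lemma scale_memD: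
  assumes "x \<in> V" "cvs sc A" "sc c x \<in> A" "c \<noteq> 0"
  shows "x \<in> A"
proof -
  interpret A: cvec sc A by unfold_locales fact
  have "sc (inverse c) (sc c x) \<in> A" by (rule A.scale_mem) fact
  thus ?thesis using assms by simp
qed

lemma cvs_subset:
  assumes "A \<subseteq> V" "0 \<in> A" "\<And>x y. x \<in> A \<Longrightarrow> y \<in> A \<Longrightarrow> x + y \<in> A"
    "\<And>c x. x \<in> A \<Longrightarrow> sc c x \<in> A"
  shows "cvs sc A"
  unfolding cvs_def using assms
  by (auto simp: subset_iff scale_add scale_left_add)

lemma cvs_zero: "cvs sc {0}"
  by (rule cvs_subset) auto

lemma cspanI: "finite F \<Longrightarrow> F \<subseteq> S \<Longrightarrow> (\<Sum>x\<in>F. sc (c x) x) \<in> cspan sc S"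
  unfolding cspan_def by blast

lemma cspan_base: "x \<in> S \<Longrightarrow> x \<in> V \<Longrightarrow> x \<in> cspan sc S"
  using cspanI[of "{x}" S "\<lambda>_. 1"] by simp

lemma cspan_cvs:
  assumes S: "S \<subseteq> V"
  shows "cvs sc (cspan sc S)" "cspan sc S \<subseteq> V"
proof -
  show sub: "cspan sc S \<subseteq> V"
    using S by (auto simp: cspan_def subset_iff)
  show "cvs sc (cspan sc S)"
  proof (rule cvs_subset)
    show "cspan sc S \<subseteq> V" by fact
    show "0 \<in> cspan sc S" using cspanI[of "{}" S] by simp
  next
    fix x y assume "x \<in> cspan sc S" "y \<in> cspan sc S"
    then obtain F a G b where *: "finite F" "F \<subseteq> S" "x = (\<Sum>v\<in>F. sc (a v) v)"
      "finite G" "G \<subseteq> S" "y = (\<Sum>v\<in>G. sc (b v) v)" unfolding cspan_def by blast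
    let ?a = "\<lambda>v. if v \<in> F then a v else 0" and ?b = "\<lambda>v. if v \<in> G then b v else 0"
    have "x = (\<Sum>v\<in>F \<union> G. sc (?a v) v)" unfolding *
      by (rule sum.mono_neutral_cong_left) (use * S in auto)
    moreover have "y = (\<Sum>v\<in>F \<union> G. sc (?b v) v)" unfolding *
      by (rule sum.mono_neutral_cong_left) (use * S in auto)
    ultimately have "x + y = (\<Sum>v\<in>F \<union> G. sc (?a v + ?b v) v)"
      using * S by (simp add: sum.distrib[symmetric]) (intro sum.cong refl scale_left_add[symmetric], blast)
    thus "x + y \<in> cspan sc S" using cspanI[of "F \<union> G" S] * by auto
  next
    fix c x assume "x \<in> cspan sc S"
    then obtain F a where *: "finite F" "F \<subseteq> S" "x = (\<Sum>v\<in>F. sc (a v) v)"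
      unfolding cspan_def by blast
    have "sc c x = (\<Sum>v\<in>F. sc (c * a v) v)" unfolding *
      using * S by (subst scale_sum) (auto intro!: sum.cong simp: subset_iff)
    thus "sc c x \<in> cspan sc S" using cspanI[of F S] * by auto
  qed
qed

lemma cspan_least: "S \<subseteq> A \<Longrightarrow> cvs sc A \<Longrightarrow> cspan sc S \<subseteq> A"
proof -
  assume "S \<subseteq> A" "cvs sc A"
  then interpret A: cvec sc A by unfold_locales
  show ?thesis using \<open>S \<subseteq> A\<close> by (auto simp: cspan_def subset_iff)
qed

lemma clin_on_zero: "clin_on sc V sc' f \<Longrightarrow> f 0 = 0"
  unfolding clin_on_def using zero_mem by (metis add_cancel_right_right add_0)

lemma clin_on_add: "clin_on sc V sc' f \<Longrightarrow> x \<in> V \<Longrightarrow> y \<in> V \<Longrightarrow> f (x + y) = f x + f y"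
  unfolding clin_on_def by blast

lemma clin_on_scale: "clin_on sc V sc' f \<Longrightarrow> x \<in> V \<Longrightarrow> f (sc c x) = sc' c (f x)"
  unfolding clin_on_def by blast

lemma clin_on_diff: "clin_on sc V sc' f \<Longrightarrow> x \<in> V \<Longrightarrow> y \<in> V \<Longrightarrow> f (x - y) = f x - f y"
  using clin_on_add[of sc' f "x - y" y] by (simp add: eq_diff_eq)

lemma clin_on_sum:
  "clin_on sc V sc' f \<Longrightarrow> (\<And>i. i \<in> I \<Longrightarrow> x i \<in> V) \<Longrightarrow> f (sum x I) = (\<Sum>i\<in>I. f (x i))"
  by (induction I rule: infinite_finite_induct) (auto simp: clin_on_zero clin_on_add)

lemma clin_on_lincomb:
  "clin_on sc V sc' f \<Longrightarrow> (\<And>i. i \<in> I \<Longrightarrow> x i \<in> V) \<Longrightarrow>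
    f (\<Sum>i\<in>I. sc (c i) (x i)) = (\<Sum>i\<in>I. sc' (c i) (f (x i)))"
  by (subst clin_on_sum) (auto simp: clin_on_scale)

end

subsection \<open>Separating eigencomponents\<close>

text \<open>Lagrange interpolation: the factor (\<open>\<chi> t\<close> - \<open>\<chi> t k\<close>)
  / (\<open>\<chi> t i\<close> - \<open>\<chi> t k\<close>) kills the entry k and keeps the entry i,
  so the entries in G are removed one at a time. In the applications \<open>M\<close> consists of
  the coefficient vectors whose linear combination lies in a given subspace.\<close>

lemma separate_coeffs:
  fixes \<chi> :: "'t \<Rightarrow> 'i \<Rightarrow> complex" and M :: "('i \<Rightarrow> complex) set"
  assumes add: "\<And>a b. a \<in> M \<Longrightarrow> b \<in> M \<Longrightarrow> (\<lambda>i. a i + b i) \<in> M"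
    and scale: "\<And>c a. a \<in> M \<Longrightarrow> (\<lambda>i. c * a i) \<in> M"
    and mult: "\<And>t a. a \<in> M \<Longrightarrow> (\<lambda>i. \<chi> t i * a i) \<in> M"
    and c: "c \<in> M"
    and G: "finite G" "\<And>k. k \<in> G \<Longrightarrow> \<exists>t. \<chi> t k \<noteq> \<chi> t i"
  shows "\<exists>a\<in>M. a i = c i \<and> (\<forall>k\<in>G. a k = 0)"
  using G
proof (induction G rule: finite_induct)
  case empty
  then show ?case using c by auto
next
  case (insert k G)
  then obtain a where a: "a \<in> M" "a i = c i" "\<forall>k\<in>G. a k = 0" by auto
  obtain t where t: "\<chi> t k \<noteq> \<chi> t i" using insert by blast
  let ?b = "\<lambda>l. 1 / (\<chi> t i - \<chi> t k) * (\<chi> t l * a l + (- \<chi> t k) * a l)"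
  have "?b \<in> M" by (intro scale add mult a(1))
  moreover have "?b i = c i" using t a by (simp add: field_simps)
  moreover have "\<forall>l\<in>insert k G. ?b l = 0" using a by auto
  ultimately show ?case by (intro bexI[of _ ?b] conjI)
qed

context cvec
begin

text \<open>Applying \<open>T t\<close> to a linear combination of the \<open>x i\<close> multiplies
  its coefficient vector by \<open>\<chi> t\<close>, so the coefficient vectors of elements of
  \<open>A\<close> form a set to which \<open>separate_coeffs\<close> applies.\<close>

lemma eigen_component_mem:
  fixes \<chi> :: "'t \<Rightarrow> 'i \<Rightarrow> complex"
  assumes A: "A \<subseteq> V" "cvs sc A"
    and lin: "\<And>t. clin_on sc V sc (T t)" and inv: "\<And>t y. y \<in> A \<Longrightarrow> T t y \<in> A"
    and F: "finite F" "\<And>i. i \<in> F \<Longrightarrow> x i \<in> V"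
    and eig: "\<And>t i. i \<in> F \<Longrightarrow> T t (x i) = sc (\<chi> t i) (x i)"
    and sum: "(\<Sum>i\<in>F. x i) \<in> A"
    and i: "i \<in> F" and sep: "\<And>k. k \<in> F \<Longrightarrow> k \<noteq> i \<Longrightarrow> \<exists>t. \<chi> t k \<noteq> \<chi> t i"
  shows "x i \<in> A"
proof -
  interpret A: cvec sc A by unfold_locales fact
  let ?M = "{a. (\<Sum>i\<in>F. sc (a i) (x i)) \<in> A}"
  have "\<exists>a\<in>?M. a i = 1 \<and> (\<forall>k\<in>F - {i}. a k = 0)"
  proof (rule separate_coeffs[where \<chi> = \<chi> and c = "\<lambda>_. 1"])
    fix a b assume ab: "a \<in> ?M" "b \<in> ?M"
    have "(\<Sum>i\<in>F. sc (a i + b i) (x i)) = (\<Sum>i\<in>F. sc (a i) (x i)) + (\<Sum>i\<in>F. sc (b i) (x i))"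
      unfolding sum.distrib[symmetric] by (intro sum.cong refl scale_left_add F)
    then show "(\<lambda>i. a i + b i) \<in> ?M" using ab A.add_mem by simp
  next
    fix c a assume a: "a \<in> ?M"
    have "(\<Sum>i\<in>F. sc (c * a i) (x i)) = sc c (\<Sum>i\<in>F. sc (a i) (x i))"
      by (subst scale_sum) (auto simp: F)
    then show "(\<lambda>i. c * a i) \<in> ?M" using a A.scale_mem by simp
  next
    fix t a assume a: "a \<in> ?M"
    have "T t (\<Sum>i\<in>F. sc (a i) (x i)) = (\<Sum>i\<in>F. sc (\<chi> t i * a i) (x i))"
      using F by (subst clin_on_lincomb[OF lin]) (auto simp: eig mult.commute intro!: sum.cong)
    moreover have "T t (\<Sum>i\<in>F. sc (a i) (x i)) \<in> A" using a by (intro inv) simp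
    ultimately show "(\<lambda>i. \<chi> t i * a i) \<in> ?M" by simp
  next
    have "(\<Sum>i\<in>F. sc 1 (x i)) = (\<Sum>i\<in>F. x i)" by (intro sum.cong refl scale_one F)
    then show "(\<lambda>_. 1) \<in> ?M" using sum by simp
  qed (use F sep in auto)
  then obtain a where a: "(\<Sum>i\<in>F. sc (a i) (x i)) \<in> A" "a i = 1" "\<forall>k\<in>F - {i}. a k = 0" by blast
  have "(\<Sum>i\<in>F. sc (a i) (x i)) = (\<Sum>k\<in>{i}. sc (a k) (x k))"
    by (rule sum.mono_neutral_right) (use F i a in auto)
  then show ?thesis using a F i by simp
qed

text \<open>Doubling the coordinate s_i multiplies s^\<alpha> by 2^(\<alpha>_i), so dilations act on
  monomials like commuting diagonal operators, and distinct exponents have distinct eigenvalues.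
  Since the hypothesis holds for every s, it is stable under these substitutions.\<close>

lemma poly_coeff_mem:
  fixes c :: "('n::finite \<Rightarrow> nat) \<Rightarrow> 'v"
  assumes A: "A \<subseteq> V" "cvs sc A"
    and F: "finite F" "\<And>\<alpha>. \<alpha> \<in> F \<Longrightarrow> c \<alpha> \<in> V"
    and sum: "\<And>s::'n \<Rightarrow> int. (\<Sum>\<alpha>\<in>F. sc (mono s \<alpha>) (c \<alpha>)) \<in> A"
    and \<alpha>: "\<alpha> \<in> F"
  shows "c \<alpha> \<in> A"
proof -
  interpret A: cvec sc A by unfold_locales fact
  let ?M = "{a. \<forall>s::'n \<Rightarrow> int. (\<Sum>\<alpha>\<in>F. sc (a \<alpha> * mono s \<alpha>) (c \<alpha>)) \<in> A}"
  let ?\<chi> = "\<lambda>i \<alpha>. 2 ^ \<alpha> i :: complex"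
  have double: "mono (\<lambda>k. if k = i then 2 * s k else s k) \<beta> = 2 ^ \<beta> i * mono s \<beta>"
    for i and s :: "'n \<Rightarrow> int" and \<beta>
  proof -
    have "mono (\<lambda>k. if k = i then 2 * s k else s k) \<beta>
        = (\<Prod>k\<in>UNIV. (if k = i then 2 ^ \<beta> i else 1) * of_int (s k) ^ \<beta> k)"
      unfolding mono_def by (intro prod.cong) (auto simp: power_mult_distrib)
    then show ?thesis by (simp add: prod.distrib mono_def)
  qed
  have "\<exists>a\<in>?M. a \<alpha> = 1 \<and> (\<forall>k\<in>F - {\<alpha>}. a k = 0)"
  proof (rule separate_coeffs[where \<chi> = ?\<chi> and c = "\<lambda>_. 1"])
    fix a b assume ab: "a \<in> ?M" "b \<in> ?M"
    have "(\<Sum>i\<in>F. sc ((a i + b i) * mono s i) (c i)) = (\<Sum>i\<in>F. sc (a i * mono s i) (c i))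
        + (\<Sum>i\<in>F. sc (b i * mono s i) (c i))" for s
      unfolding sum.distrib[symmetric] distrib_right by (intro sum.cong refl scale_left_add F)
    then show "(\<lambda>i. a i + b i) \<in> ?M" using ab A.add_mem by simp
  next
    fix r a assume a: "a \<in> ?M"
    have "(\<Sum>i\<in>F. sc (r * a i * mono s i) (c i)) = sc r (\<Sum>i\<in>F. sc (a i * mono s i) (c i))" for s
      by (subst scale_sum) (auto simp: F mult.assoc)
    then show "(\<lambda>i. r * a i) \<in> ?M" using a A.scale_mem by simp
  next
    fix t a assume a: "a \<in> ?M"
    show "(\<lambda>\<alpha>. ?\<chi> t \<alpha> * a \<alpha>) \<in> ?M"
    proof safe
      fix s :: "'n \<Rightarrow> int"
      have "(\<Sum>\<alpha>\<in>F. sc (a \<alpha> * mono (\<lambda>k. if k = t then 2 * s k else s k) \<alpha>) (c \<alpha>)) \<in> A"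
        using a by blast
      then show "(\<Sum>\<alpha>\<in>F. sc (2 ^ \<alpha> t * a \<alpha> * mono s \<alpha>) (c \<alpha>)) \<in> A"
        by (simp add: double mult.left_commute mult.assoc)
    qed
  next
    show "\<exists>t. 2 ^ k t \<noteq> (2 ^ \<alpha> t :: complex)" if "k \<in> F - {\<alpha>}" for k
    proof -
      from that have "k \<noteq> \<alpha>" by auto
      then obtain t where "k t \<noteq> \<alpha> t" by (auto simp: fun_eq_iff)
      moreover have "(2::nat) ^ k t = 2 ^ \<alpha> t" if "(2::complex) ^ k t = 2 ^ \<alpha> t"
        using that by (metis of_nat_eq_iff of_nat_numeral of_nat_power)
      ultimately show ?thesis by auto
    qed
  qed (use F sum in auto)
  then obtain a where a: "a \<in> ?M" "a \<alpha> = 1" "\<forall>k\<in>F - {\<alpha>}. a k = 0" by blast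
  \<comment> \<open>Evaluation at s = (1,...,1) turns every monomial into 1 and leaves the isolated
    coefficient.\<close>
  have "(\<Sum>\<beta>\<in>F. sc (a \<beta> * mono (\<lambda>_. 1) \<beta>) (c \<beta>)) = (\<Sum>k\<in>{\<alpha>}. sc (a k * mono (\<lambda>_. 1) k) (c k))"
    by (rule sum.mono_neutral_right) (use F \<alpha> a in auto)
  also have "\<dots> = c \<alpha>" using a F \<alpha> by (simp add: mono_def)
  finally show ?thesis using a(1) by (auto dest!: spec[of _ "\<lambda>_. 1"])
qed

end

subsection \<open>Finite dimension\<close>

text \<open>Gaussian elimination of one coordinate with a pivot \<open>b\<close>, by induction on
  the number of coordinates.\<close>

lemma linear_dependence:
  fixes v :: "'a \<Rightarrow> 'i \<Rightarrow> complex"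
  assumes "finite I" "finite F" "card F > card I"
  shows "\<exists>c. (\<exists>a\<in>F. c a \<noteq> 0) \<and> (\<forall>i\<in>I. (\<Sum>a\<in>F. c a * v a i) = 0)"
  using assms
proof (induction I arbitrary: F v rule: finite_induct)
  case empty
  then have "F \<noteq> {}" by auto
  then show ?case by (intro exI[of _ "\<lambda>_. 1"]) auto
next
  case (insert i I)
  show ?case
  proof (cases "\<forall>a\<in>F. v a i = 0")
    case True
    have "card I < card F" using insert.prems insert.hyps by simp
    then obtain c where "\<exists>a\<in>F. c a \<noteq> 0" "\<forall>i\<in>I. (\<Sum>a\<in>F. c a * v a i) = 0"
      using insert.IH[OF insert.prems(1)] by blast
    then show ?thesis using True by (intro exI[of _ c]) auto
  next
    case False
    then obtain b where b: "b \<in> F" "v b i \<noteq> 0" by auto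
    let ?F = "F - {b}" and ?v = "\<lambda>a k. v a k - v a i / v b i * v b k"
    have "finite ?F" "card I < card ?F" using insert.prems insert.hyps b by simp_all
    then obtain c where c: "\<exists>a\<in>?F. c a \<noteq> 0" "\<forall>k\<in>I. (\<Sum>a\<in>?F. c a * ?v a k) = 0"
      using insert.IH[of ?F ?v] by blast
    \<comment> \<open>The coefficient of the pivot is chosen so that the coordinate i of the
      combination vanishes.\<close>
    define c' where "c' = c(b := - (\<Sum>a\<in>?F. c a * v a i) / v b i)"
    have eq: "(\<Sum>a\<in>F. c' a * v a k) = (\<Sum>a\<in>?F. c a * ?v a k)" for k
    proof -
      have "(\<Sum>a\<in>F. c' a * v a k) = c' b * v b k + (\<Sum>a\<in>?F. c' a * v a k)"
        using b insert.prems by (simp add: sum.remove)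
      also have "(\<Sum>a\<in>?F. c' a * v a k) = (\<Sum>a\<in>?F. c a * v a k)"
        by (intro sum.cong) (auto simp: c'_def)
      also have "c' b * v b k = - (\<Sum>a\<in>?F. c a * (v a i / v b i * v b k))"
        by (simp add: c'_def sum_distrib_right sum_divide_distrib sum_negf[symmetric] mult.assoc)
      finally show ?thesis by (simp add: right_diff_distrib sum_subtractf)
    qed
    have "(\<Sum>a\<in>?F. c a * ?v a i) = 0" using b by simp
    then show ?thesis using c eq
      by (intro exI[of _ c']) (auto simp: c'_def)
  qed
qed

context cvec
begin

text \<open>Eigenvectors of ad T for distinct eigenvalues are linearly independent, and End V has
  finite dimension, so only finitely many natural numbers are eigenvalues. The bound depends on T
  alone and holds for all X at once.\<close>

lemma ad_eigen_vanish:
  assumes fd: "findim sc V"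
    and T: "\<And>x. x \<in> V \<Longrightarrow> T x \<in> V" "clin_on sc V sc T"
  obtains N :: nat where
    "\<And>a X. N \<le> a \<Longrightarrow> (\<And>x. x \<in> V \<Longrightarrow> X x \<in> V) \<Longrightarrow> clin_on sc V sc X \<Longrightarrow>
      (\<And>x. x \<in> V \<Longrightarrow> T (X x) - X (T x) = sc (of_nat a) (X x)) \<Longrightarrow> \<forall>x\<in>V. X x = 0"
proof (rule ccontr)
  define P where "P a X \<longleftrightarrow> (\<forall>x\<in>V. X x \<in> V) \<and> clin_on sc V sc X \<and>
    (\<forall>x\<in>V. T (X x) - X (T x) = sc (of_nat a) (X x)) \<and> (\<exists>x\<in>V. X x \<noteq> 0)" for a :: nat and X
  assume "\<not> thesis"
  then have "\<exists>a\<ge>N. \<exists>X. P a X" for N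
    unfolding P_def using that[of N] by blast
  then have "infinite {a. \<exists>X. P a X}"
    unfolding infinite_nat_iff_unbounded_le by auto
  define X where "X a = (SOME X. P a X)" for a
  have X: "P a (X a)" if "\<exists>X. P a X" for a
    unfolding X_def by (rule someI_ex[of "P a"]) fact
  obtain S where S: "finite S" "S \<subseteq> V" "V \<subseteq> cspan sc S" using fd unfolding findim_def by blast
  \<comment> \<open>The spanning set \<open>S\<close> may be dependent, so \<open>co\<close> merely
    chooses some coordinates of each vector.\<close>
  have repr: "\<exists>c. \<forall>x\<in>V. x = (\<Sum>b\<in>S. sc (c x b) b)"
  proof -
    have "\<exists>c. x = (\<Sum>b\<in>S. sc (c b) b)" if x: "x \<in> V" for x
    proof -
      obtain F c where *: "finite F" "F \<subseteq> S" "x = (\<Sum>v\<in>F. sc (c v) v)"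
        using subsetD[OF S(3) x] unfolding cspan_def by blast
      have "x = (\<Sum>v\<in>S. sc (if v \<in> F then c v else 0) v)" unfolding *
        by (rule sum.mono_neutral_cong_left) (use * S in auto)
      then show ?thesis by (intro exI[of _ "\<lambda>v. if v \<in> F then c v else 0"])
    qed
    then show ?thesis
      using bchoice[of V "\<lambda>x c. x = (\<Sum>b\<in>S. sc (c b) b)"] by blast
  qed
  then obtain co where co: "\<And>x. x \<in> V \<Longrightarrow> x = (\<Sum>b\<in>S. sc (co x b) b)" by blast
  \<comment> \<open>One operator more than there are matrix entries with respect to
    \<open>S\<close>; this forces a linear relation.\<close>
  obtain F where F: "finite F" "F \<subseteq> {a. \<exists>X. P a X}" "card F = Suc (card (S \<times> S))"
    using infinite_arbitrarily_large[OF \<open>infinite _\<close>] by blast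
  have XV: "X a x \<in> V" and Xlin: "clin_on sc V sc (X a)"
    and XT: "T (X a x) - X a (T x) = sc (of_nat a) (X a x)" if "a \<in> F" "x \<in> V" for a x
    using X[of a] F that unfolding P_def by auto
  obtain c where c: "\<exists>a\<in>F. c a \<noteq> 0" "\<forall>i\<in>S \<times> S. (\<Sum>a\<in>F. c a * co (X a (fst i)) (snd i)) = 0"
    using linear_dependence[of "S \<times> S" F "\<lambda>a i. co (X a (fst i)) (snd i)"] F S by auto
  let ?M = "{m. \<forall>x\<in>V. (\<Sum>a\<in>F. sc (m a) (X a x)) = 0}"
  have cS: "(\<Sum>a\<in>F. sc (c a) (X a s)) = 0" if s: "s \<in> S" for s
  proof -
    have "(\<Sum>a\<in>F. sc (c a) (X a s)) = (\<Sum>a\<in>F. \<Sum>b\<in>S. sc (c a * co (X a s) b) b)"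
    proof (rule sum.cong[OF refl])
      fix a assume "a \<in> F"
      have "sc (c a) (X a s) = sc (c a) (\<Sum>b\<in>S. sc (co (X a s) b) b)"
        using co[of "X a s"] XV[of a s] \<open>a \<in> F\<close> s S by auto
      also have "\<dots> = (\<Sum>b\<in>S. sc (c a * co (X a s) b) b)"
        using S by (subst scale_sum) (auto intro!: sum.cong)
      finally show "sc (c a) (X a s) = (\<Sum>b\<in>S. sc (c a * co (X a s) b) b)" .
    qed
    also have "\<dots> = (\<Sum>b\<in>S. sc (\<Sum>a\<in>F. c a * co (X a s) b) b)"
      by (subst sum.swap) (use S in \<open>auto intro!: sum.cong simp: sum_scale\<close>)
    also have "\<dots> = 0" using c s S by (auto intro!: sum.neutral)
    finally show ?thesis .
  qed
  have cM: "c \<in> ?M"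
  proof safe
    fix x assume x: "x \<in> V"
    have "(\<Sum>a\<in>F. sc (c a) (X a x)) = (\<Sum>a\<in>F. \<Sum>s\<in>S. sc (c a * co x s) (X a s))"
    proof (rule sum.cong[OF refl])
      fix a assume a: "a \<in> F"
      have "X a x = X a (\<Sum>s\<in>S. sc (co x s) s)" using co[OF x] by simp
      also have "\<dots> = (\<Sum>s\<in>S. sc (co x s) (X a s))"
        using S by (intro clin_on_lincomb[OF Xlin[OF a x]]) auto
      finally show "sc (c a) (X a x) = (\<Sum>s\<in>S. sc (c a * co x s) (X a s))"
        using S XV[OF a] by (simp add: scale_sum subset_iff)
    qed
    also have "\<dots> = (\<Sum>s\<in>S. sc (co x s) (\<Sum>a\<in>F. sc (c a) (X a s)))"
      by (subst sum.swap) (use S XV in \<open>auto intro!: sum.cong simp: scale_sum mult.commute subset_iff\<close>)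
    also have "\<dots> = 0" using cS by simp
    finally show "(\<Sum>a\<in>F. sc (c a) (X a x)) = 0" .
  qed
  obtain i where i: "i \<in> F" "c i \<noteq> 0" using c by blast
  \<comment> \<open>Applying ad T to a linear relation multiplies the coefficient of
    \<open>X i\<close> by i. Interpolation therefore isolates one term of the relation, and that
    operator would be zero.\<close>
  have "\<exists>a\<in>?M. a i = c i \<and> (\<forall>k\<in>F - {i}. a k = 0)"
  proof (rule separate_coeffs[where \<chi> = "\<lambda>_::unit. of_nat" and c = c])
    fix a b assume ab: "a \<in> ?M" "b \<in> ?M"
    have "(\<Sum>i\<in>F. sc (a i + b i) (X i x)) = (\<Sum>i\<in>F. sc (a i) (X i x)) + (\<Sum>i\<in>F. sc (b i) (X i x))"
      if "x \<in> V" for x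
      unfolding sum.distrib[symmetric] by (intro sum.cong refl scale_left_add XV that)
    then show "(\<lambda>i. a i + b i) \<in> ?M" using ab by simp
  next
    fix r a assume a: "a \<in> ?M"
    have "(\<Sum>i\<in>F. sc (r * a i) (X i x)) = sc r (\<Sum>i\<in>F. sc (a i) (X i x))" if "x \<in> V" for x
      using that XV by (subst scale_sum) auto
    then show "(\<lambda>i. r * a i) \<in> ?M" using a by simp
  next
    fix a assume a: "a \<in> ?M"
    show "(\<lambda>i. of_nat i * a i) \<in> ?M"
    proof safe
      fix x assume x: "x \<in> V"
      have "(\<Sum>i\<in>F. sc (of_nat i * a i) (X i x))
          = (\<Sum>i\<in>F. sc (a i) (T (X i x)) - sc (a i) (X i (T x)))"
      proof (rule sum.cong[OF refl])
        fix i assume i: "i \<in> F"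
        have "sc (of_nat i * a i) (X i x) = sc (a i) (sc (of_nat i) (X i x))"
          using XV[OF i x] by (simp add: mult.commute)
        also have "\<dots> = sc (a i) (T (X i x) - X i (T x))" using XT[OF i x] by simp
        finally show "sc (of_nat i * a i) (X i x) = sc (a i) (T (X i x)) - sc (a i) (X i (T x))"
          using XV i x T by (simp add: scale_diff)
      qed
      also have "\<dots> = T (\<Sum>i\<in>F. sc (a i) (X i x)) - (\<Sum>i\<in>F. sc (a i) (X i (T x)))"
        using XV x by (simp add: sum_subtractf clin_on_lincomb[OF T(2)])
      also have "\<dots> = 0" using a x T by (simp add: clin_on_zero[OF T(2)])
      finally show "(\<Sum>i\<in>F. sc (of_nat i * a i) (X i x)) = 0" .
    qed
  qed (use F cM in auto)
  then obtain a where a: "a \<in> ?M" "a i = c i" "\<forall>k\<in>F - {i}. a k = 0" by blast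
  have "X i x = 0" if x: "x \<in> V" for x
  proof -
    have "(\<Sum>k\<in>F. sc (a k) (X k x)) = (\<Sum>k\<in>{i}. sc (a k) (X k x))"
      by (rule sum.mono_neutral_right) (use F i a XV x in auto)
    then have "sc (c i) (X i x) = 0" using a x by simp
    then show ?thesis using scale_eq_0D XV i x by blast
  qed
  then show False using X[of i] i F unfolding P_def by blast
qed

end

section \<open>Functions on the torus and truncated binomial series\<close>

section \<open>Laurent polynomials\<close>

type_synonym 'n laurent = "('n \<Rightarrow> int) \<Rightarrow>\<^sub>0 complex"

lemma laurent_induct [case_names single add]:
  fixes p :: "'n laurent"
  assumes single: "\<And>s c. P (Poly_Mapping.single s c)"
    and add: "\<And>p q. P p \<Longrightarrow> P q \<Longrightarrow> P (p + q)"
  shows "P p"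
proof (induction p rule: Poly_Mapping.update_induct)
  case const
  show ?case using single[of 0 0] by simp
next
  case (update f a b)
  have "Poly_Mapping.update a b f = Poly_Mapping.single a b + f"
    using update(1) by (intro poly_mapping_eqI)
      (auto simp: lookup_update lookup_add lookup_single in_keys_iff when_def)
  then show ?case using add[OF single update(3)] by simp
qed

definition unit_vec :: "'n \<Rightarrow> 'n \<Rightarrow> int" where
  "unit_vec i = (\<lambda>k. if k = i then 1 else 0)"

definition tvar :: "'n \<Rightarrow> 'n laurent" where
  "tvar i = Poly_Mapping.single (unit_vec i) 1"

definition tinv :: "'n \<Rightarrow> 'n laurent" where
  "tinv i = Poly_Mapping.single (- unit_vec i) 1"

definition zvar :: "'n \<Rightarrow> 'n laurent" where
  "zvar i = tvar i - 1"

definition cst :: "complex \<Rightarrow> 'n laurent" where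
  "cst c = Poly_Mapping.single 0 c"

text \<open>The invariant derivation t_i d/dt_i. The coordinate derivation d/dz_i for z_i = t_i - 1
  is \<open>tinv i\<close> times it.\<close>

definition deriv :: "'n \<Rightarrow> 'n laurent \<Rightarrow> 'n laurent" where
  "deriv i = Poly_Mapping.mapp (\<lambda>s c. of_int (s i) * c)"

text \<open>Evaluation at the identity t = (1,...,1) of the torus.\<close>

definition aug :: "'n laurent \<Rightarrow> complex" where
  "aug p = (\<Sum>s\<in>Poly_Mapping.keys p. Poly_Mapping.lookup p s)"

lemma lookup_deriv: "Poly_Mapping.lookup (deriv i p) s = of_int (s i) * Poly_Mapping.lookup p s"
  by (simp add: deriv_def lookup_mapp when_def in_keys_iff)

lemma deriv_add [simp]: "deriv i (p + q) = deriv i p + deriv i q"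
  by (intro poly_mapping_eqI) (simp add: lookup_deriv lookup_add algebra_simps)

lemma deriv_diff [simp]: "deriv i (p - q) = deriv i p - deriv i q"
  by (intro poly_mapping_eqI) (simp add: lookup_deriv lookup_minus algebra_simps)

lemma deriv_single: "deriv i (Poly_Mapping.single s c) = Poly_Mapping.single s (of_int (s i) * c)"
  by (intro poly_mapping_eqI) (simp add: lookup_deriv lookup_single when_def)

lemma deriv_mult: "deriv i (p * q) = deriv i p * q + p * deriv i q"
proof (induction p rule: laurent_induct)
  case (single s c)
  show ?case
  proof (induction q rule: laurent_induct)
    case (single m b)
    show ?case by (simp add: mult_single deriv_single single_add[symmetric] algebra_simps)
  qed (simp add: algebra_simps)
qed (simp add: algebra_simps)

lemma deriv_one [simp]: "deriv i 1 = 0"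
  using deriv_single[of i 0 1] by simp

lemma deriv_power_Suc: "deriv i (p ^ Suc n) = of_nat (Suc n) * p ^ n * deriv i p"
  by (induction n) (simp_all add: deriv_mult algebra_simps)

lemma tvar_tinv [simp]: "tvar i * tinv i = 1" "tinv i * tvar i = 1"
  by (simp_all add: tvar_def tinv_def mult_single)

lemma deriv_tvar: "deriv i (tvar j) = (if i = j then tvar j else 0)"
  by (simp add: tvar_def deriv_single unit_vec_def)

lemma deriv_tinv: "deriv i (tinv j) = (if i = j then - tinv j else 0)"
  by (simp add: tinv_def deriv_single unit_vec_def single_uminus)

lemma deriv_zvar: "deriv i (zvar j) = (if i = j then tvar j else 0)"
  by (simp add: zvar_def deriv_tvar)

lemma aug_superset: "finite S \<Longrightarrow> Poly_Mapping.keys p \<subseteq> S \<Longrightarrow> aug p = (\<Sum>s\<in>S. Poly_Mapping.lookup p s)"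
  unfolding aug_def by (rule sum.mono_neutral_left) (auto simp: in_keys_iff)

lemma aug_single [simp]: "aug (Poly_Mapping.single s c) = c"
  by (subst aug_superset[of "{s}"]) auto

lemma aug_add [simp]: "aug (p + q) = aug p + aug q"
proof -
  let ?S = "Poly_Mapping.keys p \<union> Poly_Mapping.keys q"
  have "aug (p + q) = (\<Sum>s\<in>?S. Poly_Mapping.lookup (p + q) s)"
    by (rule aug_superset) (use Poly_Mapping.keys_add[of p q] in auto)
  then show ?thesis
    by (simp add: lookup_add sum.distrib aug_superset[of ?S p] aug_superset[of ?S q])
qed

lemma aug_diff [simp]: "aug (p - q) = aug p - aug q"
  using aug_add[of "p - q" q] by simp

lemma aug_mult [simp]: "aug (p * q) = aug p * aug q"
proof (induction p rule: laurent_induct)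
  case (single s c)
  show ?case
    by (induction q rule: laurent_induct) (simp_all add: mult_single algebra_simps)
qed (simp add: algebra_simps)

lemma aug_zvar [simp]: "aug (zvar i) = 0"
  using aug_single[of 0 1] by (simp add: zvar_def tvar_def del: aug_single single_one) (simp)

lemma cst_one [simp]: "cst 1 = 1" and cst_zero [simp]: "cst 0 = 0"
  by (simp_all add: cst_def)

lemma cst_add: "cst (a + b) = cst a + cst b"
  by (simp add: cst_def single_add)

lemma cst_mult: "cst (a * b) = cst a * cst b"
  by (simp add: cst_def mult_single)

lemma cst_sum: "cst (sum f A) = (\<Sum>a\<in>A. cst (f a))"
  by (induction A rule: infinite_finite_induct) (auto simp: cst_add)

lemma cst_prod: "cst (prod f A) = (\<Prod>a\<in>A. cst (f a))"
  by (induction A rule: infinite_finite_induct) (auto simp: cst_mult)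

lemma cst_of_nat: "cst (of_nat n) = of_nat n"
  by (simp add: cst_def)

lemma prod_single:
  "finite A \<Longrightarrow> (\<Prod>i\<in>A. Poly_Mapping.single (f i) 1) = (Poly_Mapping.single (sum f A) 1 :: 'n laurent)"
proof (induction A rule: finite_induct)
  case empty
  show ?case by (simp only: sum.empty prod.empty single_one)
next
  case (insert x A)
  show ?case by (simp only: prod.insert[OF insert.hyps] sum.insert[OF insert.hyps] insert.IH mult_single mult_1)
qed

lemma prod_tvar_powers:
  fixes s :: "'n::finite \<Rightarrow> int"
  shows "(\<Prod>i\<in>UNIV. Poly_Mapping.single (\<lambda>k. s i * unit_vec i k) 1)
    = (Poly_Mapping.single s 1 :: 'n laurent)"
proof -
  have "sum f A k = (\<Sum>i\<in>A. f i k)" if "finite A" for f :: "'n \<Rightarrow> 'n \<Rightarrow> int" and A k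
    using that by (induction A rule: finite_induct) auto
  then have "(\<Sum>i\<in>UNIV. (\<lambda>k. s i * unit_vec i k)) = s"
    by (auto simp: fun_eq_iff unit_vec_def if_distrib sum.delta cong: if_cong)
  then show ?thesis by (simp add: prod_single)
qed

text \<open>The recursion (k+1) C(x,k+1) = (x-k) C(x,k), read off on coefficients.\<close>

lemma gchoose_coeffs:
  "\<exists>c. (\<forall>l>k. c l = 0) \<and> (\<forall>x::complex. x gchoose k = (\<Sum>l\<le>k. c l * x ^ l))"
proof (induction k)
  case 0
  show ?case by (intro exI[of _ "\<lambda>l. if l = 0 then 1 else 0"]) auto
next
  case (Suc k)
  then obtain c where c: "\<forall>l>k. c l = 0" "\<forall>x::complex. x gchoose k = (\<Sum>l\<le>k. c l * x ^ l)" by blast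
  let ?c = "\<lambda>l. ((if l = 0 then 0 else c (l - 1)) - of_nat k * c l) / of_nat (Suc k)"
  have "x gchoose Suc k = (\<Sum>l\<le>Suc k. ?c l * x ^ l)" for x :: complex
  proof -
    have "(\<Sum>l\<le>Suc k. ?c l * x ^ l) * of_nat (Suc k)
        = (\<Sum>l\<le>Suc k. (if l = 0 then 0 else c (l - 1)) * x ^ l) - of_nat k * (\<Sum>l\<le>Suc k. c l * x ^ l)"
      by (simp only: sum_distrib_right sum_distrib_left sum_subtractf[symmetric])
        (intro sum.cong refl, simp add: field_simps del: of_nat_Suc)
    also have "(\<Sum>l\<le>Suc k. (if l = 0 then 0 else c (l - 1)) * x ^ l) = x * (\<Sum>l\<le>k. c l * x ^ l)"
      by (simp add: sum.atMost_Suc_shift del: sum.atMost_Suc)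
        (simp add: sum_distrib_left mult.left_commute)
    also have "(\<Sum>l\<le>Suc k. c l * x ^ l) = (\<Sum>l\<le>k. c l * x ^ l)" using c by simp
    finally have "(\<Sum>l\<le>Suc k. ?c l * x ^ l) * of_nat (Suc k) = (x - of_nat k) * (x gchoose k)"
      using c by (simp add: algebra_simps)
    also have "\<dots> = (x gchoose Suc k) * of_nat (Suc k)"
      using gbinomial_mult_1[of x k] by (simp add: algebra_simps)
    finally have "(\<Sum>l\<le>Suc k. ?c l * x ^ l) * of_nat (Suc k) = (x gchoose Suc k) * of_nat (Suc k)" .
    from mult_right_cancel[OF of_nat_neq_0, THEN iffD1, OF this] show ?thesis by (rule sym)
  qed
  then show ?case using c by (intro exI[of _ ?c]) auto
qed

text \<open>Pascal's rule: truncated at degree n, the series of (1+z)^x and (1+z)^(x+1) differ by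
  the factor 1+z up to a single term of degree n+1. The exponent x is arbitrary, so negative powers
  are covered.\<close>

lemma truncated_binomial_step:
  fixes z :: "'n laurent"
  shows "(1 + z) * (\<Sum>k<Suc n. cst (x gchoose k) * z ^ k) - (\<Sum>k<Suc n. cst ((x + 1) gchoose k) * z ^ k)
    = cst (x gchoose n) * z ^ Suc n"
proof (induction n)
  case 0
  show ?case by simp
next
  case (Suc n)
  have "(x + 1) gchoose Suc n = (x gchoose n) + (x gchoose Suc n)"
    by (rule gbinomial_Suc_Suc)
  then show ?case using Suc by (simp add: cst_add algebra_simps)
qed

section \<open>Nilpotence of z_i and polynomial dependence on s\<close>

section \<open>Vector fields vanishing at a point of the torus\<close>

text \<open>The commutation relation says that \<open>D j s\<close> represents the vector field
  \<open>(e_s - 1) \<partial>_j\<close>.\<close>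

locale vanishing_fields = cvec sc U for sc :: "complex \<Rightarrow> 'u::ab_group_add \<Rightarrow> 'u" and U +
  fixes D :: "'n::finite \<Rightarrow> ('n \<Rightarrow> int) \<Rightarrow> 'u \<Rightarrow> 'u"
  assumes fd: "findim sc U"
    and D_mem [simp]: "u \<in> U \<Longrightarrow> D j s u \<in> U"
    and D_lin: "clin_on sc U sc (D j s)"
    and D_zero: "u \<in> U \<Longrightarrow> D j 0 u = 0"
    and D_comm: "u \<in> U \<Longrightarrow> D j s (D k m u) - D k m (D j s u)
      = sc (of_int (m j)) (D k (s + m) u - D k m u) - sc (of_int (s k)) (D j (s + m) u - D j s u)"
begin

text \<open>As \<open>D j s\<close> stands for (e_s - 1) \<partial>_j, this operator stands for (p -
  \<open>aug p\<close>) \<partial>_j; on the augmentation ideal it is p \<partial>_j itself.\<close>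

definition L :: "'n \<Rightarrow> 'n laurent \<Rightarrow> 'u \<Rightarrow> 'u" where
  "L j p u = (\<Sum>s\<in>Poly_Mapping.keys p. sc (Poly_Mapping.lookup p s) (D j s u))"

lemma L_superset:
  assumes "finite S" "Poly_Mapping.keys p \<subseteq> S" "u \<in> U"
  shows "L j p u = (\<Sum>s\<in>S. sc (Poly_Mapping.lookup p s) (D j s u))"
  unfolding L_def using assms by (intro sum.mono_neutral_left) (auto simp: in_keys_iff)

lemma L_mem [simp]: "u \<in> U \<Longrightarrow> L j p u \<in> U"
  unfolding L_def by simp

lemma L_single [simp]: "u \<in> U \<Longrightarrow> L j (Poly_Mapping.single s c) u = sc c (D j s u)"
  by (subst L_superset[of "{s}"]) auto

lemma L_add [simp]:
  assumes "u \<in> U" shows "L j (p + q) u = L j p u + L j q u"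
proof -
  let ?S = "Poly_Mapping.keys p \<union> Poly_Mapping.keys q"
  have "L j (p + q) u = (\<Sum>s\<in>?S. sc (Poly_Mapping.lookup (p + q) s) (D j s u))"
    using Poly_Mapping.keys_add[of p q] assms by (intro L_superset) auto
  then show ?thesis using assms
    by (simp add: lookup_add scale_left_add sum.distrib L_superset[of ?S p] L_superset[of ?S q])
qed

lemma L_zero [simp]: "u \<in> U \<Longrightarrow> L j 0 u = 0"
  by (simp add: L_def)

lemma L_diff [simp]: "u \<in> U \<Longrightarrow> L j (p - q) u = L j p u - L j q u"
  using L_add[of u j "p - q" q] by simp

lemma L_cst [simp]: "u \<in> U \<Longrightarrow> L j (cst c * p) u = sc c (L j p u)"
  by (induction p rule: laurent_induct)
    (simp_all add: cst_def mult_single scale_add distrib_left)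

lemma L_sum: "u \<in> U \<Longrightarrow> L j (sum f A) u = (\<Sum>a\<in>A. L j (f a) u)"
  by (induction A rule: infinite_finite_induct) auto

lemma L_lin: "clin_on sc U sc (L j p)"
  unfolding clin_on_def L_def
  by (auto simp: clin_on_add[OF D_lin] clin_on_scale[OF D_lin] scale_add sum.distrib scale_sum
      mult.commute)

text \<open>Both sides are bilinear in p and q, so it is enough to take p = e_s and q = e_m, where
  this is \<open>D_comm\<close>: the subtracted terms with index m or s alone become the subtracted
  augmentations.\<close>

lemma L_bracket:
  assumes u: "u \<in> U"
  shows "L j p (L k q u) - L k q (L j p u)
    = L k ((p - cst (aug p)) * deriv j q) u - L j ((q - cst (aug q)) * deriv k p) u"
proof (induction p rule: laurent_induct)
  case (single s a)
  show ?case
  proof (induction q rule: laurent_induct)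
    case (single m b)
    have "L j (Poly_Mapping.single s a) (L k (Poly_Mapping.single m b) u)
        - L k (Poly_Mapping.single m b) (L j (Poly_Mapping.single s a) u)
        = sc (a * b) (D j s (D k m u) - D k m (D j s u))"
      using u by (simp add: clin_on_scale[OF D_lin] scale_diff mult.commute)
    also have "\<dots> = sc (a * b * of_int (m j)) (D k (s + m) u - D k m u)
        - sc (a * b * of_int (s k)) (D j (s + m) u - D j s u)"
      using u by (simp add: D_comm scale_diff del: D_mem) (simp add: scale_diff)
    finally show ?case using u
      by (simp add: deriv_single mult_single cst_def left_diff_distrib scale_diff ac_simps)
  next
    case (add q r)
    have "L j (Poly_Mapping.single s a) (L k (q + r) u) - L k (q + r) (L j (Poly_Mapping.single s a) u)
      = (L j (Poly_Mapping.single s a) (L k q u) - L k q (L j (Poly_Mapping.single s a) u))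
      + (L j (Poly_Mapping.single s a) (L k r u) - L k r (L j (Poly_Mapping.single s a) u))"
      using u by (simp add: clin_on_add[OF D_lin] scale_add)
    then show ?case unfolding add
      using u by (simp add: cst_add algebra_simps)
  qed
next
  case (add p r)
  have "L j (p + r) (L k q u) - L k q (L j (p + r) u)
    = (L j p (L k q u) - L k q (L j p u)) + (L j r (L k q u) - L k q (L j r u))"
    using u by (simp add: clin_on_add[OF L_lin])
  then show ?case unfolding add
    using u by (simp add: cst_add algebra_simps)
qed

lemma L_bracket0:
  "u \<in> U \<Longrightarrow> aug p = 0 \<Longrightarrow> aug q = 0 \<Longrightarrow>
    L j p (L k q u) - L k q (L j p u) = L k (p * deriv j q) u - L j (q * deriv k p) u"
  by (simp add: L_bracket)

text \<open>The Euler fields \<open>z_i \<partial>/\<partial>z_i\<close>, where \<open>\<partial>/\<partial>z_i = t_i\<inverse> \<partial>_i\<close>, act on \<open>z_i^a \<partial>/\<partial>z_j\<close>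
  by scalars growing with \<open>a\<close>.\<close>

lemma euler_bracket:
  assumes u: "u \<in> U" and ij: "i \<noteq> j"
  shows "L i (zvar i * tinv i) (L j (zvar i ^ Suc n * zvar j ^ b * tinv j) u)
      - L j (zvar i ^ Suc n * zvar j ^ b * tinv j) (L i (zvar i * tinv i) u)
    = sc (of_nat (Suc n)) (L j (zvar i ^ Suc n * zvar j ^ b * tinv j) u)"
proof -
  have d: "deriv i (zvar j ^ b * tinv j) = 0"
    using ij by (cases b) (simp_all add: deriv_mult deriv_tinv deriv_zvar deriv_power_Suc del: power_Suc)
  have "zvar i * tinv i * deriv i (zvar i ^ Suc n * zvar j ^ b * tinv j)
      = cst (of_nat (Suc n)) * (zvar i ^ Suc n * zvar j ^ b * tinv j) * (tinv i * tvar i)"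
    unfolding mult.assoc deriv_mult[of i "zvar i ^ Suc n"] d deriv_power_Suc deriv_zvar
    by (simp add: cst_of_nat ac_simps del: tvar_tinv of_nat_Suc)
  moreover have "deriv j (zvar i * tinv i) = 0"
    using ij by (simp add: deriv_mult deriv_tinv deriv_zvar)
  ultimately show ?thesis
    using u by (subst L_bracket0) (simp_all add: aug_mult)
qed

text \<open>For i = j the field z^(n+1) d/dz also differentiates the coefficient z of the Euler
  field, which lowers the eigenvalue from n+1 to n.\<close>

lemma euler_bracket_same:
  assumes u: "u \<in> U"
  shows "L j (zvar j * tinv j) (L j (zvar j ^ Suc n * tinv j) u)
      - L j (zvar j ^ Suc n * tinv j) (L j (zvar j * tinv j) u)
    = sc (of_nat n) (L j (zvar j ^ Suc n * tinv j) u)"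
proof -
  let ?z = "zvar j" and ?w = "tinv j" and ?t = "tvar j"
  have "?z * ?w * deriv j (?z ^ Suc n * ?w) - ?z ^ Suc n * ?w * deriv j (?z * ?w)
    = ?z * ?w * (of_nat (Suc n) * ?z ^ n * ?t * ?w - ?z ^ Suc n * ?w)
      - ?z ^ Suc n * ?w * (?t * ?w - ?z * ?w)"
    by (simp add: deriv_mult deriv_tinv deriv_zvar deriv_power_Suc del: power_Suc of_nat_Suc)
  also have "\<dots> = cst (of_nat n) * (?z ^ Suc n * ?w) * (?t * ?w)"
    by (simp add: cst_of_nat algebra_simps del: tvar_tinv)
  also have "\<dots> = cst (of_nat n) * (?z ^ Suc n * ?w)" by simp
  finally have eq: "?z * ?w * deriv j (?z ^ Suc n * ?w) - ?z ^ Suc n * ?w * deriv j (?z * ?w)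
    = cst (of_nat n) * (?z ^ Suc n * ?w)" .
  have "L j (?z * ?w) (L j (?z ^ Suc n * ?w) u) - L j (?z ^ Suc n * ?w) (L j (?z * ?w) u)
    = L j (?z * ?w * deriv j (?z ^ Suc n * ?w) - ?z ^ Suc n * ?w * deriv j (?z * ?w)) u"
    using u by (subst L_bracket0) simp_all
  then show ?thesis unfolding eq using u by simp
qed

text \<open>These two families, z_i^a d/dz_j and z_i^a z_j d/dz_j, are the ones entering the bracket
  identity of \<open>zvar_power_in_kernel\<close>. For i \<noteq> j they are the cases b = 0 and b =
  1 of \<open>euler_bracket\<close>; for i = j the second is the first with exponent a+1.\<close>

lemma zvar_power_vanish:
  obtains N where "\<And>a u. N \<le> a \<Longrightarrow> u \<in> U \<Longrightarrow> L j (zvar i ^ a * tinv j) u = 0"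
    "\<And>a u. N \<le> a \<Longrightarrow> u \<in> U \<Longrightarrow> L j (zvar i ^ a * zvar j * tinv j) u = 0"
proof -
  let ?T = "L i (zvar i * tinv i)"
  obtain N :: nat where N: "\<And>a X. N \<le> a \<Longrightarrow> (\<And>x. x \<in> U \<Longrightarrow> X x \<in> U) \<Longrightarrow> clin_on sc U sc X \<Longrightarrow>
      (\<And>x. x \<in> U \<Longrightarrow> ?T (X x) - X (?T x) = sc (of_nat a) (X x)) \<Longrightarrow> \<forall>x\<in>U. X x = 0"
    using ad_eigen_vanish[OF fd L_mem L_lin] by metis
  show thesis
  proof (cases "i = j")
    case False
    have *: "L j (zvar i ^ a * zvar j ^ b * tinv j) u = 0" if a: "Suc N \<le> a" and u: "u \<in> U" for a b u
    proof -
      obtain n where n: "a = Suc n" "N \<le> Suc n" using a by (cases a) auto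
      show ?thesis
        using N[OF n(2) L_mem L_lin, of j "zvar i ^ Suc n * zvar j ^ b * tinv j"]
          euler_bracket[OF _ False, of _ n b] u n by blast
    qed
    show thesis using that[of "Suc N"] *[of _ _ 0] *[of _ _ 1] by simp
  next
    case True
    have *: "L j (zvar j ^ a * tinv j) u = 0" if a: "Suc N \<le> a" and u: "u \<in> U" for a u
    proof -
      obtain n where n: "a = Suc n" "N \<le> n" using a by (cases a) auto
      show ?thesis
        using N[OF n(2) L_mem L_lin, of j "zvar j ^ Suc n * tinv j"]
          euler_bracket_same[of _ j n] u n True by blast
    qed
    show thesis using that[of "Suc N"] *[of "Suc _"] * True by (simp add: power_commutes)
  qed
qed

text \<open>The multiplier q makes this an ideal of the Laurent ring, the largest one on which all
  \<open>L j\<close> vanish. One may therefore compute modulo it.\<close>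

definition K :: "'n laurent set" where
  "K = {p. \<forall>j q. \<forall>u\<in>U. L j (q * p) u = 0}"

lemma K_add: "p \<in> K \<Longrightarrow> q \<in> K \<Longrightarrow> p + q \<in> K"
  and K_diff: "p \<in> K \<Longrightarrow> q \<in> K \<Longrightarrow> p - q \<in> K"
  unfolding K_def by (simp_all add: distrib_left right_diff_distrib)

lemma K_zero: "0 \<in> K" unfolding K_def by simp

lemma K_mult: "p \<in> K \<Longrightarrow> r * p \<in> K"
  unfolding K_def by (simp add: mult.assoc[symmetric])

lemma K_prod:
  assumes "finite A" "\<And>a. a \<in> A \<Longrightarrow> f a - g a \<in> K"
  shows "prod f A - prod g A \<in> K"
  using assms
proof (induction A rule: finite_induct)
  case empty
  show ?case by (simp add: K_zero)
next
  case (insert a A)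
  have "prod f (insert a A) - prod g (insert a A)
    = prod f A * (f a - g a) + g a * (prod f A - prod g A)"
    using insert.hyps by (simp add: algebra_simps)
  then show ?case using insert by (auto intro: K_add K_mult)
qed

text \<open>For \<open>\<partial> = \<partial>/\<partial>z_j\<close>, \<open>[p \<partial>, g z_j \<partial>] - [p z_j \<partial>, g \<partial>] = 2 p g \<partial>\<close>.\<close>

lemma zvar_power_in_kernel:
  "\<exists>N. \<forall>a\<ge>N. \<forall>q. \<forall>u\<in>U. L j (q * zvar i ^ a) u = 0"
proof -
  obtain N where N: "\<And>a u. N \<le> a \<Longrightarrow> u \<in> U \<Longrightarrow> L j (zvar i ^ a * tinv j) u = 0"
    "\<And>a u. N \<le> a \<Longrightarrow> u \<in> U \<Longrightarrow> L j (zvar i ^ a * zvar j * tinv j) u = 0"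
    using zvar_power_vanish[of j i] by blast
  let ?z = "zvar j" and ?w = "tinv j" and ?t = "tvar j"
  \<comment> \<open>\<open>L_bracket0\<close> needs coefficients vanishing at the identity: for p
    this is assumed, and for \<open>?g\<close> it follows from a > 0, hence
    \<open>Suc N\<close>.\<close>
  have *: "L j (p * (zvar i ^ a * ?w)) u = 0"
    if a: "Suc N \<le> a" and p: "aug p = 0" and u: "u \<in> U" for a p u
  proof -
    let ?g = "zvar i ^ a * ?w"
    have gz: "?g * ?z = zvar i ^ a * ?z * ?w" by (simp add: ac_simps)
    have g0: "aug ?g = 0" using a by (cases a) simp_all
    have g: "L j ?g v = 0" "L j (?g * ?z) v = 0" if "v \<in> U" for v
      unfolding gz using N a that by simp_all
    have 1: "L j (p * ?w * deriv j (?g * ?z) - ?g * ?z * deriv j (p * ?w)) u = 0"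
      using L_bracket0[of u "p * ?w" "?g * ?z" j j] u p g0
      by (simp add: g clin_on_zero[OF L_lin])
    have 2: "L j (p * ?z * ?w * deriv j ?g - ?g * deriv j (p * ?z * ?w)) u = 0"
      using L_bracket0[of u "p * ?z * ?w" "?g" j j] u p g0
      by (simp add: g clin_on_zero[OF L_lin])
    have "(p * ?w * deriv j (?g * ?z) - ?g * ?z * deriv j (p * ?w))
        - (p * ?z * ?w * deriv j ?g - ?g * deriv j (p * ?z * ?w))
      = 2 * p * ?g * (?w * ?t)"
      by (simp add: deriv_mult deriv_zvar algebra_simps del: tvar_tinv)
    also have "\<dots> = cst 2 * (p * ?g)" by (simp add: cst_def ac_simps)
    finally have eq: "(p * ?w * deriv j (?g * ?z) - ?g * ?z * deriv j (p * ?w))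
        - (p * ?z * ?w * deriv j ?g - ?g * deriv j (p * ?z * ?w)) = cst 2 * (p * ?g)" .
    have "L j (cst 2 * (p * ?g)) u = L j (p * ?w * deriv j (?g * ?z) - ?g * ?z * deriv j (p * ?w)) u
        - L j (p * ?z * ?w * deriv j ?g - ?g * deriv j (p * ?z * ?w)) u"
      by (subst eq[symmetric]) (rule L_diff[OF u])
    then have "L j (cst 2 * (p * ?g)) u = 0" unfolding 1 2 by simp
    then show ?thesis using u scale_eq_0D[of "L j (p * ?g) u" 2] by simp
  qed
  have "L j (q * zvar i ^ a) u = 0" if a: "Suc (Suc N) \<le> a" and u: "u \<in> U" for a q u
  proof -
    obtain b where b: "a = Suc b" "Suc N \<le> b" using a by (cases a) auto
    \<comment> \<open>One factor z_i is split off, so that the multiplier of the remaining power has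
      augmentation zero for an arbitrary q; \<open>?t\<close> compensates for
      \<open>?w\<close>.\<close>
    have "q * zvar i ^ a = q * ?t * zvar i * (zvar i ^ b * ?w) * 1"
      unfolding tvar_tinv(2)[of j, symmetric] using b(1) by (simp add: ac_simps del: tvar_tinv)
        (simp flip: mult.assoc)
    then show ?thesis using *[OF b(2) _ u, of "q * ?t * zvar i"] by simp
  qed
  then show ?thesis by blast
qed

lemma zvar_power_K: "\<exists>N. \<forall>i. zvar i ^ N \<in> K"
proof -
  have "\<exists>f. \<forall>x::'n \<times> 'n. \<forall>a\<ge>f x. \<forall>q. \<forall>u\<in>U. L (fst x) (q * zvar (snd x) ^ a) u = 0"
    by (intro choice allI zvar_power_in_kernel)
  then obtain f where f: "\<forall>x::'n \<times> 'n. \<forall>a\<ge>f x. \<forall>q. \<forall>u\<in>U. L (fst x) (q * zvar (snd x) ^ a) u = 0"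
    by blast
  have "f x \<le> Max (range f)" for x by (intro Max_ge) auto
  then have "zvar i ^ Max (range f) \<in> K" for i
    unfolding K_def using f by fastforce
  then show ?thesis by blast
qed

text \<open>t_i^s = (1 + z_i)^s is its truncated binomial series modulo \<open>K\<close>. The
  induction runs upwards and downwards from s = 0, each step being
  \<open>truncated_binomial_step\<close>, whose error term lies in \<open>K\<close>.\<close>

lemma tvar_power_binomial:
  assumes N: "zvar i ^ N \<in> K"
  shows "Poly_Mapping.single (\<lambda>k. s * unit_vec i k) 1
    - (\<Sum>k<Suc N. cst (of_int s gchoose k) * zvar i ^ k) \<in> K"
proof (induction s rule: int_induct[of _ 0])
  let ?e = "\<lambda>s. Poly_Mapping.single (\<lambda>k. s * unit_vec i k) 1 :: 'n laurent"
  let ?b = "\<lambda>s. \<Sum>k<Suc N. cst (of_int s gchoose k) * zvar i ^ k"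
  case base
  have "(\<lambda>k. 0 * unit_vec i k) = 0" by (rule ext) simp
  then have "?e 0 = 1" by (simp only: single_one)
  moreover have "?b 0 = 1" by (subst sum.lessThan_Suc_shift) simp
  ultimately have "?e 0 - ?b 0 = 0" by simp
  then show ?case using K_zero by simp
next
  let ?e = "\<lambda>s. Poly_Mapping.single (\<lambda>k. s * unit_vec i k) 1 :: 'n laurent"
  let ?b = "\<lambda>s. \<Sum>k<Suc N. cst (of_int s gchoose k) * zvar i ^ k"
  have t: "1 + zvar i = tvar i" by (simp add: zvar_def)
  have "zvar i ^ Suc N \<in> K" using N K_mult by simp
  then have bK: "tvar i * ?b s - ?b (s + 1) \<in> K" for s
    using truncated_binomial_step[where z = "zvar i" and n = N and x = "of_int s"] unfolding t of_int_add of_int_1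
    by (simp only: K_mult)
  have e: "?e (s + 1) = tvar i * ?e s" for s
    unfolding tvar_def mult_single
    by (intro arg_cong2[of _ _ _ _ Poly_Mapping.single]) (auto simp: fun_eq_iff algebra_simps)
  have step: "?e (s + 1) - ?b (s + 1) = tvar i * (?e s - ?b s) + (tvar i * ?b s - ?b (s + 1))" for s
    unfolding e by (simp only: right_diff_distrib) simp
  {
    case (step1 s)
    show ?case unfolding step by (intro K_add K_mult bK step1)
  next
    case (step2 s)
    have "tvar i * (?e (s - 1) - ?b (s - 1)) = (?e s - ?b s) - (tvar i * ?b (s - 1) - ?b s)"
      using step[of "s - 1"] by simp
    then have "tvar i * (?e (s - 1) - ?b (s - 1)) \<in> K"
      using K_diff[OF step2(2) bK[of "s - 1"]] by simp
    \<comment> \<open>The downward step divides by t_i, a unit of the Laurent ring; \<open>K\<close>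
      is an ideal.\<close>
    then have "tinv i * (tvar i * (?e (s - 1) - ?b (s - 1))) \<in> K" by (rule K_mult)
    then show ?case unfolding mult.assoc[symmetric] tvar_tinv mult_1 .
  }
qed

text \<open>Binomial coefficients are rewritten in powers of s; the resulting coefficients
  \<open>r l\<close> are Laurent polynomials independent of s.\<close>

lemma tvar_power_polynomial:
  assumes N: "zvar i ^ N \<in> K"
  obtains r where "\<And>s. Poly_Mapping.single (\<lambda>k. s * unit_vec i k) 1
    - (\<Sum>l<Suc N. cst (of_int s ^ l) * r l) \<in> K"
proof -
  have "\<forall>k. \<exists>c. (\<forall>l>k. c l = 0) \<and> (\<forall>x::complex. x gchoose k = (\<Sum>l\<le>k. c l * x ^ l))"
    by (intro allI gchoose_coeffs)
  from choice[OF this] obtain c where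
    c_all: "\<forall>k. (\<forall>l>k. c k l = 0) \<and> (\<forall>x::complex. x gchoose k = (\<Sum>l\<le>k. c k l * x ^ l))" ..
  then have c: "\<And>k l. l > k \<Longrightarrow> c k l = 0"
    "\<And>k x. x gchoose k = (\<Sum>l\<le>k. c k l * x ^ l :: complex)"
    by (simp_all only:)
  let ?r = "\<lambda>l. \<Sum>k<Suc N. cst (c k l) * zvar i ^ k"
  have "(\<Sum>k<Suc N. cst (x gchoose k) * zvar i ^ k) = (\<Sum>l<Suc N. cst (x ^ l) * ?r l)" for x
  proof -
    have "x gchoose k = (\<Sum>l<Suc N. c k l * x ^ l)" if "k < Suc N" for k
      unfolding c(2) by (rule sum.mono_neutral_left) (use c(1) that in auto)
    then have "(\<Sum>k<Suc N. cst (x gchoose k) * zvar i ^ k)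
        = (\<Sum>k<Suc N. \<Sum>l<Suc N. cst (x ^ l) * (cst (c k l) * zvar i ^ k))"
      by (intro sum.cong refl) (simp only: cst_sum cst_mult sum_distrib_right lessThan_iff, simp only: ac_simps)
    also have "\<dots> = (\<Sum>l<Suc N. cst (x ^ l) * ?r l)"
      by (subst sum.swap) (simp only: sum_distrib_left)
    finally show ?thesis .
  qed
  then show thesis using that[of ?r] tvar_power_binomial[OF N] by simp
qed

text \<open>e_s is the product of the t_i^(s_i), each factor is polynomial in s_i modulo
  \<open>K\<close>, and multiplying out gives a polynomial in s whose coefficients are fixed Laurent
  polynomials. Applying \<open>L j\<close> gives the operators \<open>C\<close>.\<close>

theorem D_polynomial:
  obtains A C where "finite A" "0 \<notin> A"
    "\<And>j \<alpha> u. u \<in> U \<Longrightarrow> C j \<alpha> u \<in> U" "\<And>j \<alpha>. clin_on sc U sc (C j \<alpha>)"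
    "\<And>j s u. u \<in> U \<Longrightarrow> D j s u = (\<Sum>\<alpha>\<in>A. sc (mono s \<alpha>) (C j \<alpha> u))"
proof -
  obtain N where N: "\<And>i. zvar i ^ N \<in> K" using zvar_power_K by blast
  have "\<forall>i. \<exists>r. \<forall>s. Poly_Mapping.single (\<lambda>k. s * unit_vec i k) 1
    - (\<Sum>l<Suc N. cst (of_int s ^ l) * r l) \<in> K"
    using tvar_power_polynomial[OF N] by blast
  from choice[OF this] obtain r where r: "\<And>i s. Poly_Mapping.single (\<lambda>k. s * unit_vec i k) 1
    - (\<Sum>l<Suc N. cst (of_int s ^ l) * r i l) \<in> K" by blast
  define B :: "('n \<Rightarrow> nat) set" where "B = PiE UNIV (\<lambda>_. {..<Suc N})"
  define C where "C j \<alpha> = L j (\<Prod>i\<in>UNIV. r i (\<alpha> i))" for j \<alpha>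
  have finB: "finite B" unfolding B_def by (intro finite_PiE) auto
  have B0: "0 \<in> B" unfolding B_def by auto
  have D_eq: "D j s u = (\<Sum>\<alpha>\<in>B. sc (mono s \<alpha>) (C j \<alpha> u))" if u: "u \<in> U" for j s u
  proof -
    have "(\<Prod>i\<in>UNIV. \<Sum>l<Suc N. cst (of_int (s i) ^ l) * r i l)
      = (\<Sum>\<alpha>\<in>B. \<Prod>i\<in>UNIV. cst (of_int (s i) ^ \<alpha> i) * r i (\<alpha> i))"
      unfolding B_def by (rule prod_sum_PiE) auto
    also have "\<dots> = (\<Sum>\<alpha>\<in>B. cst (mono s \<alpha>) * (\<Prod>i\<in>UNIV. r i (\<alpha> i)))"
      by (simp only: prod.distrib mono_def cst_prod)
    finally have eq: "(\<Prod>i\<in>UNIV. \<Sum>l<Suc N. cst (of_int (s i) ^ l) * r i l)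
      = (\<Sum>\<alpha>\<in>B. cst (mono s \<alpha>) * (\<Prod>i\<in>UNIV. r i (\<alpha> i)))" .
    have "(\<Prod>i\<in>UNIV. Poly_Mapping.single (\<lambda>k. s i * unit_vec i k) 1)
      - (\<Prod>i\<in>UNIV. \<Sum>l<Suc N. cst (of_int (s i) ^ l) * r i l) \<in> K"
      by (rule K_prod[OF finite_UNIV r])
    then have "Poly_Mapping.single s 1 - (\<Sum>\<alpha>\<in>B. cst (mono s \<alpha>) * (\<Prod>i\<in>UNIV. r i (\<alpha> i))) \<in> K"
      unfolding prod_tvar_powers eq .
    then have "L j (1 * (Poly_Mapping.single s 1
        - (\<Sum>\<alpha>\<in>B. cst (mono s \<alpha>) * (\<Prod>i\<in>UNIV. r i (\<alpha> i))))) u = 0"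
      using u unfolding K_def by blast
    then show ?thesis using u by (simp add: L_sum C_def)
  qed
  have mono0: "mono (0 :: 'n \<Rightarrow> int) \<alpha> = (if \<alpha> = 0 then 1 else 0)" for \<alpha>
    by (auto simp: mono_def fun_eq_iff)
  have C0: "C j 0 u = 0" if u: "u \<in> U" for j u
  proof -
    have "C j \<alpha> u \<in> U" for \<alpha> using u by (simp add: C_def)
    then have "D j 0 u = (\<Sum>\<alpha>\<in>B. if \<alpha> = 0 then C j 0 u else 0)"
      unfolding D_eq[OF u] mono0 by (intro sum.cong) auto
    then show ?thesis using D_zero[OF u] finB B0 by simp
  qed
  show thesis
  proof (rule that[of "B - {0}" C])
    show "D j s u = (\<Sum>\<alpha>\<in>B - {0}. sc (mono s \<alpha>) (C j \<alpha> u))" if "u \<in> U" for j s u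
      unfolding D_eq[OF that] using finB B0 C0[OF that] by (simp add: sum.remove)
  qed (use finB in \<open>auto simp: C_def L_lin\<close>)
qed

end

section \<open>Generating functions for the brackets of W_n^+\<close>

section \<open>Representations of \<open>W_n\<^sup>+\<close> and polynomial families\<close>

lemma mfact_nonzero [simp]: "mfact \<alpha> \<noteq> 0"
  by (simp add: mfact_def)

lemma mono_zero: "mono (0 :: 'n::finite \<Rightarrow> int) \<alpha> = (if \<alpha> = 0 then 1 else 0)"
  by (auto simp: mono_def fun_eq_iff)

lemma finite_le_fun: "finite {\<alpha>. \<alpha> \<le> (\<gamma> :: 'n::finite \<Rightarrow> nat)}"
proof -
  have "{\<alpha>. \<alpha> \<le> \<gamma>} = PiE UNIV (\<lambda>i. {..\<gamma> i})" by (auto simp: le_fun_def PiE_def)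
  then show ?thesis by (simp add: finite_PiE)
qed

text \<open>The coefficient form of exp((s+m).z) = exp(s.z) exp(m.z): the binomial theorem for
  divided powers, coordinate by coordinate.\<close>

lemma mono_add_divided:
  "mono (s + m) \<gamma> / mfact \<gamma>
    = (\<Sum>\<alpha> | \<alpha> \<le> \<gamma>. mono s \<alpha> / mfact \<alpha> * (mono m (\<gamma> - \<alpha>) / mfact (\<gamma> - \<alpha>)))"
proof -
  have box: "{\<alpha>. \<alpha> \<le> \<gamma>} = PiE UNIV (\<lambda>i. {..\<gamma> i})" by (auto simp: le_fun_def PiE_def)
  have coord: "(x + y) ^ g / fact g = (\<Sum>a\<le>g. x ^ a / fact a * (y ^ (g - a) / fact (g - a)))"
    for x y :: complex and g
    unfolding binomial_ring sum_divide_distrib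
    by (intro sum.cong) (auto simp: binomial_fact field_simps)
  have "mono (s + m) \<gamma> / mfact \<gamma>
      = (\<Prod>i\<in>UNIV. (of_int (s i) + of_int (m i)) ^ \<gamma> i / fact (\<gamma> i))"
    by (simp add: mono_def mfact_def prod_dividef)
  also have "\<dots> = (\<Prod>i\<in>UNIV. \<Sum>a\<in>{..\<gamma> i}. of_int (s i) ^ a / fact a
      * (of_int (m i) ^ (\<gamma> i - a) / fact (\<gamma> i - a)))"
    by (simp only: coord)
  also have "\<dots> = (\<Sum>\<alpha>\<in>PiE UNIV (\<lambda>i. {..\<gamma> i}). \<Prod>i\<in>UNIV. of_int (s i) ^ \<alpha> i / fact (\<alpha> i)
      * (of_int (m i) ^ (\<gamma> i - \<alpha> i) / fact (\<gamma> i - \<alpha> i)))"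
    by (rule prod_sum_PiE) auto
  also have "\<dots> = (\<Sum>\<alpha> | \<alpha> \<le> \<gamma>. mono s \<alpha> / mfact \<alpha> * (mono m (\<gamma> - \<alpha>) / mfact (\<gamma> - \<alpha>)))"
    unfolding box by (intro sum.cong) (simp_all add: mono_def mfact_def prod.distrib prod_dividef)
  finally show ?thesis .
qed

text \<open>The coefficient form of \<partial>_j exp(m.z) = m_j exp(m.z). It is the source of the
  factor \<beta>_j in the bracket of W_n^+.\<close>

lemma mono_divided_shift:
  "of_int (m j) * (mono m \<delta> / mfact \<delta>)
    = of_nat ((\<delta> + eps j) j) * (mono m (\<delta> + eps j) / mfact (\<delta> + eps j))"
proof -
  have "mono m (\<delta> + eps j) = (\<Prod>i\<in>UNIV. of_int (m i) ^ \<delta> i * (if i = j then of_int (m j) else 1))"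
    unfolding mono_def by (intro prod.cong) (auto simp: eps_def)
  then have 1: "mono m (\<delta> + eps j) = mono m \<delta> * of_int (m j)"
    by (simp add: prod.distrib mono_def)
  have "mfact (\<delta> + eps j) = (\<Prod>i\<in>UNIV. fact (\<delta> i) * (if i = j then of_nat (Suc (\<delta> j)) else 1))"
    unfolding mfact_def by (intro prod.cong) (auto simp: eps_def)
  then have 2: "mfact (\<delta> + eps j) = mfact \<delta> * of_nat (Suc (\<delta> j))"
    by (simp add: prod.distrib mfact_def del: of_nat_Suc)
  have 3: "(\<delta> + eps j) j = Suc (\<delta> j)" by (simp add: eps_def)
  show ?thesis unfolding 1 2 3 by (simp add: field_simps del: of_nat_Suc)
qed

lemma eps_nonzero [simp]: "eps i \<noteq> 0"
  by (auto simp: eps_def fun_eq_iff)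

text \<open>A cofinal family among the finite sets of admissible exponents, so that one index set
  serves several operators at once. The exponent 0 is left out because W_n^+ contains no constant
  fields.\<close>

definition mbox :: "nat \<Rightarrow> ('n \<Rightarrow> nat) set" where
  "mbox K = {\<alpha>. \<forall>i. \<alpha> i \<le> K} - {0}"

lemma finite_mbox [simp]: "finite (mbox K :: ('n::finite \<Rightarrow> nat) set)"
  using finite_le_fun[of "\<lambda>_::'n. K"] by (simp add: mbox_def le_fun_def)

lemma zero_notin_mbox [simp]: "0 \<notin> mbox K"
  by (simp add: mbox_def)

lemma mbox_nonzero: "\<alpha> \<in> mbox K \<Longrightarrow> \<alpha> \<noteq> 0"
  by (auto simp: mbox_def)

lemma mbox_mono: "K \<le> K' \<Longrightarrow> mbox K \<subseteq> mbox K'"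
  by (auto simp: mbox_def intro: order_trans)

lemma finite_subset_mbox: "finite A \<Longrightarrow> 0 \<notin> A \<Longrightarrow> \<exists>K. A \<subseteq> (mbox K :: ('n::finite \<Rightarrow> nat) set)"
proof -
  assume A: "finite A" "0 \<notin> A"
  let ?K = "\<Sum>\<alpha>\<in>A. \<Sum>i\<in>UNIV. \<alpha> i"
  have "\<alpha> i \<le> ?K" if "\<alpha> \<in> A" for \<alpha> i
  proof -
    have "\<alpha> i \<le> (\<Sum>i\<in>UNIV. \<alpha> i)" by (rule member_le_sum) auto
    also have "\<dots> \<le> ?K" by (rule member_le_sum) (use that A in auto)
    finally show ?thesis .
  qed
  then show ?thesis using A by (intro exI[of _ ?K]) (auto simp: mbox_def)
qed

text \<open>The sum \<alpha> + \<beta> has total degree at least two and at most one is removed.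
  With truncated subtraction this also covers the case where the coordinate j of the sum is 0, so
  every index written in a bracket is admissible.\<close>

lemma index_nonzero:
  "\<alpha> \<noteq> 0 \<Longrightarrow> \<beta> \<noteq> 0 \<Longrightarrow> \<alpha> + \<beta> - eps j \<noteq> (0 :: 'n \<Rightarrow> nat)"
proof
  assume *: "\<alpha> \<noteq> 0" "\<beta> \<noteq> 0" "\<alpha> + \<beta> - eps j = 0"
  have le: "\<alpha> i + \<beta> i \<le> eps j i" for i
    using fun_cong[OF *(3), of i] by simp
  obtain a b where "\<alpha> a \<noteq> 0" "\<beta> b \<noteq> 0" using * by (auto simp: fun_eq_iff)
  then show False using le[of a] le[of b] by (auto simp: eps_def split: if_splits)
qed

context cvec
begin

text \<open>For F without 0 and \<open>R \<alpha>\<close> the action of z^\<alpha> \<partial>_j,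
  this is the action of (exp(s.z) - 1) \<partial>_j truncated to F.\<close>

definition expand :: "('n::finite \<Rightarrow> nat) set \<Rightarrow> (('n \<Rightarrow> nat) \<Rightarrow> 'v \<Rightarrow> 'v) \<Rightarrow> ('n \<Rightarrow> int) \<Rightarrow> 'v \<Rightarrow> 'v" where
  "expand F R s u = (\<Sum>\<alpha>\<in>F. sc (mono s \<alpha> / mfact \<alpha>) (R \<alpha> u))"

lemma expand_superset:
  assumes "finite G" "F \<subseteq> G" "\<And>\<alpha>. \<alpha> \<in> G - F \<Longrightarrow> R \<alpha> u = 0"
  shows "expand F R s u = expand G R s u"
  unfolding expand_def using assms by (intro sum.mono_neutral_left) auto

lemma expand_mem [simp]: "(\<And>\<alpha>. \<alpha> \<in> F \<Longrightarrow> R \<alpha> u \<in> V) \<Longrightarrow> expand F R s u \<in> V"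
  unfolding expand_def by auto

lemma expand_zero: "0 \<notin> F \<Longrightarrow> (\<And>\<alpha>. \<alpha> \<in> F \<Longrightarrow> R \<alpha> u \<in> V) \<Longrightarrow> expand F R 0 u = 0"
  unfolding expand_def mono_zero by (rule sum.neutral) auto

text \<open>The coefficient form of (exp(s.z) - 1) \<partial>_j exp(m.z) = m_j (exp((s+m).z) -
  exp(m.z)). The box grows by one because \<beta> = \<gamma> - \<alpha> + \<epsilon>_j may have the
  coordinate K+1.\<close>

lemma expand_shift:
  fixes s m :: "'n::finite \<Rightarrow> int"
  assumes RV: "\<And>\<gamma>. \<gamma> \<noteq> 0 \<Longrightarrow> R \<gamma> u \<in> V" and R0: "\<And>\<gamma>. \<gamma> \<noteq> 0 \<Longrightarrow> \<gamma> \<notin> mbox K \<Longrightarrow> R \<gamma> u = 0"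
  shows "sc (of_int (m j)) (expand (mbox K) R (s + m) u - expand (mbox K) R m u)
    = (\<Sum>\<alpha>\<in>mbox (Suc K). \<Sum>\<beta>\<in>mbox (Suc K). sc (mono s \<alpha> / mfact \<alpha> * (mono m \<beta> / mfact \<beta>))
        (sc (of_nat (\<beta> j)) (R (\<alpha> + \<beta> - eps j) u)))"
proof -
  let ?F = "mbox K :: ('n \<Rightarrow> nat) set" and ?G = "mbox (Suc K) :: ('n \<Rightarrow> nat) set"
  let ?h = "\<lambda>\<alpha> \<beta>. sc (mono s \<alpha> / mfact \<alpha> * (mono m \<beta> / mfact \<beta>)) (sc (of_nat (\<beta> j)) (R (\<alpha> + \<beta> - eps j) u))"
  let ?g = "\<lambda>\<gamma> \<alpha>. sc (mono s \<alpha> / mfact \<alpha> * (of_int (m j) * (mono m (\<gamma> - \<alpha>) / mfact (\<gamma> - \<alpha>)))) (R \<gamma> u)"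
  have F0: "\<gamma> \<noteq> 0" if "\<gamma> \<in> mbox k" for \<gamma> :: "'n \<Rightarrow> nat" and k using that by (simp add: mbox_def)
  \<comment> \<open>Subtracting the monomial in m removes precisely the term \<alpha> = 0.\<close>
  have diff: "mono (s + m) \<gamma> / mfact \<gamma> - mono m \<gamma> / mfact \<gamma>
      = (\<Sum>\<alpha>\<in>{\<alpha>. \<alpha> \<le> \<gamma>} - {0}. mono s \<alpha> / mfact \<alpha> * (mono m (\<gamma> - \<alpha>) / mfact (\<gamma> - \<alpha>)))" for \<gamma>
  proof -
    have "0 \<in> {\<alpha>. \<alpha> \<le> \<gamma>}" by (simp add: le_fun_def)
    moreover have "mono s 0 / mfact (0 :: 'n \<Rightarrow> nat) * (mono m (\<gamma> - 0) / mfact (\<gamma> - 0)) = mono m \<gamma> / mfact \<gamma>"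
      by (simp add: mono_def mfact_def)
    ultimately show ?thesis
      unfolding mono_add_divided by (subst sum.remove[OF finite_le_fun, of 0]) auto
  qed
  have "sc (of_int (m j)) (expand ?F R (s + m) u - expand ?F R m u)
      = (\<Sum>\<gamma>\<in>?F. sc (of_int (m j) * (mono (s + m) \<gamma> / mfact \<gamma> - mono m \<gamma> / mfact \<gamma>)) (R \<gamma> u))"
    unfolding expand_def sum_subtractf[symmetric]
    using RV F0 by (subst scale_sum) (auto intro!: sum.cong simp: scale_left_diff scale_diff right_diff_distrib)
  also have "\<dots> = (\<Sum>\<gamma>\<in>?F. \<Sum>\<alpha>\<in>{\<alpha>. \<alpha> \<le> \<gamma>} - {0}. ?g \<gamma> \<alpha>)"
  proof (rule sum.cong[OF refl])
    fix \<gamma> :: "'n \<Rightarrow> nat" assume "\<gamma> \<in> ?F"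
    then have RV1: "R \<gamma> u \<in> V" using RV F0 by blast
    show "sc (of_int (m j) * (mono (s + m) \<gamma> / mfact \<gamma> - mono m \<gamma> / mfact \<gamma>)) (R \<gamma> u)
      = (\<Sum>\<alpha>\<in>{\<alpha>. \<alpha> \<le> \<gamma>} - {0}. ?g \<gamma> \<alpha>)"
      unfolding diff sum_distrib_left sum_scale[OF RV1]
      by (intro arg_cong2[of _ _ _ _ sc] sum.cong refl) (simp add: mult.left_commute)
  qed
  also have "\<dots> = (\<Sum>(\<gamma>, \<alpha>)\<in>Sigma ?F (\<lambda>\<gamma>. {\<alpha>. \<alpha> \<le> \<gamma>} - {0}). ?g \<gamma> \<alpha>)"
    by (rule sum.Sigma) (auto intro: finite_le_fun)
  \<comment> \<open>The factor m_j raises the divided power of m from \<gamma> - \<alpha> to \<beta>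
    = \<gamma> - \<alpha> + \<epsilon>_j; the condition 1 \<le> \<beta>_j makes the substitution
    invertible in spite of truncated subtraction.\<close>
  also have "\<dots> = (\<Sum>(\<alpha>, \<beta>)\<in>{(\<alpha>, \<beta>). \<alpha> \<in> ?G \<and> \<beta> \<in> ?G \<and> 1 \<le> \<beta> j \<and> \<alpha> + \<beta> - eps j \<in> ?F}. ?h \<alpha> \<beta>)"
  proof (rule sum.reindex_bij_witness[where i = "\<lambda>(\<alpha>, \<beta>). (\<alpha> + \<beta> - eps j, \<alpha>)"
        and j = "\<lambda>(\<gamma>, \<alpha>). (\<alpha>, \<gamma> - \<alpha> + eps j)"])
    fix x assume x: "x \<in> Sigma ?F (\<lambda>\<gamma>. {\<alpha>. \<alpha> \<le> \<gamma>} - {0})"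
    obtain \<gamma> \<alpha> :: "'n \<Rightarrow> nat" where x_eq: "x = (\<gamma>, \<alpha>)" by (cases x)
    have g1: "\<gamma> \<in> ?F" and al: "\<alpha> \<le> \<gamma>" "\<alpha> \<noteq> 0" using x by (auto simp: x_eq)
    have le: "\<alpha> i \<le> \<gamma> i" for i using al(1) by (simp add: le_fun_def)
    have roundtrip: "\<alpha> + (\<gamma> - \<alpha> + eps j) - eps j = \<gamma>"
    proof (rule ext)
      fix i show "(\<alpha> + (\<gamma> - \<alpha> + eps j) - eps j) i = \<gamma> i" using le[of i] by simp
    qed
    show "(case case x of (\<gamma>, \<alpha>) \<Rightarrow> (\<alpha>, \<gamma> - \<alpha> + eps j) of (\<alpha>, \<beta>) \<Rightarrow> (\<alpha> + \<beta> - eps j, \<alpha>)) = x"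
      by (simp only: x_eq prod.case roundtrip)
    have "\<alpha> i \<le> Suc K" "\<gamma> i - \<alpha> i + eps j i \<le> Suc K" for i
    proof -
      have "\<gamma> i \<le> K" using g1 by (simp add: mbox_def)
      then show "\<alpha> i \<le> Suc K" "\<gamma> i - \<alpha> i + eps j i \<le> Suc K"
        using le[of i] by (auto simp: eps_def)
    qed
    moreover have "(\<gamma> - \<alpha> + eps j) j \<ge> 1" by (simp add: eps_def)
    moreover then have "\<gamma> - \<alpha> + eps j \<noteq> 0" by (metis not_one_le_zero zero_fun_apply)
    ultimately show "(case x of (\<gamma>, \<alpha>) \<Rightarrow> (\<alpha>, \<gamma> - \<alpha> + eps j))
        \<in> {(\<alpha>, \<beta>). \<alpha> \<in> ?G \<and> \<beta> \<in> ?G \<and> 1 \<le> \<beta> j \<and> \<alpha> + \<beta> - eps j \<in> ?F}"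
      unfolding x_eq prod.case mem_Collect_eq roundtrip using al g1 by (simp add: mbox_def)
    have RV1: "R \<gamma> u \<in> V" using RV F0 g1 by blast
    show "(case case x of (\<gamma>, \<alpha>) \<Rightarrow> (\<alpha>, \<gamma> - \<alpha> + eps j) of (\<alpha>, \<beta>) \<Rightarrow> ?h \<alpha> \<beta>)
        = (case x of (\<gamma>, \<alpha>) \<Rightarrow> ?g \<gamma> \<alpha>)"
      unfolding x_eq prod.case roundtrip mono_divided_shift scale_scale[OF RV1]
      by (intro arg_cong2[of _ _ _ _ sc] refl) (simp add: ac_simps)
  next
    fix y assume y: "y \<in> {(\<alpha>, \<beta>). \<alpha> \<in> ?G \<and> \<beta> \<in> ?G \<and> 1 \<le> \<beta> j \<and> \<alpha> + \<beta> - eps j \<in> ?F}"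
    obtain \<alpha> \<beta> :: "'n \<Rightarrow> nat" where y_eq: "y = (\<alpha>, \<beta>)" by (cases y)
    have 1: "\<alpha> + \<beta> - eps j - \<alpha> + eps j = \<beta>"
      using y by (auto simp: y_eq fun_eq_iff eps_def)
    have 2: "\<alpha> \<le> \<alpha> + \<beta> - eps j" using y by (auto simp: y_eq le_fun_def eps_def)
    show "(case case y of (\<alpha>, \<beta>) \<Rightarrow> (\<alpha> + \<beta> - eps j, \<alpha>) of (\<gamma>, \<alpha>) \<Rightarrow> (\<alpha>, \<gamma> - \<alpha> + eps j)) = y"
      by (simp only: y_eq prod.case 1)
    show "(case y of (\<alpha>, \<beta>) \<Rightarrow> (\<alpha> + \<beta> - eps j, \<alpha>)) \<in> Sigma ?F (\<lambda>\<gamma>. {\<alpha>. \<alpha> \<le> \<gamma>} - {0})"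
      using y 2 by (auto simp: y_eq mbox_def)
  qed
  \<comment> \<open>The added pairs contribute nothing: either the scalar \<beta>_j is 0, or
    \<alpha> + \<beta> - \<epsilon>_j lies outside the support of \<open>R\<close>.\<close>
  also have "\<dots> = (\<Sum>(\<alpha>, \<beta>)\<in>?G \<times> ?G. ?h \<alpha> \<beta>)"
  proof (rule sum.mono_neutral_left)
    show "\<forall>x\<in>?G \<times> ?G - {(\<alpha>, \<beta>). \<alpha> \<in> ?G \<and> \<beta> \<in> ?G \<and> 1 \<le> \<beta> j \<and> \<alpha> + \<beta> - eps j \<in> ?F}.
        (case x of (\<alpha>, \<beta>) \<Rightarrow> ?h \<alpha> \<beta>) = 0"
    proof
      fix x assume x: "x \<in> ?G \<times> ?G - {(\<alpha>, \<beta>). \<alpha> \<in> ?G \<and> \<beta> \<in> ?G \<and> 1 \<le> \<beta> j \<and> \<alpha> + \<beta> - eps j \<in> ?F}"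
      obtain \<alpha> \<beta> where x_eq: "x = (\<alpha>, \<beta>)" by (cases x)
      have *: "\<alpha> \<in> ?G" "\<beta> \<in> ?G" "\<not> (1 \<le> \<beta> j \<and> \<alpha> + \<beta> - eps j \<in> ?F)"
        using x unfolding x_eq by auto
      have nz: "\<alpha> + \<beta> - eps j \<noteq> 0" using * by (intro index_nonzero) (auto simp: mbox_def)
      have "?h \<alpha> \<beta> = 0"
      proof (cases "\<beta> j = 0")
        case True
        then show ?thesis using RV[OF nz] by simp
      next
        case False
        then show ?thesis using * R0[OF nz] by simp
      qed
      then show "(case x of (\<alpha>, \<beta>) \<Rightarrow> ?h \<alpha> \<beta>) = 0" by (simp only: x_eq prod.case)
    qed
  qed auto
  also have "\<dots> = (\<Sum>\<alpha>\<in>?G. \<Sum>\<beta>\<in>?G. ?h \<alpha> \<beta>)" by (rule sum.cartesian_product[symmetric])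
  finally show ?thesis .
qed

text \<open>The failure of the torus relation for the generating functions is the generating
  function of the failures of the W_n^+ relations. It is read in both directions: the relations for
  \<rho> give those for D, and by uniqueness of coefficients the converse holds.\<close>

lemma comm_expansion:
  fixes s m :: "'n::finite \<Rightarrow> int" and \<rho> :: "'n \<Rightarrow> ('n \<Rightarrow> nat) \<Rightarrow> 'v \<Rightarrow> 'v"
  assumes mem: "\<And>j \<alpha> u. \<alpha> \<noteq> 0 \<Longrightarrow> u \<in> V \<Longrightarrow> \<rho> j \<alpha> u \<in> V"
    and lin: "\<And>j \<alpha>. \<alpha> \<noteq> 0 \<Longrightarrow> clin_on sc V sc (\<rho> j \<alpha>)"
    and supp: "\<And>j \<alpha> u. \<alpha> \<noteq> 0 \<Longrightarrow> \<alpha> \<notin> mbox K \<Longrightarrow> u \<in> V \<Longrightarrow> \<rho> j \<alpha> u = 0"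
    and u: "u \<in> V"
  defines "D \<equiv> \<lambda>j. expand (mbox K) (\<rho> j)"
  shows "D j s (D k m u) - D k m (D j s u)
      - (sc (of_int (m j)) (D k (s + m) u - D k m u) - sc (of_int (s k)) (D j (s + m) u - D j s u))
    = (\<Sum>\<alpha>\<in>mbox (Suc K). \<Sum>\<beta>\<in>mbox (Suc K). sc (mono s \<alpha> / mfact \<alpha> * (mono m \<beta> / mfact \<beta>))
        (\<rho> j \<alpha> (\<rho> k \<beta> u) - \<rho> k \<beta> (\<rho> j \<alpha> u)
         - (sc (of_nat (\<beta> j)) (\<rho> k (\<alpha> + \<beta> - eps j) u) - sc (of_nat (\<alpha> k)) (\<rho> j (\<alpha> + \<beta> - eps k) u))))"
proof -
  let ?G = "mbox (Suc K) :: ('n \<Rightarrow> nat) set"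
  have G0: "\<gamma> \<noteq> 0" if "\<gamma> \<in> ?G" for \<gamma> :: "'n \<Rightarrow> nat" using that by (simp add: mbox_def)
  have D_eq: "D j s v = (\<Sum>\<alpha>\<in>?G. sc (mono s \<alpha> / mfact \<alpha>) (\<rho> j \<alpha> v))" if "v \<in> V" for j s v
    unfolding D_def expand_def[symmetric] using that supp G0
    by (intro expand_superset mbox_mono) auto
  have prod: "D j s (D k m u) = (\<Sum>\<alpha>\<in>?G. \<Sum>\<beta>\<in>?G. sc (mono s \<alpha> / mfact \<alpha> * (mono m \<beta> / mfact \<beta>)) (\<rho> j \<alpha> (\<rho> k \<beta> u)))"
    for j k s m
  proof -
    have Du: "D k m u \<in> V" unfolding D_eq[OF u] using mem u G0 by auto
    show ?thesis
      unfolding D_eq[OF Du] unfolding D_eq[OF u]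
      using mem u G0 by (auto intro!: sum.cong simp: clin_on_lincomb[OF lin] scale_sum)
  qed
  have 1: "sc (of_int (m j)) (D k (s + m) u - D k m u)
    = (\<Sum>\<alpha>\<in>?G. \<Sum>\<beta>\<in>?G. sc (mono s \<alpha> / mfact \<alpha> * (mono m \<beta> / mfact \<beta>)) (sc (of_nat (\<beta> j)) (\<rho> k (\<alpha> + \<beta> - eps j) u)))"
    unfolding D_def by (rule expand_shift) (use mem supp u in auto)
  \<comment> \<open>The same shift identity with (s, \<alpha>) and (m, \<beta>) exchanged.\<close>
  have 2: "sc (of_int (s k)) (D j (s + m) u - D j s u)
    = (\<Sum>\<alpha>\<in>?G. \<Sum>\<beta>\<in>?G. sc (mono s \<alpha> / mfact \<alpha> * (mono m \<beta> / mfact \<beta>)) (sc (of_nat (\<alpha> k)) (\<rho> j (\<alpha> + \<beta> - eps k) u)))"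
  proof -
    have "sc (of_int (s k)) (D j (m + s) u - D j s u)
      = (\<Sum>\<alpha>\<in>?G. \<Sum>\<beta>\<in>?G. sc (mono m \<alpha> / mfact \<alpha> * (mono s \<beta> / mfact \<beta>)) (sc (of_nat (\<beta> k)) (\<rho> j (\<alpha> + \<beta> - eps k) u)))"
      unfolding D_def by (rule expand_shift) (use mem supp u in auto)
    then show ?thesis by (subst (asm) sum.swap) (simp only: add.commute mult.commute)
  qed
  have 3: "D k m (D j s u) = (\<Sum>\<alpha>\<in>?G. \<Sum>\<beta>\<in>?G. sc (mono s \<alpha> / mfact \<alpha> * (mono m \<beta> / mfact \<beta>)) (\<rho> k \<beta> (\<rho> j \<alpha> u)))"
    unfolding prod by (subst sum.swap) (simp only: mult.commute)
  show ?thesis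
    unfolding prod[of j s k m] 1 2 3 sum_subtractf[symmetric]
  proof (intro sum.cong refl)
    fix \<alpha> \<beta> :: "'n \<Rightarrow> nat" assume "\<alpha> \<in> ?G" "\<beta> \<in> ?G"
    note nz = G0[OF this(1)] G0[OF this(2)]
    then have "\<rho> j \<alpha> (\<rho> k \<beta> u) \<in> V" "\<rho> k \<beta> (\<rho> j \<alpha> u) \<in> V"
      "\<rho> k (\<alpha> + \<beta> - eps j) u \<in> V" "\<rho> j (\<alpha> + \<beta> - eps k) u \<in> V"
      using u by (simp_all add: mem index_nonzero)
    then show "sc (mono s \<alpha> / mfact \<alpha> * (mono m \<beta> / mfact \<beta>)) (\<rho> j \<alpha> (\<rho> k \<beta> u))
        - sc (mono s \<alpha> / mfact \<alpha> * (mono m \<beta> / mfact \<beta>)) (\<rho> k \<beta> (\<rho> j \<alpha> u))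
        - (sc (mono s \<alpha> / mfact \<alpha> * (mono m \<beta> / mfact \<beta>)) (sc (of_nat (\<beta> j)) (\<rho> k (\<alpha> + \<beta> - eps j) u))
        - sc (mono s \<alpha> / mfact \<alpha> * (mono m \<beta> / mfact \<beta>)) (sc (of_nat (\<alpha> k)) (\<rho> j (\<alpha> + \<beta> - eps k) u)))
      = sc (mono s \<alpha> / mfact \<alpha> * (mono m \<beta> / mfact \<beta>)) (\<rho> j \<alpha> (\<rho> k \<beta> u) - \<rho> k \<beta> (\<rho> j \<alpha> u)
         - (sc (of_nat (\<beta> j)) (\<rho> k (\<alpha> + \<beta> - eps j) u) - sc (of_nat (\<alpha> k)) (\<rho> j (\<alpha> + \<beta> - eps k) u)))"
      by (simp add: scale_diff del: scale_scale)
  qed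
qed

end

locale wplus_module = cvec sc U for sc :: "complex \<Rightarrow> 'u::ab_group_add \<Rightarrow> 'u" and U +
  fixes \<rho> :: "'n::finite \<Rightarrow> ('n \<Rightarrow> nat) \<Rightarrow> 'u \<Rightarrow> 'u"
  assumes rep: "Wplus_rep sc U \<rho>"
begin

lemma rho_mem [simp]: "\<alpha> \<noteq> 0 \<Longrightarrow> u \<in> U \<Longrightarrow> \<rho> j \<alpha> u \<in> U"
  and rho_lin: "\<alpha> \<noteq> 0 \<Longrightarrow> clin_on sc U sc (\<rho> j \<alpha>)"
  and rho_comm: "\<alpha> \<noteq> 0 \<Longrightarrow> \<beta> \<noteq> 0 \<Longrightarrow> u \<in> U \<Longrightarrow> \<rho> j \<alpha> (\<rho> k \<beta> u) - \<rho> k \<beta> (\<rho> j \<alpha> u)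
    = sc (of_nat (\<beta> j)) (\<rho> k (\<alpha> + \<beta> - eps j) u) - sc (of_nat (\<alpha> k)) (\<rho> j (\<alpha> + \<beta> - eps k) u)"
  using rep unfolding Wplus_rep_def by auto

text \<open>The field \<Sum>_i z_i \<partial>/\<partial>z_i, whose adjoint action grades
  W_n^+.\<close>

definition euler :: "'u \<Rightarrow> 'u" where
  "euler u = (\<Sum>i\<in>UNIV. \<rho> i (eps i) u)"

lemma euler_mem [simp]: "u \<in> U \<Longrightarrow> euler u \<in> U"
  unfolding euler_def by simp

lemma euler_lin: "clin_on sc U sc euler"
  unfolding clin_on_def euler_def
  by (simp add: clin_on_add[OF rho_lin] clin_on_scale[OF rho_lin] sum.distrib scale_sum)

text \<open>The Euler field counts |\<alpha>| from the coefficient z^\<alpha> and -1 from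
  \<partial>/\<partial>z_j. As \<alpha> \<noteq> 0, the natural number subtraction is exact.\<close>

lemma euler_comm:
  assumes a: "\<alpha> \<noteq> 0" and u: "u \<in> U"
  shows "euler (\<rho> j \<alpha> u) - \<rho> j \<alpha> (euler u) = sc (of_nat (sum \<alpha> UNIV - 1)) (\<rho> j \<alpha> u)"
proof -
  have pos: "sum \<alpha> UNIV \<ge> 1"
  proof -
    obtain i where "\<alpha> i \<noteq> 0" using a by (auto simp: fun_eq_iff)
    then show ?thesis using member_le_sum[of i UNIV \<alpha>] by auto
  qed
  have i: "eps i + \<alpha> - eps i = \<alpha>" for i by simp
  have "euler (\<rho> j \<alpha> u) - \<rho> j \<alpha> (euler u) = (\<Sum>i\<in>UNIV. \<rho> i (eps i) (\<rho> j \<alpha> u) - \<rho> j \<alpha> (\<rho> i (eps i) u))"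
    using a u by (simp add: euler_def clin_on_sum[OF rho_lin] sum_subtractf)
  also have "\<dots> = (\<Sum>i\<in>UNIV. sc (of_nat (\<alpha> i)) (\<rho> j \<alpha> u) - (if i = j then \<rho> j \<alpha> u else 0))"
  proof (rule sum.cong[OF refl])
    fix i
    have "eps i + \<alpha> - eps j \<noteq> 0" using a by (intro index_nonzero) auto
    then show "\<rho> i (eps i) (\<rho> j \<alpha> u) - \<rho> j \<alpha> (\<rho> i (eps i) u)
        = sc (of_nat (\<alpha> i)) (\<rho> j \<alpha> u) - (if i = j then \<rho> j \<alpha> u else 0)"
      unfolding rho_comm[OF eps_nonzero a u] i using a u by (auto simp: eps_def)
  qed
  also have "\<dots> = sc (of_nat (sum \<alpha> UNIV)) (\<rho> j \<alpha> u) - sc 1 (\<rho> j \<alpha> u)"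
    using a u by (simp add: sum_subtractf sum_scale)
  also have "\<dots> = sc (of_nat (sum \<alpha> UNIV - 1)) (\<rho> j \<alpha> u)"
    using a u pos by (simp add: scale_left_diff of_nat_diff)
  finally show ?thesis .
qed

lemma euler_eigen_vanish:
  assumes "findim sc U"
  obtains N :: nat where
    "\<And>a X. N \<le> a \<Longrightarrow> (\<And>x. x \<in> U \<Longrightarrow> X x \<in> U) \<Longrightarrow> clin_on sc U sc X \<Longrightarrow>
      (\<And>x. x \<in> U \<Longrightarrow> euler (X x) - X (euler x) = sc (of_nat a) (X x)) \<Longrightarrow> \<forall>x\<in>U. X x = 0"
  using ad_eigen_vanish[OF assms euler_mem euler_lin] by blast

definition supported :: "nat \<Rightarrow> bool" where
  "supported K \<longleftrightarrow> (\<forall>j. Wp_supp U \<rho> j \<subseteq> mbox K)"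

lemma supportedD: "supported K \<Longrightarrow> \<alpha> \<noteq> 0 \<Longrightarrow> \<alpha> \<notin> mbox K \<Longrightarrow> u \<in> U \<Longrightarrow> \<rho> j \<alpha> u = 0"
  by (auto simp: supported_def Wp_supp_def)

text \<open>The degree |\<alpha>| - 1 is an eigenvalue of ad \<open>euler\<close>, hence bounded for
  operators that do not vanish, and an exponent outside a large box has large degree.\<close>

lemma finite_support:
  assumes "findim sc U"
  obtains K where "supported K"
proof -
  obtain N :: nat where N: "\<And>a X. N \<le> a \<Longrightarrow> (\<And>x. x \<in> U \<Longrightarrow> X x \<in> U) \<Longrightarrow> clin_on sc U sc X \<Longrightarrow>
      (\<And>x. x \<in> U \<Longrightarrow> euler (X x) - X (euler x) = sc (of_nat a) (X x)) \<Longrightarrow> \<forall>x\<in>U. X x = 0"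
    using euler_eigen_vanish[OF assms] by blast
  have "\<rho> j \<alpha> u = 0" if a: "\<alpha> \<noteq> 0" "\<alpha> \<notin> mbox (Suc N)" and u: "u \<in> U" for j \<alpha> u
  proof -
    obtain i where "\<alpha> i > Suc N" using a by (auto simp: mbox_def not_le)
    then have "N \<le> sum \<alpha> UNIV - 1" using member_le_sum[of i UNIV \<alpha>] by auto
    from N[OF this rho_mem[OF a(1)] rho_lin[OF a(1)] euler_comm[OF a(1)]]
    show ?thesis using u by blast
  qed
  then have "supported (Suc N)" by (auto simp: supported_def Wp_supp_def)
  then show thesis by (rule that)
qed

end

text \<open>\<open>poly_coeff_mem\<close> for the difference of the two families and the zero
  subspace.\<close>

lemma (in cvec) expansion_unique:
  fixes R R' :: "('n::finite \<Rightarrow> nat) \<Rightarrow> 'v"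
  assumes A: "finite A" "\<And>\<alpha>. \<alpha> \<in> A \<Longrightarrow> R \<alpha> \<in> V" "\<And>\<alpha>. \<alpha> \<in> A \<Longrightarrow> R' \<alpha> \<in> V"
    and eq: "\<And>s::'n \<Rightarrow> int. (\<Sum>\<alpha>\<in>A. sc (mono s \<alpha> / mfact \<alpha>) (R \<alpha>)) = (\<Sum>\<alpha>\<in>A. sc (mono s \<alpha> / mfact \<alpha>) (R' \<alpha>))"
    and \<alpha>: "\<alpha> \<in> A"
  shows "R \<alpha> = R' \<alpha>"
proof -
  have "sc (1 / mfact \<alpha>) (R \<alpha> - R' \<alpha>) \<in> {0}"
  proof (rule poly_coeff_mem[where F = A and c = "\<lambda>\<alpha>. sc (1 / mfact \<alpha>) (R \<alpha> - R' \<alpha>)"])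
    fix s :: "'n \<Rightarrow> int"
    have "(\<Sum>\<alpha>\<in>A. sc (mono s \<alpha>) (sc (1 / mfact \<alpha>) (R \<alpha> - R' \<alpha>)))
      = (\<Sum>\<alpha>\<in>A. sc (mono s \<alpha> / mfact \<alpha>) (R \<alpha>)) - (\<Sum>\<alpha>\<in>A. sc (mono s \<alpha> / mfact \<alpha>) (R' \<alpha>))"
      unfolding sum_subtractf[symmetric] using A by (intro sum.cong) (simp_all add: scale_diff)
    then show "(\<Sum>\<alpha>\<in>A. sc (mono s \<alpha>) (sc (1 / mfact \<alpha>) (R \<alpha> - R' \<alpha>))) \<in> {0}" using eq by simp
  qed (use A \<alpha> cvs_zero in auto)
  then have "R \<alpha> - R' \<alpha> = 0"
    using scale_eq_0D[of "R \<alpha> - R' \<alpha>" "1 / mfact \<alpha>"] A(2,3)[OF \<alpha>] by simp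
  then show ?thesis by simp
qed

text \<open>The factor \<open>mfact \<alpha>\<close> turns the coefficients of
  \<open>D_polynomial\<close> into coefficients of divided powers; for these
  \<open>comm_expansion\<close> converts \<open>D_comm\<close> into the relations of W_n^+.\<close>

theorem (in vanishing_fields) D_wplus_rep:
  "\<exists>K C. Wplus_rep sc U C \<and> (\<forall>j. Wp_supp U C j \<subseteq> mbox K)
    \<and> (\<forall>j s. \<forall>u\<in>U. D j s u = expand (mbox K) (C j) s u)"
proof -
  obtain A C0 where A: "finite A" "0 \<notin> A"
    and C0: "\<And>j \<alpha> u. u \<in> U \<Longrightarrow> C0 j \<alpha> u \<in> U" "\<And>j \<alpha>. clin_on sc U sc (C0 j \<alpha>)"
    and D_eq: "\<And>j s u. u \<in> U \<Longrightarrow> D j s u = (\<Sum>\<alpha>\<in>A. sc (mono s \<alpha>) (C0 j \<alpha> u))"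
    using D_polynomial by blast
  define C where "C j \<alpha> u = (if \<alpha> \<in> A then sc (mfact \<alpha>) (C0 j \<alpha> u) else 0)" for j \<alpha> u
  have C_zero: "C j \<alpha> u = 0" if "\<alpha> \<notin> A" for j \<alpha> u using that by (simp add: C_def)
  have C_mem: "C j \<alpha> u \<in> U" if "u \<in> U" for j \<alpha> u using that C0 by (simp add: C_def)
  have C_lin: "clin_on sc U sc (C j \<alpha>)" for j \<alpha>
    unfolding clin_on_def C_def
    by (auto simp: C0(1) clin_on_add[OF C0(2)] clin_on_scale[OF C0(2)] scale_add mult.commute)
  have D_expand: "D j s u = expand (mbox K) (C j) s u" if K: "A \<subseteq> mbox K" and u: "u \<in> U" for K j s u
  proof -
    have "D j s u = expand A (C j) s u"
      unfolding D_eq[OF u] expand_def using u C0 by (intro sum.cong) (simp_all add: C_def)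
    also have "\<dots> = expand (mbox K) (C j) s u"
      using K by (intro expand_superset) (auto simp: C_def)
    finally show ?thesis .
  qed
  have "Wplus_rep sc U C"
    unfolding Wplus_rep_def
  proof (intro conjI allI impI ballI cvs C_mem C_lin)
    fix j k :: 'n and \<alpha> \<beta> :: "'n \<Rightarrow> nat" and u assume ab: "\<alpha> \<noteq> 0" "\<beta> \<noteq> 0" and u: "u \<in> U"
    \<comment> \<open>The box also contains the two given exponents, so that their coefficient is
      among those compared.\<close>
    obtain K where K: "A \<union> {\<alpha>, \<beta>} \<subseteq> mbox K" using finite_subset_mbox[of "A \<union> {\<alpha>, \<beta>}"] A ab by auto
    let ?G = "mbox (Suc K) :: ('n \<Rightarrow> nat) set"
    let ?X = "\<lambda>\<alpha> \<beta>. C j \<alpha> (C k \<beta> u) - C k \<beta> (C j \<alpha> u)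
         - (sc (of_nat (\<beta> j)) (C k (\<alpha> + \<beta> - eps j) u) - sc (of_nat (\<alpha> k)) (C j (\<alpha> + \<beta> - eps k) u))"
    have X: "?X \<alpha> \<beta> \<in> U" for \<alpha> \<beta> using u C_mem by simp
    have DE: "D i s v = expand (mbox K) (C i) s v" if "v \<in> U" for i s v
      using D_expand K that by blast
    have EU: "expand (mbox K) (C i) s v \<in> U" if "v \<in> U" for i s v
      using C_mem that by simp
    have zero: "(\<Sum>\<alpha>\<in>?G. \<Sum>\<beta>\<in>?G. sc (mono s \<alpha> / mfact \<alpha> * (mono m \<beta> / mfact \<beta>)) (?X \<alpha> \<beta>)) = 0" for s m
    proof -
      have "(\<Sum>\<alpha>\<in>?G. \<Sum>\<beta>\<in>?G. sc (mono s \<alpha> / mfact \<alpha> * (mono m \<beta> / mfact \<beta>)) (?X \<alpha> \<beta>))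
        = D j s (D k m u) - D k m (D j s u)
        - (sc (of_int (m j)) (D k (s + m) u - D k m u) - sc (of_int (s k)) (D j (s + m) u - D j s u))"
        unfolding DE[OF u] DE[OF EU[OF u]]
        by (rule comm_expansion[symmetric]) (use C_mem C_lin u K in \<open>auto intro: C_zero\<close>)
      then show ?thesis using D_comm[OF u] by simp
    qed
    \<comment> \<open>Coefficients are compared in s with m held fixed, and afterwards in m.\<close>
    have "(\<Sum>\<beta>\<in>?G. sc (mono m \<beta> / mfact \<beta>) (?X \<alpha> \<beta>)) = 0" for m
    proof (rule expansion_unique[where A = ?G and \<alpha> = \<alpha> and R' = "\<lambda>_. 0"
          and R = "\<lambda>\<alpha>. \<Sum>\<beta>\<in>?G. sc (mono m \<beta> / mfact \<beta>) (?X \<alpha> \<beta>)"])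
      show "\<alpha> \<in> ?G" using K mbox_mono[of K "Suc K"] by auto
      fix s
      have "(\<Sum>\<alpha>\<in>?G. sc (mono s \<alpha> / mfact \<alpha>) (\<Sum>\<beta>\<in>?G. sc (mono m \<beta> / mfact \<beta>) (?X \<alpha> \<beta>)))
        = (\<Sum>\<alpha>\<in>?G. \<Sum>\<beta>\<in>?G. sc (mono s \<alpha> / mfact \<alpha> * (mono m \<beta> / mfact \<beta>)) (?X \<alpha> \<beta>))"
        using X by (intro sum.cong refl) (simp add: scale_sum)
      then show "(\<Sum>\<alpha>\<in>?G. sc (mono s \<alpha> / mfact \<alpha>) (\<Sum>\<beta>\<in>?G. sc (mono m \<beta> / mfact \<beta>) (?X \<alpha> \<beta>)))
        = (\<Sum>\<alpha>\<in>?G. sc (mono s \<alpha> / mfact \<alpha>) 0)" using zero by simp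
    qed (use X in auto)
    then have "?X \<alpha> \<beta> = 0"
      using X K mbox_mono[of K "Suc K"]
      by (intro expansion_unique[where A = ?G and \<alpha> = \<beta> and R' = "\<lambda>_. 0" and R = "?X \<alpha>"]) auto
    then show "C j \<alpha> (C k \<beta> u) - C k \<beta> (C j \<alpha> u)
      = sc (of_nat (\<beta> j)) (C k (\<alpha> + \<beta> - eps j) u) - sc (of_nat (\<alpha> k)) (C j (\<alpha> + \<beta> - eps k) u)"
      by simp
  qed
  moreover obtain K where K: "A \<subseteq> mbox K" using finite_subset_mbox A by blast
  moreover have "Wp_supp U C j \<subseteq> mbox K" for j using K by (auto simp: Wp_supp_def C_def)
  ultimately show ?thesis
    using D_expand[OF K] by blast
qed

section \<open>From W_n^+-modules to category J: the axioms, submodules, indecomposability and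
  irreducibility\<close>

section \<open>The modules \<open>F(T\<^sup>n) \<otimes> U\<close>\<close>

lemma sum_apply: "(sum f A) k = (\<Sum>a\<in>A. f a k)"
  by (induction A rule: infinite_finite_induct) auto

lemma Jops_simps [simp]: "Jops d e (Inl (j, s)) x = d j s x" "Jops d e (Inr m) x = e m x"
  by (simp_all add: Jops_def)

lemma ops_sub_Jops: "ops_sub sc V UNIV (Jops d e) W \<longleftrightarrow> W \<subseteq> V \<and> cvs sc W
    \<and> (\<forall>j s. \<forall>x\<in>W. d j s x \<in> W) \<and> (\<forall>m. \<forall>x\<in>W. e m x \<in> W)"
  by (auto simp: ops_sub_def split_sum_all)

lemma ops_iso_Jops: "ops_iso sc V UNIV (Jops d e) sc' V' (Jops d' e') \<longleftrightarrow>
    (\<exists>f. bij_betw f V V' \<and> clin_on sc V sc' f \<and> (\<forall>j s. \<forall>x\<in>V. f (d j s x) = d' j s (f x))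
      \<and> (\<forall>m. \<forall>x\<in>V. f (e m x) = e' m (f x)))"
  by (simp add: ops_iso_def split_sum_all)

lemma ops_sub_Wp: "ops_sub sc U Wp_idx (Wp_ops \<rho>) A \<longleftrightarrow> A \<subseteq> U \<and> cvs sc A
    \<and> (\<forall>j \<alpha>. \<alpha> \<noteq> 0 \<longrightarrow> (\<forall>x\<in>A. \<rho> j \<alpha> x \<in> A))"
  by (auto simp: ops_sub_def Wp_idx_def Wp_ops_def)

lemma ops_iso_Wp: "ops_iso sc U Wp_idx (Wp_ops \<rho>) sc' U' (Wp_ops \<rho>') \<longleftrightarrow>
    (\<exists>f. bij_betw f U U' \<and> clin_on sc U sc' f
      \<and> (\<forall>j \<alpha>. \<alpha> \<noteq> 0 \<longrightarrow> (\<forall>x\<in>U. f (\<rho> j \<alpha> x) = \<rho>' j \<alpha> (f x))))"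
  by (simp add: ops_iso_def Wp_idx_def Wp_ops_def)

text \<open>The pure tensor e_m \<otimes> u.\<close>

definition sgl :: "('n \<Rightarrow> int) \<Rightarrow> 'u::zero \<Rightarrow> ('n \<Rightarrow> int) \<Rightarrow> 'u" where
  "sgl m u = (\<lambda>k. if k = m then u else 0)"

lemma sgl_eq_iff [simp]: "sgl m u = sgl m v \<longleftrightarrow> u = v"
  by (auto simp: sgl_def fun_eq_iff)

lemma sgl_zero [simp]: "sgl m 0 = 0"
  by (auto simp: sgl_def fun_eq_iff)

lemma sgl_add: "sgl m (u + v) = sgl m u + (sgl m v :: _ \<Rightarrow> 'u::ab_group_add)"
  by (auto simp: sgl_def fun_eq_iff)

lemma shiftE_sgl [simp]: "shiftE m (sgl k u) = sgl (k + m) u"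
  by (auto simp: sgl_def shiftE_def fun_eq_iff diff_eq_eq)

lemma shiftE_shiftE [simp]: "shiftE m (shiftE k f) = shiftE (m + k) f"
  by (simp add: shiftE_def fun_eq_iff algebra_simps)

lemma shiftE_0 [simp]: "shiftE 0 f = f"
  by (simp add: shiftE_def)

lemma finite_shift_support:
  "finite {k. f k \<noteq> 0} \<Longrightarrow> finite {k :: 'n \<Rightarrow> int. f (k - s) \<noteq> 0}"
proof -
  assume *: "finite {k. f k \<noteq> 0}"
  have "{k. f (k - s) \<noteq> 0} \<subseteq> (\<lambda>k. k + s) ` {k. f k \<noteq> 0}"
  proof
    fix k assume "k \<in> {k. f (k - s) \<noteq> 0}"
    then show "k \<in> (\<lambda>k. k + s) ` {k. f k \<noteq> 0}" by (intro image_eqI[of _ _ "k - s"]) auto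
  qed
  then show ?thesis using * finite_surj by blast
qed

lemma FU_decomp:
  fixes f :: "('n \<Rightarrow> int) \<Rightarrow> 'u::ab_group_add"
  assumes "finite {m. f m \<noteq> 0}"
  shows "f = (\<Sum>m | f m \<noteq> 0. sgl m (f m))"
proof
  fix k
  show "f k = (\<Sum>m | f m \<noteq> 0. sgl m (f m)) k"
    using assms by (simp add: sum_apply sgl_def)
qed

context cvec
begin

lemma FU_D: "f \<in> FU V \<Longrightarrow> f k \<in> V" "f \<in> FU V \<Longrightarrow> finite {m. f m \<noteq> 0}"
  by (auto simp: FU_def)

lemma cvec_FU: "cvec (scF sc) (FU V :: (('n \<Rightarrow> int) \<Rightarrow> 'v) set)"
proof
  show "cvs (scF sc) (FU V :: (('n \<Rightarrow> int) \<Rightarrow> 'v) set)"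
    unfolding cvs_def
  proof (intro conjI allI ballI)
    show "0 \<in> FU V" by (simp add: FU_def)
    fix f g :: "('n \<Rightarrow> int) \<Rightarrow> 'v" assume fg: "f \<in> FU V" "g \<in> FU V"
    have "{m. (f + g) m \<noteq> 0} \<subseteq> {m. f m \<noteq> 0} \<union> {m. g m \<noteq> 0}" by auto
    then have "finite {m. (f + g) m \<noteq> 0}" by (rule finite_subset) (use fg in \<open>simp add: FU_def\<close>)
    then show "f + g \<in> FU V" using fg by (simp add: FU_def)
  next
    fix c and f :: "('n \<Rightarrow> int) \<Rightarrow> 'v" assume f: "f \<in> FU V"
    have "{m. scF sc c f m \<noteq> 0} \<subseteq> {m. f m \<noteq> 0}" using f by (auto simp: scF_def FU_def)
    then have "finite {m. scF sc c f m \<noteq> 0}" by (rule finite_subset) (use f in \<open>simp add: FU_def\<close>)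
    then show "scF sc c f \<in> FU V" using f by (simp add: FU_def scF_def)
  qed (simp_all add: scF_def fun_eq_iff FU_D scale_add scale_left_add)
qed

lemma sgl_FU [simp]: "u \<in> V \<Longrightarrow> sgl m u \<in> FU V"
  by (simp add: FU_def sgl_def)

lemma shiftE_FU [simp]: "f \<in> FU V \<Longrightarrow> shiftE m f \<in> FU V"
  by (simp add: FU_def shiftE_def finite_shift_support)

lemma scF_sgl: "scF sc c (sgl m u) = sgl m (sc c u)"
  by (auto simp: scF_def sgl_def fun_eq_iff)

lemma FU_sumI:
  assumes "cvs (scF sc) W" "f \<in> FU V" "\<And>m. sgl m (f m) \<in> W"
  shows "f \<in> W"
proof -
  interpret W: cvec "scF sc" W by unfold_locales fact
  have "(\<Sum>m | f m \<noteq> 0. sgl m (f m)) \<in> W" using assms by (intro W.sum_mem)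
  then show ?thesis
    by (rule iffD2[OF arg_cong[OF FU_decomp[OF FU_D(2)[OF assms(2)]], of "\<lambda>x. x \<in> W"]])
qed

text \<open>A spanning set of least cardinality is independent, since a nontrivial relation would
  allow one vector to be dropped. Coefficients are required to vanish off \<open>B\<close> so that
  they are unique as functions on the whole type.\<close>

lemma findim_basis:
  assumes "findim sc V"
  obtains B where "finite B" "B \<subseteq> V"
    "\<And>x. x \<in> V \<Longrightarrow> \<exists>!c. (\<forall>b. c b \<noteq> 0 \<longrightarrow> b \<in> B) \<and> x = (\<Sum>b\<in>B. sc (c b) b)"
proof -
  define P where "P B \<longleftrightarrow> finite B \<and> B \<subseteq> V \<and> V \<subseteq> cspan sc B" for B
  define B where "B = arg_min card P"
  have "\<exists>B. P B" using assms unfolding findim_def P_def by blast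
  then have PB: "P B" and min: "\<And>B'. P B' \<Longrightarrow> card B \<le> card B'"
    unfolding B_def using arg_min_natI[of P _ card] arg_min_nat_le[of P _ card] by blast+
  have fin: "finite B" and BV: "B \<subseteq> V" and span: "V \<subseteq> cspan sc B" using PB by (auto simp: P_def)
  have indep: "r b = 0" if c: "(\<Sum>b\<in>B. sc (r b) b) = 0" and b: "b \<in> B" for r b
  proof (rule ccontr)
    assume rb: "r b \<noteq> 0"
    let ?B = "B - {b}"
    have BV': "?B \<subseteq> V" and bV: "b \<in> V" using BV b by auto
    interpret S: cvec sc "cspan sc ?B" by unfold_locales (rule cspan_cvs[OF BV'])
    have "sc (r b) b + (\<Sum>a\<in>?B. sc (r a) a) = 0"
      using c sum.remove[OF fin b, of "\<lambda>b. sc (r b) b"] by simp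
    then have "sc (r b) b = - (\<Sum>a\<in>?B. sc (r a) a)" by (simp add: eq_neg_iff_add_eq_0)
    moreover have "(\<Sum>a\<in>?B. sc (r a) a) \<in> cspan sc ?B" using fin by (intro cspanI) auto
    ultimately have "sc (r b) b \<in> cspan sc ?B" by simp
    then have "b \<in> cspan sc ?B" using scale_memD[OF bV S.cvs] rb by blast
    moreover have "x \<in> cspan sc ?B" if "x \<in> ?B" for x using cspan_base[OF that] that BV' by blast
    ultimately have "B \<subseteq> cspan sc ?B" by blast
    then have "cspan sc B \<subseteq> cspan sc ?B" by (rule cspan_least[OF _ S.cvs])
    then have "P ?B" using fin BV' span by (auto simp: P_def)
    then show False using min[of ?B] card_Diff1_less[OF fin b] by linarith
  qed
  show thesis
  proof (rule that[OF fin BV], rule ex_ex1I)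
    fix x assume "x \<in> V"
    then obtain F c where F: "finite F" "F \<subseteq> B" "x = (\<Sum>v\<in>F. sc (c v) v)"
      using span unfolding cspan_def by blast
    have "x = (\<Sum>v\<in>B. sc (if v \<in> F then c v else 0) v)" unfolding F
      by (rule sum.mono_neutral_cong_left) (use F fin BV in auto)
    then show "\<exists>c. (\<forall>b. c b \<noteq> 0 \<longrightarrow> b \<in> B) \<and> x = (\<Sum>b\<in>B. sc (c b) b)"
      using F(2) by (intro exI[of _ "\<lambda>v. if v \<in> F then c v else 0"]) auto
  next
    fix x c c'
    assume c: "(\<forall>b. c b \<noteq> 0 \<longrightarrow> b \<in> B) \<and> x = (\<Sum>b\<in>B. sc (c b) b)"
      and c': "(\<forall>b. c' b \<noteq> 0 \<longrightarrow> b \<in> B) \<and> x = (\<Sum>b\<in>B. sc (c' b) b)"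
    have "(\<Sum>b\<in>B. sc (c b - c' b) b) = (\<Sum>b\<in>B. sc (c b) b) - (\<Sum>b\<in>B. sc (c' b) b)"
      unfolding sum_subtractf[symmetric] using BV by (intro sum.cong) (auto simp: scale_left_diff)
    then have "(\<Sum>b\<in>B. sc (c b - c' b) b) = 0" using c c' by simp
    then have "\<forall>b\<in>B. c b - c' b = 0" using indep[of "\<lambda>b. c b - c' b"] by blast
    then have "c b = c' b" if "b \<in> B" for b using that by simp
    moreover have "c b = c' b" if "b \<notin> B" for b using that c c' by metis
    ultimately show "c = c'" by blast
  qed
qed

text \<open>A basis of U placed in degree 0 is a free basis: the coefficient of e_k at such a basis
  vector is the coordinate of \<open>f k\<close>.\<close>

lemma FU_free:
  assumes "findim sc V"
  shows "\<exists>B. finite B \<and> B \<subseteq> FU V \<and> (\<forall>f\<in>FU V. \<exists>!c :: (('n \<Rightarrow> int) \<Rightarrow> 'v) \<Rightarrow> ('n \<Rightarrow> int) \<Rightarrow> complex.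
          (\<forall>b m. c b m \<noteq> 0 \<longrightarrow> b \<in> B) \<and> (\<forall>b. finite {m. c b m \<noteq> 0})
          \<and> f = (\<Sum>b\<in>B. \<Sum>m\<in>{m. c b m \<noteq> 0}. scF sc (c b m) (shiftE m b)))"
proof -
  obtain B where B: "finite B" "B \<subseteq> V"
    and ex: "\<And>x. x \<in> V \<Longrightarrow> \<exists>!c. (\<forall>b. c b \<noteq> 0 \<longrightarrow> b \<in> B) \<and> x = (\<Sum>b\<in>B. sc (c b) b)"
    using findim_basis[OF assms] by blast
  define co where "co x = (THE c. (\<forall>b. c b \<noteq> 0 \<longrightarrow> b \<in> B) \<and> x = (\<Sum>b\<in>B. sc (c b) b))" for x
  have co: "(\<forall>b. co x b \<noteq> 0 \<longrightarrow> b \<in> B) \<and> x = (\<Sum>b\<in>B. sc (co x b) b)" if "x \<in> V" for x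
    unfolding co_def by (rule theI'[OF ex[OF that]])
  have co_unique: "c = co x" if "x \<in> V" "\<And>b. c b \<noteq> 0 \<Longrightarrow> b \<in> B" "x = (\<Sum>b\<in>B. sc (c b) b)" for x c
    using ex[OF that(1)] co[OF that(1)] that(2,3) by blast
  \<comment> \<open>The coordinates of 0 vanish, so the coefficient families built from a finitely
    supported f are finitely supported.\<close>
  have "(\<Sum>b\<in>B. sc 0 b) = 0" by (rule sum.neutral) (use B in auto)
  then have co0: "co 0 = (\<lambda>_. 0)" by (intro co_unique[symmetric]) auto
  let ?S = "sgl (0 :: 'n \<Rightarrow> int) :: 'v \<Rightarrow> ('n \<Rightarrow> int) \<Rightarrow> 'v"
  have inj: "inj_on ?S B" by (auto simp: inj_on_def)
  \<comment> \<open>A translate e_m \<otimes> b is nonzero at k only for m = k, so evaluation at k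
    reduces freeness to uniqueness of coordinates in U.\<close>
  have eval: "(\<Sum>b\<in>?S ` B. \<Sum>m\<in>{m. c b m \<noteq> 0}. scF sc (c b m) (shiftE m b)) k = (\<Sum>b\<in>B. sc (c (?S b) k) b)"
    if fin: "\<And>b. finite {m. c b m \<noteq> 0}" for c k
  proof -
    have "(\<Sum>b\<in>?S ` B. \<Sum>m\<in>{m. c b m \<noteq> 0}. scF sc (c b m) (shiftE m b)) k
      = (\<Sum>b\<in>B. \<Sum>m\<in>{m. c (?S b) m \<noteq> 0}. scF sc (c (?S b) m) (shiftE m (?S b)) k)"
      by (simp add: sum_apply sum.reindex[OF inj])
    also have "\<dots> = (\<Sum>b\<in>B. sc (c (?S b) k) b)"
    proof (rule sum.cong[OF refl])
      fix b assume b: "b \<in> B"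
      have "(\<Sum>m\<in>{m. c (?S b) m \<noteq> 0}. scF sc (c (?S b) m) (shiftE m (?S b)) k)
        = (\<Sum>m\<in>{m. c (?S b) m \<noteq> 0}. if m = k then sc (c (?S b) k) b else 0)"
        by (intro sum.cong refl) (auto simp: scF_sgl, auto simp: sgl_def)
      also have "\<dots> = sc (c (?S b) k) b" using fin b B by auto
      finally show "(\<Sum>m\<in>{m. c (?S b) m \<noteq> 0}. scF sc (c (?S b) m) (shiftE m (?S b)) k) = sc (c (?S b) k) b" .
    qed
    finally show ?thesis .
  qed
  show ?thesis
  proof (intro exI[of _ "?S ` B"] conjI ballI)
    show "finite (?S ` B)" "?S ` B \<subseteq> FU V" using B by auto
    fix f :: "('n \<Rightarrow> int) \<Rightarrow> 'v" assume f: "f \<in> FU V"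
    show "\<exists>!c. (\<forall>b m. c b m \<noteq> 0 \<longrightarrow> b \<in> ?S ` B) \<and> (\<forall>b. finite {m. c b m \<noteq> 0})
          \<and> f = (\<Sum>b\<in>?S ` B. \<Sum>m\<in>{m. c b m \<noteq> 0}. scF sc (c b m) (shiftE m b))"
    proof (rule ex_ex1I)
      let ?c = "\<lambda>b m. if b \<in> ?S ` B then co (f m) (b 0) else 0"
      have fin: "finite {m. ?c b m \<noteq> 0}" for b
        by (rule finite_subset[OF _ FU_D(2)[OF f]]) (auto simp: co0)
      have "f = (\<Sum>b\<in>?S ` B. \<Sum>m\<in>{m. ?c b m \<noteq> 0}. scF sc (?c b m) (shiftE m b))"
      proof
        fix k
        have "f k = (\<Sum>b\<in>B. sc (co (f k) b) b)" using co FU_D(1)[OF f] by blast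
        also have "\<dots> = (\<Sum>b\<in>B. sc (?c (?S b) k) b)" by (intro sum.cong) (auto simp: sgl_def)
        also have "\<dots> = (\<Sum>b\<in>?S ` B. \<Sum>m\<in>{m. ?c b m \<noteq> 0}. scF sc (?c b m) (shiftE m b)) k"
          by (rule eval[OF fin, symmetric])
        finally show "f k = (\<Sum>b\<in>?S ` B. \<Sum>m\<in>{m. ?c b m \<noteq> 0}. scF sc (?c b m) (shiftE m b)) k" .
      qed
      then show "\<exists>c. (\<forall>b m. c b m \<noteq> 0 \<longrightarrow> b \<in> ?S ` B) \<and> (\<forall>b. finite {m. c b m \<noteq> 0})
          \<and> f = (\<Sum>b\<in>?S ` B. \<Sum>m\<in>{m. c b m \<noteq> 0}. scF sc (c b m) (shiftE m b))"
        using fin by (intro exI[of _ ?c] conjI allI) auto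
    next
      fix c c'
      have key: "c b k = (if b \<in> ?S ` B then co (f k) (b 0) else 0)"
        if "(\<forall>b m. c b m \<noteq> 0 \<longrightarrow> b \<in> ?S ` B) \<and> (\<forall>b. finite {m. c b m \<noteq> 0})
          \<and> f = (\<Sum>b\<in>?S ` B. \<Sum>m\<in>{m. c b m \<noteq> 0}. scF sc (c b m) (shiftE m b))" for c b k
      proof -
        have "f k = (\<Sum>b\<in>B. sc (c (?S b) k) b)" using that eval[of c k] by metis
        then have "f k = (\<Sum>b\<in>B. sc (if b \<in> B then c (?S b) k else 0) b)" by simp
        then have eq: "(\<lambda>b. if b \<in> B then c (?S b) k else 0) = co (f k)"
          by (intro co_unique FU_D(1)[OF f]) (simp split: if_splits)
        have "co (f k) b = c (?S b) k" if "b \<in> B" for b using fun_cong[OF eq, of b] that by simp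
        then show ?thesis using that by (auto simp: sgl_def)
      qed
      assume "(\<forall>b m. c b m \<noteq> 0 \<longrightarrow> b \<in> ?S ` B) \<and> (\<forall>b. finite {m. c b m \<noteq> 0})
          \<and> f = (\<Sum>b\<in>?S ` B. \<Sum>m\<in>{m. c b m \<noteq> 0}. scF sc (c b m) (shiftE m b))"
        "(\<forall>b m. c' b m \<noteq> 0 \<longrightarrow> b \<in> ?S ` B) \<and> (\<forall>b. finite {m. c' b m \<noteq> 0})
          \<and> f = (\<Sum>b\<in>?S ` B. \<Sum>m\<in>{m. c' b m \<noteq> 0}. scF sc (c' b m) (shiftE m b))"
      from key[OF this(1)] key[OF this(2)] show "c = c'" by (intro ext) (simp only:)
    qed
  qed
qed

end

locale wplus_module_fd = wplus_module sc U \<rho>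
  for sc :: "complex \<Rightarrow> 'u::ab_group_add \<Rightarrow> 'u" and U and \<rho> :: "'n::finite \<Rightarrow> ('n \<Rightarrow> nat) \<Rightarrow> 'u \<Rightarrow> 'u" +
  assumes fd: "findim sc U"
begin

text \<open>The action of (exp(s.z) - 1) \<partial>_j on U. The index set depends on j, hence the
  passage to a common box in \<open>Dw_eq\<close>.\<close>

definition Dw :: "'n \<Rightarrow> ('n \<Rightarrow> int) \<Rightarrow> 'u \<Rightarrow> 'u" where
  "Dw j s u = expand (Wp_supp U \<rho> j) (\<rho> j) s u"

lemma Jind_Dw: "Jind lam sc U \<rho> j s f
    = (\<lambda>k. sc (of_int ((k - s) j) + lam j) (f (k - s)) + Dw j s (f (k - s)))"
  by (simp add: Jind_def Dw_def expand_def)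

lemma Dw_eq:
  assumes K: "supported K" and u: "u \<in> U"
  shows "Dw j s u = expand (mbox K) (\<rho> j) s u"
  unfolding Dw_def
proof (rule expand_superset)
  show "Wp_supp U \<rho> j \<subseteq> mbox K" using K by (simp add: supported_def)
qed (use u in \<open>auto simp: Wp_supp_def dest: mbox_nonzero\<close>)

lemma Dw_mem [simp]: "u \<in> U \<Longrightarrow> Dw j s u \<in> U"
  unfolding Dw_def by (rule expand_mem) (simp add: Wp_supp_def)

lemma Dw_lin: "clin_on sc U sc (Dw j s)"
  unfolding clin_on_def
proof (intro conjI allI ballI)
  have nz: "\<alpha> \<noteq> 0" if "\<alpha> \<in> Wp_supp U \<rho> j" for \<alpha> using that by (simp add: Wp_supp_def)
  show "Dw j s (x + y) = Dw j s x + Dw j s y" if "x \<in> U" "y \<in> U" for x y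
    unfolding Dw_def expand_def sum.distrib[symmetric]
    using that nz by (intro sum.cong) (simp_all add: clin_on_add[OF rho_lin] scale_add)
  show "Dw j s (sc c x) = sc c (Dw j s x)" if x: "x \<in> U" for c x
  proof -
    have "sc c (Dw j s x) = (\<Sum>\<alpha>\<in>Wp_supp U \<rho> j. sc c (sc (mono s \<alpha> / mfact \<alpha>) (\<rho> j \<alpha> x)))"
      unfolding Dw_def expand_def using x nz by (intro scale_sum) simp
    also have "\<dots> = Dw j s (sc c x)"
      unfolding Dw_def expand_def using x nz
      by (intro sum.cong) (simp_all add: clin_on_scale[OF rho_lin] mult.commute)
    finally show ?thesis ..
  qed
qed

lemma Dw_zero_index [simp]: "u \<in> U \<Longrightarrow> Dw j 0 u = 0"
  unfolding Dw_def by (rule expand_zero) (auto simp: Wp_supp_def)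

lemma Dw_zero [simp]: "Dw j s 0 = 0"
  by (rule clin_on_zero[OF Dw_lin])

lemma Dw_comm:
  assumes u: "u \<in> U"
  shows "Dw j s (Dw k m u) - Dw k m (Dw j s u)
      = sc (of_int (m j)) (Dw k (s + m) u - Dw k m u) - sc (of_int (s k)) (Dw j (s + m) u - Dw j s u)"
proof -
  obtain K where K: "supported K"
    using finite_support[OF fd] by blast
  have mem: "expand (mbox K) (\<rho> j) s u \<in> U" if "u \<in> U" for j s u
    by (rule expand_mem) (use that in \<open>auto dest: mbox_nonzero\<close>)
  have "Dw j s (Dw k m u) - Dw k m (Dw j s u)
      - (sc (of_int (m j)) (Dw k (s + m) u - Dw k m u) - sc (of_int (s k)) (Dw j (s + m) u - Dw j s u))
    = (\<Sum>\<alpha>\<in>mbox (Suc K). \<Sum>\<beta>\<in>mbox (Suc K). sc (mono s \<alpha> / mfact \<alpha> * (mono m \<beta> / mfact \<beta>))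
        (\<rho> j \<alpha> (\<rho> k \<beta> u) - \<rho> k \<beta> (\<rho> j \<alpha> u)
         - (sc (of_nat (\<beta> j)) (\<rho> k (\<alpha> + \<beta> - eps j) u) - sc (of_nat (\<alpha> k)) (\<rho> j (\<alpha> + \<beta> - eps k) u))))"
    unfolding Dw_eq[OF K u] Dw_eq[OF K mem[OF u]]
    by (rule comm_expansion) (auto intro: rho_lin supportedD[OF K] u)
  also have "\<dots> = 0"
  proof (intro sum.neutral ballI)
    fix \<alpha> \<beta> :: "'n \<Rightarrow> nat" assume "\<alpha> \<in> mbox (Suc K)" "\<beta> \<in> mbox (Suc K)"
    then have "\<alpha> \<noteq> 0" "\<beta> \<noteq> 0" by (auto simp: mbox_def)
    from rho_comm[OF this u]
    show "sc (mono s \<alpha> / mfact \<alpha> * (mono m \<beta> / mfact \<beta>))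
        (\<rho> j \<alpha> (\<rho> k \<beta> u) - \<rho> k \<beta> (\<rho> j \<alpha> u)
         - (sc (of_nat (\<beta> j)) (\<rho> k (\<alpha> + \<beta> - eps j) u) - sc (of_nat (\<alpha> k)) (\<rho> j (\<alpha> + \<beta> - eps k) u))) = 0"
      by simp
  qed
  finally show ?thesis by simp
qed

text \<open>Up to factorials, \<open>\<rho> j \<alpha> u\<close> is a coefficient of the polynomial
  s \<mapsto> \<open>Dw j s u\<close> with values in A. Hence a subspace stable under all
  \<open>Dw\<close> is stable under \<rho>.\<close>

lemma rho_mem_of_Dw_mem:
  assumes A: "A \<subseteq> U" "cvs sc A" and u: "u \<in> U" and D: "\<And>s. Dw j s u \<in> A" and a: "\<alpha> \<noteq> 0"
  shows "\<rho> j \<alpha> u \<in> A"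
proof -
  obtain K where K: "supported K"
    using finite_support[OF fd] by blast
  interpret A: cvec sc A by unfold_locales fact
  show ?thesis
  proof (cases "\<alpha> \<in> mbox K")
    case False
    then show ?thesis using supportedD[OF K a] u by simp
  next
    case True
    have "sc (1 / mfact \<alpha>) (\<rho> j \<alpha> u) \<in> A"
    proof (rule poly_coeff_mem[OF A finite_mbox _ _ True, of "\<lambda>\<alpha>. sc (1 / mfact \<alpha>) (\<rho> j \<alpha> u)"])
      fix s :: "'n \<Rightarrow> int"
      have "Dw j s u = (\<Sum>\<alpha>\<in>mbox K. sc (mono s \<alpha> / mfact \<alpha>) (\<rho> j \<alpha> u))"
        using Dw_eq[OF K u] by (simp only: expand_def)
      also have "\<dots> = (\<Sum>\<alpha>\<in>mbox K. sc (mono s \<alpha>) (sc (1 / mfact \<alpha>) (\<rho> j \<alpha> u)))"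
        by (intro sum.cong) (use u in \<open>auto dest: mbox_nonzero\<close>)
      finally have "(\<Sum>\<alpha>\<in>mbox K. sc (mono s \<alpha>) (sc (1 / mfact \<alpha>) (\<rho> j \<alpha> u))) = Dw j s u" ..
      then show "(\<Sum>\<alpha>\<in>mbox K. sc (mono s \<alpha>) (sc (1 / mfact \<alpha>) (\<rho> j \<alpha> u))) \<in> A" using D by simp
    qed (use u in \<open>auto dest: mbox_nonzero\<close>)
    then show ?thesis by (rule scale_memD[OF rho_mem[OF a u] A(2)]) simp
  qed
qed

abbreviation Jd :: "('n \<Rightarrow> complex) \<Rightarrow> 'n \<Rightarrow> ('n \<Rightarrow> int) \<Rightarrow> (('n \<Rightarrow> int) \<Rightarrow> 'u) \<Rightarrow> ('n \<Rightarrow> int) \<Rightarrow> 'u" where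
  "Jd lam \<equiv> Jind lam sc U \<rho>"

lemma Jd_FU [simp]:
  assumes f: "f \<in> FU U" shows "Jd lam j s f \<in> FU U"
proof -
  have "{k. Jd lam j s f k \<noteq> 0} \<subseteq> {k. f (k - s) \<noteq> 0}"
    by (auto simp: Jind_Dw)
  then have "finite {k. Jd lam j s f k \<noteq> 0}"
    by (rule finite_subset) (rule finite_shift_support[OF FU_D(2)[OF f]])
  then show ?thesis using FU_D(1)[OF f] by (simp add: FU_def Jind_Dw)
qed

lemma Jd_lin: "clin_on (scF sc) (FU U) (scF sc) (Jd lam j s)"
  unfolding clin_on_def
  by (simp add: Jind_Dw fun_eq_iff scF_def FU_D clin_on_add[OF Dw_lin] clin_on_scale[OF Dw_lin]
      scale_add mult.commute)

lemma shiftE_lin: "clin_on (scF sc) (FU U) (scF sc) (shiftE m)"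
  unfolding clin_on_def by (auto simp: fun_eq_iff scF_def shiftE_def)

lemma Jd_sgl: "u \<in> U \<Longrightarrow> Jd lam j s (sgl m u) = sgl (m + s) (sc (of_int (m j) + lam j) u + Dw j s u)"
proof
  fix p
  assume u: "u \<in> U"
  show "Jd lam j s (sgl m u) p = sgl (m + s) (sc (of_int (m j) + lam j) u + Dw j s u) p"
  proof (cases "p = m + s")
    case True
    then show ?thesis by (simp add: Jind_Dw sgl_def)
  next
    case False
    then have "p - s \<noteq> m" by (simp add: diff_eq_eq)
    then show ?thesis using False by (simp add: Jind_Dw sgl_def)
  qed
qed

lemma Jd_0_sgl: "u \<in> U \<Longrightarrow> Jd lam j 0 (sgl m u) = scF sc (of_int (m j) + lam j) (sgl m u)"
  by (simp add: Jd_sgl scF_sgl)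

text \<open>The letters stand for p = \<open>Dw j s x\<close>, q = \<open>Dw k m x\<close>, r =
  \<open>Dw k (s + m) x\<close>, t = \<open>Dw j (s + m) x\<close>, with pq and qp the two
  compositions; a and b are the weight scalars in directions j and k. The shifts mj and sk of the
  weights cancel the subtracted q and p in \<open>eq\<close>.\<close>

lemma first_order_bracket:
  assumes V: "x \<in> U" "p \<in> U" "q \<in> U" "qp \<in> U" "r \<in> U" "t \<in> U"
    and eq: "pq - qp = sc mj (r - q) - sc sk (t - p)"
  shows "(sc (a + mj) (sc b x + q) + (sc b p + pq)) - (sc (b + sk) (sc a x + p) + (sc a q + qp))
    = sc mj (sc b x + r) - sc sk (sc a x + t)"
proof -
  have "pq = qp + (sc mj (r - q) - sc sk (t - p))" using eq by (simp add: algebra_simps)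
  then show ?thesis
    using V by (simp add: scale_add scale_diff scale_left_add ring_distribs mult.commute)
qed

lemma Jd_bracket:
  assumes f: "f \<in> FU U"
  shows "Jd lam j s (Jd lam k m f) - Jd lam k m (Jd lam j s f)
    = scF sc (of_int (m j)) (Jd lam k (s + m) f) - scF sc (of_int (s k)) (Jd lam j (s + m) f)"
proof
  fix p
  \<comment> \<open>Both compositions at position p read f only at this degree, so the claim reduces
    to an identity in the single vector \<open>x\<close>.\<close>
  define q where "q = p - (s + m)"
  define x where "x = f q"
  define a b where "a = of_int (q j) + lam j" and "b = of_int (q k) + lam k"
  have x: "x \<in> U" using FU_D(1)[OF f] by (simp add: x_def)
  have q: "p - s - m = q" "p - m - s = q"
    by (simp_all add: q_def diff_diff_eq add.commute)
  have coeff: "complex_of_int ((p - s) j) + lam j = a + of_int (m j)"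
    "complex_of_int ((p - m) k) + lam k = b + of_int (s k)"
    by (simp_all add: q_def a_def b_def)
  have "Jd lam j s (Jd lam k m f) p = sc (a + of_int (m j)) (sc b x + Dw k m x) + Dw j s (sc b x + Dw k m x)"
    by (simp only: Jind_Dw q coeff x_def[symmetric] b_def[symmetric])
  also have "Dw j s (sc b x + Dw k m x) = sc b (Dw j s x) + Dw j s (Dw k m x)"
    using x by (simp add: clin_on_add[OF Dw_lin] clin_on_scale[OF Dw_lin])
  finally have e1: "Jd lam j s (Jd lam k m f) p
    = sc (a + of_int (m j)) (sc b x + Dw k m x) + (sc b (Dw j s x) + Dw j s (Dw k m x))" .
  have "Jd lam k m (Jd lam j s f) p = sc (b + of_int (s k)) (sc a x + Dw j s x) + Dw k m (sc a x + Dw j s x)"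
    by (simp only: Jind_Dw q coeff x_def[symmetric] a_def[symmetric])
  also have "Dw k m (sc a x + Dw j s x) = sc a (Dw k m x) + Dw k m (Dw j s x)"
    using x by (simp add: clin_on_add[OF Dw_lin] clin_on_scale[OF Dw_lin])
  finally have e2: "Jd lam k m (Jd lam j s f) p
    = sc (b + of_int (s k)) (sc a x + Dw j s x) + (sc a (Dw k m x) + Dw k m (Dw j s x))" .
  have e3: "Jd lam k (s + m) f p = sc b x + Dw k (s + m) x" "Jd lam j (s + m) f p = sc a x + Dw j (s + m) x"
    by (simp_all only: Jind_Dw q_def[symmetric] x_def[symmetric] a_def[symmetric] b_def[symmetric])
  have "Jd lam j s (Jd lam k m f) p - Jd lam k m (Jd lam j s f) p
    = scF sc (of_int (m j)) (Jd lam k (s + m) f) p - scF sc (of_int (s k)) (Jd lam j (s + m) f) p"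
    unfolding scF_def e1 e2 e3
    using x by (intro first_order_bracket Dw_comm) simp_all
  then show "(Jd lam j s (Jd lam k m f) - Jd lam k m (Jd lam j s f)) p
    = (scF sc (of_int (m j)) (Jd lam k (s + m) f) - scF sc (of_int (s k)) (Jd lam j (s + m) f)) p"
    by (simp only: minus_apply)
qed

theorem Jd_is_Jmod: "is_Jmod (scF sc) (FU U) (Jd lam) shiftE"
proof -
  interpret F: cvec "scF sc" "FU U :: (('n \<Rightarrow> int) \<Rightarrow> 'u) set" by (rule cvec_FU)
  have "FU U \<subseteq> cspan (scF sc) {f\<in>FU U. \<exists>c. Jd lam j 0 f = scF sc c f}" for j
  proof
    fix f :: "('n \<Rightarrow> int) \<Rightarrow> 'u" assume f: "f \<in> FU U"
    let ?S = "{f\<in>FU U. \<exists>c. Jd lam j 0 f = scF sc c f}"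
    have "cvs (scF sc) (cspan (scF sc) ?S)" by (rule F.cspan_cvs) auto
    then show "f \<in> cspan (scF sc) ?S"
    proof (rule FU_sumI[OF _ f])
      fix m
      have u: "f m \<in> U" using FU_D(1)[OF f] .
      have "sgl m (f m) \<in> ?S" using Jd_0_sgl[OF u, of lam j m] u by auto
      then show "sgl m (f m) \<in> cspan (scF sc) ?S" by (rule F.cspan_base) (use u in simp)
    qed
  qed
  moreover have "Jd lam j s (shiftE m f) = scF sc (of_int (m j)) (shiftE (m + s) f) + shiftE m (Jd lam j s f)"
    if f: "f \<in> FU U" for j s m f
  proof
    fix p
    define q where "q = p - (m + s)"
    have q: "p - s - m = q" "p - m - s = q" by (simp_all add: q_def diff_diff_eq add.commute)
    have coeff: "complex_of_int ((p - s) j) + lam j = of_int (m j) + (of_int (q j) + lam j)"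
      by (simp add: q_def)
    have "Jd lam j s (shiftE m f) p = scF sc (of_int (m j)) (shiftE (m + s) f) p + shiftE m (Jd lam j s f) p"
      by (simp only: Jind_Dw scF_def shiftE_def q coeff q_def[symmetric])
        (simp only: scale_left_add[OF FU_D(1)[OF f]] add.assoc)
    then show "Jd lam j s (shiftE m f) p
      = (scF sc (of_int (m j)) (shiftE (m + s) f) + shiftE m (Jd lam j s f)) p"
      by (simp only: plus_fun_apply)
  qed
  ultimately show ?thesis
    unfolding is_Jmod_def
    using F.cvs Jd_lin shiftE_lin Jd_bracket FU_free[OF fd]
    by (intro conjI allI ballI) simp_all
qed

subsection \<open>Submodules\<close>

lemma FU_submodule:
  assumes "ops_sub sc U Wp_idx (Wp_ops \<rho>) A"
  shows "ops_sub (scF sc) (FU U) UNIV (Jops (Jd lam) shiftE) (FU A)"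
proof -
  have A: "A \<subseteq> U" "cvs sc A" and inv: "\<And>j \<alpha> x. \<alpha> \<noteq> 0 \<Longrightarrow> x \<in> A \<Longrightarrow> \<rho> j \<alpha> x \<in> A"
    using assms by (auto simp: ops_sub_Wp)
  interpret A: cvec sc A by unfold_locales fact
  have "Dw j s x \<in> A" if "x \<in> A" for j s x
    unfolding Dw_def expand_def using that inv by (intro A.sum_mem A.scale_mem) (auto simp: Wp_supp_def)
  then have "Jd lam j s f k \<in> A" if "f \<in> FU A" for j s f k
    using A.FU_D(1)[OF that] by (simp add: Jind_Dw)
  moreover have sub: "f \<in> FU U" if "f \<in> FU A" for f :: "('n \<Rightarrow> int) \<Rightarrow> 'u"
    using A that by (auto simp: FU_def)
  ultimately have "Jd lam j s f \<in> FU A" if "f \<in> FU A" for j s f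
    using that FU_D(2)[OF Jd_FU[OF sub[OF that], of lam j s]] unfolding FU_def[of A] by simp
  then show ?thesis
    unfolding ops_sub_Jops using cvec.cvs[OF A.cvec_FU] A.shiftE_FU sub by blast
qed

text \<open>Distinct degrees m have distinct weights m + \<open>lam\<close>, so a submodule is
  graded; the invertible shifts identify all its graded pieces with the one in degree 0. Stability
  of that piece under \<rho> follows by subtracting the weight scalar and comparing coefficients in
  s.\<close>

lemma submodule_FU:
  fixes B :: "(('n \<Rightarrow> int) \<Rightarrow> 'u) set"
  assumes "ops_sub (scF sc) (FU U) UNIV (Jops (Jd lam) shiftE) B"
  obtains A where "ops_sub sc U Wp_idx (Wp_ops \<rho>) A" "B = FU A"
proof -
  interpret F: cvec "scF sc" "FU U :: (('n \<Rightarrow> int) \<Rightarrow> 'u) set" by (rule cvec_FU)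
  have B: "B \<subseteq> FU U" "cvs (scF sc) B" and Jd_B: "\<And>j s f. f \<in> B \<Longrightarrow> Jd lam j s f \<in> B"
    and shift_B: "\<And>m f. f \<in> B \<Longrightarrow> shiftE m f \<in> B"
    using assms by (auto simp: ops_sub_Jops)
  interpret B: cvec "scF sc" B by unfold_locales fact
  define A where "A = {u\<in>U. sgl 0 u \<in> B}"
  have A_sgl: "u \<in> A \<longleftrightarrow> u \<in> U \<and> sgl m u \<in> B" for u m
    using shift_B[of "sgl 0 u" m] shift_B[of "sgl m u" "- m"] by (auto simp: A_def)
  have comp: "sgl m (f m) \<in> B" if f: "f \<in> B" for f m
  proof (cases "f m = 0")
    case False
    have fU: "f \<in> FU U" using f B by blast
    show ?thesis
    proof (rule F.eigen_component_mem[where T = "\<lambda>j. Jd lam j 0" and F = "{m. f m \<noteq> 0}"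
          and x = "\<lambda>m. sgl m (f m)" and \<chi> = "\<lambda>j m. of_int (m j) + lam j"])
      show "(\<Sum>m | f m \<noteq> 0. sgl m (f m)) \<in> B" using f FU_decomp[OF FU_D(2)[OF fU]] by (rule subst[rotated])
      show "\<exists>j. complex_of_int (k j) + lam j \<noteq> complex_of_int (m j) + lam j" if "k \<noteq> m" for k
        using that by (auto simp: fun_eq_iff)
    qed (use B Jd_B Jd_lin Jd_0_sgl FU_D[OF fU] False in auto)
  qed simp
  have subA: "cvs sc A"
  proof (rule cvs_subset)
    show "A \<subseteq> U" by (auto simp: A_def)
    show "x + y \<in> A" if "x \<in> A" "y \<in> A" for x y using that by (simp add: A_def sgl_add)
    show "sc c x \<in> A" if "x \<in> A" for c x
      using that B.scale_mem[of "sgl 0 x" c] by (simp add: A_def scF_sgl)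
  qed (simp add: A_def)
  interpret A: cvec sc A by unfold_locales fact
  have "\<rho> j \<alpha> u \<in> A" if a: "\<alpha> \<noteq> 0" and u: "u \<in> A" for j \<alpha> u
  proof (rule rho_mem_of_Dw_mem[OF _ subA _ _ a])
    show "A \<subseteq> U" and uU: "u \<in> U" using u by (auto simp: A_def)
    fix s
    have "sgl s (sc (lam j) u + Dw j s u) \<in> B"
      using Jd_B[of "sgl 0 u" j s] u by (simp add: A_def Jd_sgl)
    then have "sc (lam j) u + Dw j s u \<in> A"
      using A_sgl[of "sc (lam j) u + Dw j s u" s] uU by simp
    then have "(sc (lam j) u + Dw j s u) - sc (lam j) u \<in> A" using u by (intro A.diff_mem) auto
    then show "Dw j s u \<in> A" by simp
  qed
  then have "ops_sub sc U Wp_idx (Wp_ops \<rho>) A"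
    using subA by (auto simp: ops_sub_Wp A_def)
  moreover have "B = FU A"
  proof
    show "B \<subseteq> FU A"
    proof
      fix f assume f: "f \<in> B"
      then have fU: "f \<in> FU U" using B by blast
      have "f m \<in> A" for m using A_sgl[of "f m" m] comp[OF f] FU_D(1)[OF fU] by blast
      then show "f \<in> FU A" using FU_D(2)[OF fU] by (simp add: FU_def)
    qed
    show "FU A \<subseteq> B"
    proof
      fix f :: "('n \<Rightarrow> int) \<Rightarrow> 'u" assume f: "f \<in> FU A"
      have fU: "f \<in> FU U" using f by (auto simp: FU_def A_def)
      have "sgl m (f m) \<in> B" for m using A_sgl[of "f m" m] A.FU_D(1)[OF f, of m] by blast
      then show "f \<in> B" by (rule FU_sumI[OF B(2) fU])
    qed
  qed
  ultimately show thesis using that by blast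
qed

end

lemma FU_zero: "FU {0 :: 'u::ab_group_add} = {0 :: ('n \<Rightarrow> int) \<Rightarrow> 'u}"
  by (auto simp: FU_def fun_eq_iff)

lemma FU_inj:
  assumes "0 \<in> A" "0 \<in> B" "FU A = (FU B :: (('n \<Rightarrow> int) \<Rightarrow> 'u::ab_group_add) set)" shows "A = B"
proof -
  have *: "u \<in> A \<longleftrightarrow> sgl (0 :: 'n \<Rightarrow> int) u \<in> FU A" if "0 \<in> A" for A :: "'u set" and u
    using that by (auto simp: FU_def sgl_def)
  show ?thesis using *[OF assms(1)] *[OF assms(2)] assms(3) by blast
qed

lemma FU_Int: "FU A \<inter> FU B = FU (A \<inter> B)"
  by (auto simp: FU_def)

lemma FU_plus:
  fixes A B :: "'u::ab_group_add set"
  assumes "0 \<in> A" "0 \<in> B"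
  shows "FU {a + b |a b. a \<in> A \<and> b \<in> B} = {f + g |f g. f \<in> (FU A :: (('n \<Rightarrow> int) \<Rightarrow> 'u) set) \<and> g \<in> FU B}"
proof (intro subset_antisym subsetI)
  fix h :: "('n \<Rightarrow> int) \<Rightarrow> 'u" assume h: "h \<in> FU {a + b |a b. a \<in> A \<and> b \<in> B}"
  then have "\<forall>k. \<exists>p. h k = fst p + snd p \<and> fst p \<in> A \<and> snd p \<in> B" by (fastforce simp: FU_def)
  then obtain p where p: "\<And>k. h k = fst (p k) + snd (p k)" "\<And>k. fst (p k) \<in> A" "\<And>k. snd (p k) \<in> B"
    by metis
  \<comment> \<open>The chosen summands of 0 may be nonzero; setting both parts to 0 where h
    vanishes keeps their supports finite.\<close>
  define f g where "f k = (if h k = 0 then 0 else fst (p k))" and "g k = (if h k = 0 then 0 else snd (p k))" for k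
  have fin: "finite {k. h k \<noteq> 0}" using h by (simp add: FU_def)
  have "finite {k. f k \<noteq> 0}" "finite {k. g k \<noteq> 0}"
    by (rule finite_subset[OF _ fin], auto simp: f_def g_def)+
  then have "f \<in> FU A" "g \<in> FU B" using p assms by (auto simp: FU_def f_def g_def)
  moreover have "h = f + g" using p(1) by (auto simp: fun_eq_iff f_def g_def)
  ultimately show "h \<in> {f + g |f g. f \<in> FU A \<and> g \<in> FU B}" by blast
next
  fix h :: "('n \<Rightarrow> int) \<Rightarrow> 'u" assume "h \<in> {f + g |f g. f \<in> FU A \<and> g \<in> FU B}"
  then obtain f g where h: "h = f + g" "f \<in> FU A" "g \<in> FU B" by blast
  have "finite {k. h k \<noteq> 0}"
    by (rule finite_subset[of _ "{k. f k \<noteq> 0} \<union> {k. g k \<noteq> 0}"]) (use h in \<open>auto simp: FU_def\<close>)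
  then show "h \<in> FU {a + b |a b. a \<in> A \<and> b \<in> B}" using h by (auto simp: FU_def)
qed

context wplus_module_fd
begin

lemma ops_sub_zero_mem: "ops_sub sc U I ops A \<Longrightarrow> 0 \<in> A"
  by (auto simp: ops_sub_def cvs_def)

text \<open>A \<mapsto> \<open>FU A\<close> is a bijection between submodules of U and of the tensor
  module which respects zero, intersections and sums, so decompositions correspond.\<close>

lemma indecomposable_iff:
  "ops_indecomposable (scF sc) (FU U) UNIV (Jops (Jd lam) shiftE)
    \<longleftrightarrow> ops_indecomposable sc U Wp_idx (Wp_ops \<rho>)"
proof -
  let ?ex = "\<lambda>A B. ops_sub sc U Wp_idx (Wp_ops \<rho>) A \<and> ops_sub sc U Wp_idx (Wp_ops \<rho>) B
      \<and> A \<noteq> {0} \<and> B \<noteq> {0} \<and> A \<inter> B = {0} \<and> U = {a + b |a b. a \<in> A \<and> b \<in> B}"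
  let ?exF = "\<lambda>A B. ops_sub (scF sc) (FU U) UNIV (Jops (Jd lam) shiftE) A
      \<and> ops_sub (scF sc) (FU U) UNIV (Jops (Jd lam) shiftE) B
      \<and> A \<noteq> {0} \<and> B \<noteq> {0} \<and> A \<inter> B = {0} \<and> FU U = {a + b |a b. a \<in> A \<and> b \<in> B}"
  have FU0: "FU A = ({0} :: (('n \<Rightarrow> int) \<Rightarrow> 'u) set) \<longleftrightarrow> A = {0}" if "0 \<in> A" for A :: "'u set"
    using FU_inj[OF that, of "{0}", where 'n = 'n] FU_zero[where 'n = 'n and 'u = 'u] by auto
  have FU1: "FU A = (FU U :: (('n \<Rightarrow> int) \<Rightarrow> 'u) set) \<longleftrightarrow> A = U" if "0 \<in> A" for A :: "'u set"
    using FU_inj[OF that zero_mem, where 'n = 'n] by auto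
  have iff: "?exF (FU A) (FU B) \<longleftrightarrow> ?ex A B"
    if AB: "ops_sub sc U Wp_idx (Wp_ops \<rho>) A" "ops_sub sc U Wp_idx (Wp_ops \<rho>) B" for A B
  proof -
    note z = AB[THEN ops_sub_zero_mem]
    have "0 \<in> {a + b |a b. a \<in> A \<and> b \<in> B}" using z by force
    from FU1[OF this] have "FU U = {a + b |a b. a \<in> (FU A :: (('n \<Rightarrow> int) \<Rightarrow> 'u) set) \<and> b \<in> FU B} \<longleftrightarrow> U = {a + b |a b. a \<in> A \<and> b \<in> B}"
      unfolding FU_plus[OF z] by (simp only: eq_commute)
    moreover have "0 \<in> A \<inter> B" using z by simp
    ultimately show ?thesis using FU_submodule AB z by (simp add: FU0 FU_Int)
  qed
  have "(\<exists>A B. ?exF A B) \<longleftrightarrow> (\<exists>A B. ?ex A B)"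
  proof
    assume "\<exists>A B. ?exF A B"
    then obtain A B where AB: "?exF A B" by (elim exE)
    obtain A' where A': "ops_sub sc U Wp_idx (Wp_ops \<rho>) A'" "A = FU A'" using AB submodule_FU by blast
    obtain B' where B': "ops_sub sc U Wp_idx (Wp_ops \<rho>) B'" "B = FU B'" using AB submodule_FU by blast
    have "?ex A' B'" by (rule iffD1[OF iff[OF A'(1) B'(1)] AB[unfolded A'(2) B'(2)]])
    then show "\<exists>A B. ?ex A B" by (intro exI)
  next
    assume "\<exists>A B. ?ex A B"
    then obtain A B where AB: "?ex A B" by (elim exE)
    have "?exF (FU A) (FU B)" by (rule iffD2[OF iff[OF conjunct1[OF AB] conjunct1[OF conjunct2[OF AB]]] AB])
    then show "\<exists>A B. ?exF A B" by (intro exI)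
  qed
  then show ?thesis unfolding ops_indecomposable_def using FU0[OF zero_mem] by simp
qed

lemma irreducible_iff:
  "ops_irreducible (scF sc) (FU U) UNIV (Jops (Jd lam) shiftE)
    \<longleftrightarrow> ops_irreducible sc U Wp_idx (Wp_ops \<rho>)"
proof -
  have FU0: "FU A = ({0} :: (('n \<Rightarrow> int) \<Rightarrow> 'u) set) \<longleftrightarrow> A = {0}" if "0 \<in> A" for A :: "'u set"
    using FU_inj[OF that, of "{0}", where 'n = 'n] FU_zero[where 'n = 'n and 'u = 'u] by auto
  have FU1: "FU A = (FU U :: (('n \<Rightarrow> int) \<Rightarrow> 'u) set) \<longleftrightarrow> A = U" if "0 \<in> A" for A :: "'u set"
    using FU_inj[OF that zero_mem, where 'n = 'n] by auto
  have "(\<forall>W. ops_sub (scF sc) (FU U) UNIV (Jops (Jd lam) shiftE) W \<longrightarrow> W = {0} \<or> W = FU U)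
    \<longleftrightarrow> (\<forall>W. ops_sub sc U Wp_idx (Wp_ops \<rho>) W \<longrightarrow> W = {0} \<or> W = U)"
  proof (intro iffI allI impI)
    fix W assume *: "\<forall>W. ops_sub (scF sc) (FU U) UNIV (Jops (Jd lam) shiftE) W \<longrightarrow> W = {0} \<or> W = FU U"
      and W: "ops_sub sc U Wp_idx (Wp_ops \<rho>) W"
    show "W = {0} \<or> W = U"
      using *[rule_format, OF FU_submodule[OF W]] FU0 FU1 ops_sub_zero_mem[OF W] by simp
  next
    fix W assume *: "\<forall>W. ops_sub sc U Wp_idx (Wp_ops \<rho>) W \<longrightarrow> W = {0} \<or> W = U"
      and W: "ops_sub (scF sc) (FU U) UNIV (Jops (Jd lam) shiftE) W"
    obtain A where A: "ops_sub sc U Wp_idx (Wp_ops \<rho>) A" "W = FU A" using submodule_FU[OF W] by blast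
    show "W = {0} \<or> W = FU U" using * A FU0 ops_sub_zero_mem[OF A(1)] by auto
  qed
  then show ?thesis unfolding ops_irreducible_def using FU0[OF zero_mem] by simp
qed

end

section \<open>Joint diagonalization and splitting along cosets of the weight lattice\<close>

section \<open>Weight decomposition of modules in category \<open>J\<close>\<close>

context cvec
begin

lemma cspan_mono: "S \<subseteq> T \<Longrightarrow> cspan sc S \<subseteq> cspan sc T"
  unfolding cspan_def by blast

lemma group_cspan:
  fixes Q :: "'t \<Rightarrow> 'v set"
  assumes Q: "\<And>\<chi>. Q \<chi> \<subseteq> V" "\<And>\<chi>. cvs sc (Q \<chi>)" and x: "x \<in> cspan sc (\<Union>\<chi>\<in>X. Q \<chi>)"
  obtains F y where "finite F" "F \<subseteq> X" "\<And>\<chi>. y \<chi> \<in> Q \<chi>" "x = (\<Sum>\<chi>\<in>F. y \<chi>)"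
proof -
  obtain G c where G: "finite G" "G \<subseteq> (\<Union>\<chi>\<in>X. Q \<chi>)" and x_eq: "x = (\<Sum>v\<in>G. sc (c v) v)"
    using x unfolding cspan_def by blast
  have "\<forall>v\<in>G. \<exists>\<chi>. \<chi> \<in> X \<and> v \<in> Q \<chi>" using G by blast
  from bchoice[OF this] obtain ch where ch: "\<And>v. v \<in> G \<Longrightarrow> ch v \<in> X" "\<And>v. v \<in> G \<Longrightarrow> v \<in> Q (ch v)"
    by blast
  define y where "y \<chi> = (\<Sum>v\<in>{v\<in>G. ch v = \<chi>}. sc (c v) v)" for \<chi>
  have "y \<chi> \<in> Q \<chi>" for \<chi>
  proof -
    interpret Q: cvec sc "Q \<chi>" by unfold_locales (rule Q)
    show ?thesis unfolding y_def using ch by (intro Q.sum_mem Q.scale_mem) auto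
  qed
  moreover have "x = (\<Sum>\<chi>\<in>ch ` G. y \<chi>)"
    unfolding x_eq y_def by (rule sum.image_gen[OF G(1)])
  ultimately show thesis using that[of "ch ` G" y] G ch by blast
qed

end

definition shift_weight :: "('n \<Rightarrow> complex) \<Rightarrow> ('n \<Rightarrow> int) \<Rightarrow> 'n \<Rightarrow> complex" where
  "shift_weight \<mu> s = (\<lambda>k. \<mu> k + of_int (s k))"

lemma shift_weight_inverse [simp]:
  "shift_weight (shift_weight \<mu> s) (- s) = \<mu>" "shift_weight (shift_weight \<mu> (- s)) s = \<mu>"
  by (simp_all add: shift_weight_def)

lemma shift_weight_shift: "shift_weight (shift_weight \<mu> s) m = shift_weight \<mu> (s + m)"
  by (simp add: shift_weight_def add.assoc)

lemma shift_weight_0 [simp]: "shift_weight \<mu> 0 = \<mu>"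
  by (simp add: shift_weight_def)

locale jmod =
  fixes sc :: "complex \<Rightarrow> 'v::ab_group_add \<Rightarrow> 'v" and V :: "'v set"
    and d :: "'n::finite \<Rightarrow> ('n \<Rightarrow> int) \<Rightarrow> 'v \<Rightarrow> 'v" and e :: "('n \<Rightarrow> int) \<Rightarrow> 'v \<Rightarrow> 'v"
  assumes jmod: "is_Jmod sc V d e"

sublocale jmod \<subseteq> cvec sc V
  using jmod by unfold_locales (simp add: is_Jmod_def)

context jmod
begin

lemma d_mem [simp]: "x \<in> V \<Longrightarrow> d j s x \<in> V"
  and d_lin: "clin_on sc V sc (d j s)"
  and e_mem [simp]: "x \<in> V \<Longrightarrow> e m x \<in> V"
  and e_lin: "clin_on sc V sc (e m)"
  and e_0 [simp]: "x \<in> V \<Longrightarrow> e 0 x = x"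
  and e_e [simp]: "x \<in> V \<Longrightarrow> e m (e m' x) = e (m + m') x"
  and d_d: "x \<in> V \<Longrightarrow> d j s (d k m x) - d k m (d j s x)
          = sc (of_int (m j)) (d k (s + m) x) - sc (of_int (s k)) (d j (s + m) x)"
  and d_e: "x \<in> V \<Longrightarrow> d j s (e m x) = sc (of_int (m j)) (e (m + s) x) + e m (d j s x)"
  and diag: "V \<subseteq> cspan sc {x\<in>V. \<exists>c. d j 0 x = sc c x}"
  using jmod unfolding is_Jmod_def by simp_all

abbreviation W :: "('n \<Rightarrow> complex) \<Rightarrow> 'v set" where
  "W \<mu> \<equiv> weight_space sc V d \<mu>"

lemma W_iff: "x \<in> W \<mu> \<longleftrightarrow> x \<in> V \<and> (\<forall>j. d j 0 x = sc (\<mu> j) x)"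
  by (auto simp: weight_space_def)

lemma W_sub: "W \<mu> \<subseteq> V"
  by (auto simp: W_iff)

lemma W_cvs: "cvs sc (W \<mu>)"
  by (rule cvs_subset[OF W_sub])
    (auto simp: W_iff clin_on_zero[OF d_lin] clin_on_add[OF d_lin] clin_on_scale[OF d_lin] scale_add mult.commute)

lemma d_W: "x \<in> W \<mu> \<Longrightarrow> d j s x \<in> W (shift_weight \<mu> s)"
proof -
  assume x: "x \<in> W \<mu>"
  have "d k 0 (d j s x) = sc (shift_weight \<mu> s k) (d j s x)" for k
  proof -
    have xV: "x \<in> V" and k: "d k 0 x = sc (\<mu> k) x" using x by (auto simp: W_iff)
    have "d k 0 (d j s x) - d j s (d k 0 x) = sc (of_int (s k)) (d j s x)"
      using d_d[OF xV, of k 0 j s] xV by simp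
    then have "d k 0 (d j s x) = sc (of_int (s k)) (d j s x) + sc (\<mu> k) (d j s x)"
      unfolding k clin_on_scale[OF d_lin xV] by (simp add: diff_eq_eq)
    then show ?thesis using xV by (simp add: shift_weight_def scale_left_add add.commute)
  qed
  then show ?thesis using x by (auto simp: W_iff)
qed

lemma e_W: "x \<in> W \<mu> \<Longrightarrow> e m x \<in> W (shift_weight \<mu> m)"
  by (auto simp: W_iff d_e clin_on_scale[OF e_lin] shift_weight_def scale_left_add add.commute)

text \<open>Induction on the set of directions. A joint eigenvector for S splits into eigenvectors
  of \<open>d j 0\<close>; its joint eigenspace is stable under \<open>d j 0\<close>, because the
  operators commute, and therefore contains these components.\<close>

lemma simultaneous_diag:
  "finite S \<Longrightarrow> V \<subseteq> cspan sc {v\<in>V. \<forall>k\<in>S. \<exists>c. d k 0 v = sc c v}"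
proof (induction S rule: finite_induct)
  case empty
  show ?case using cspan_base by auto
next
  case (insert j S)
  let ?E = "\<lambda>S. {v\<in>V. \<forall>k\<in>S. \<exists>c. d k 0 v = sc c v}"
  have span: "cvs sc (cspan sc (?E (insert j S)))" by (rule cspan_cvs) auto
  interpret C: cvec sc "cspan sc (?E (insert j S))" by unfold_locales fact
  have "?E S \<subseteq> cspan sc (?E (insert j S))"
  proof
    fix v assume v: "v \<in> ?E S"
    then have "\<forall>k\<in>S. \<exists>c. d k 0 v = sc c v" by blast
    from bchoice[OF this] obtain \<mu> where \<mu>: "\<And>k. k \<in> S \<Longrightarrow> d k 0 v = sc (\<mu> k) v" by blast
    define A where "A = {y\<in>V. \<forall>k\<in>S. d k 0 y = sc (\<mu> k) y}"
    have A: "A \<subseteq> V" "cvs sc A"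
    proof -
      show "A \<subseteq> V" by (auto simp: A_def)
      then show "cvs sc A"
        by (rule cvs_subset) (auto simp: A_def clin_on_zero[OF d_lin] clin_on_add[OF d_lin]
            clin_on_scale[OF d_lin] scale_add mult.commute)
    qed
    define Q where "Q c = {x\<in>V. d j 0 x = sc c x}" for c
    have Q: "Q c \<subseteq> V" "cvs sc (Q c)" for c
    proof -
      show "Q c \<subseteq> V" by (auto simp: Q_def)
      then show "cvs sc (Q c)"
        by (rule cvs_subset) (auto simp: Q_def clin_on_zero[OF d_lin] clin_on_add[OF d_lin]
            clin_on_scale[OF d_lin] scale_add mult.commute)
    qed
    have "{x\<in>V. \<exists>c. d j 0 x = sc c x} = (\<Union>c\<in>UNIV. Q c)" by (auto simp: Q_def)
    then have "v \<in> cspan sc (\<Union>c\<in>UNIV. Q c)" using diag[of j] v by auto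
    then obtain F y where F: "finite F" "\<And>c. y c \<in> Q c" and v_eq: "v = (\<Sum>c\<in>F. y c)"
      by (rule group_cspan[OF Q]) auto
    have comm: "d j 0 (d k 0 x) = d k 0 (d j 0 x)" if "x \<in> V" for k x
      using d_d[OF that, of j 0 k 0] that by simp
    have "y c \<in> A" if c: "c \<in> F" for c
    proof (rule eigen_component_mem[OF A, where T = "\<lambda>_::unit. d j 0" and F = F and x = y and \<chi> = "\<lambda>_ c. c"])
      show "d j 0 y \<in> A" if "y \<in> A" for y
        using that by (auto simp: A_def comm[symmetric] clin_on_scale[OF d_lin])
      show "(\<Sum>c\<in>F. y c) \<in> A" using v \<mu> v_eq by (simp add: A_def)
    qed (use F c d_lin in \<open>auto simp: Q_def\<close>)
    then have "y c \<in> ?E (insert j S)" if "c \<in> F" for c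
      using that F(2)[of c] by (auto simp: A_def Q_def)
    then have "y c \<in> cspan sc (?E (insert j S))" if "c \<in> F" for c
      using that by (intro cspan_base) auto
    then show "v \<in> cspan sc (?E (insert j S))" unfolding v_eq by (rule C.sum_mem)
  qed
  then have "cspan sc (?E S) \<subseteq> cspan sc (?E (insert j S))" by (rule cspan_least[OF _ span])
  then show ?case using insert.IH by blast
qed

lemma weights_span: "V \<subseteq> cspan sc (\<Union>\<mu>. W \<mu>)"
proof -
  have "{v\<in>V. \<forall>k\<in>UNIV. \<exists>c. d k 0 v = sc c v} \<subseteq> (\<Union>\<mu>. W \<mu>)"
  proof
    fix v assume v: "v \<in> {v\<in>V. \<forall>k\<in>UNIV. \<exists>c. d k 0 v = sc c v}"
    then have "\<forall>k. \<exists>c. d k 0 v = sc c v" by blast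
    from choice[OF this] obtain \<mu> where "\<forall>k. d k 0 v = sc (\<mu> k) v" ..
    then show "v \<in> (\<Union>\<mu>. W \<mu>)" using v by (auto simp: W_iff)
  qed
  then have "cspan sc {v\<in>V. \<forall>k\<in>UNIV. \<exists>c. d k 0 v = sc c v} \<subseteq> cspan sc (\<Union>\<mu>. W \<mu>)"
    by (rule cspan_mono)
  then show ?thesis using simultaneous_diag[of UNIV] by auto
qed

lemma weight_components_mem:
  assumes A: "A \<subseteq> V" "cvs sc A" "\<And>j x. x \<in> A \<Longrightarrow> d j 0 x \<in> A"
    and F: "finite F" "\<And>i. i \<in> F \<Longrightarrow> y i \<in> W (\<mu> i)" "inj_on \<mu> F"
    and sum: "(\<Sum>i\<in>F. y i) \<in> A" and i: "i \<in> F"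
  shows "y i \<in> A"
proof (rule eigen_component_mem[OF A(1,2), where T = "\<lambda>j. d j 0" and F = F and x = y and \<chi> = "\<lambda>j i. \<mu> i j"])
  show "\<exists>j. \<mu> k j \<noteq> \<mu> i j" if "k \<in> F" "k \<noteq> i" for k
    using that i F(3) by (auto simp: inj_on_def fun_eq_iff)
qed (use A F i sum d_lin in \<open>auto simp: W_iff\<close>)

text \<open>Both \<open>d j s\<close> and \<open>e s\<close> translate weights by s, so a union of
  lattice cosets of weights is preserved.\<close>

lemma weight_sum_submodule:
  assumes P: "\<And>\<mu> s. \<mu> \<in> P \<Longrightarrow> shift_weight \<mu> s \<in> P"
  shows "ops_sub sc V UNIV (Jops d e) (cspan sc (\<Union>\<mu>\<in>P. W \<mu>))"
proof -
  let ?A = "cspan sc (\<Union>\<mu>\<in>P. W \<mu>)"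
  have sub: "(\<Union>\<mu>\<in>P. W \<mu>) \<subseteq> V" using W_sub by blast
  interpret A: cvec sc ?A by unfold_locales (rule cspan_cvs[OF sub])
  have AV: "?A \<subseteq> V" by (rule cspan_cvs[OF sub])
  have inv: "\<forall>x\<in>?A. T x \<in> ?A" if T: "clin_on sc V sc T"
    and gen: "\<And>\<mu> x. \<mu> \<in> P \<Longrightarrow> x \<in> W \<mu> \<Longrightarrow> T x \<in> (\<Union>\<mu>\<in>P. W \<mu>)" for T
  proof -
    have "cvs sc {x\<in>V. T x \<in> ?A}"
      by (rule cvs_subset) (auto simp: clin_on_zero[OF T] clin_on_add[OF T] clin_on_scale[OF T])
    moreover have "(\<Union>\<mu>\<in>P. W \<mu>) \<subseteq> {x\<in>V. T x \<in> ?A}"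
      using gen sub cspan_base by blast
    ultimately have "?A \<subseteq> {x\<in>V. T x \<in> ?A}" by (intro cspan_least)
    then show ?thesis by blast
  qed
  show ?thesis
    unfolding ops_sub_Jops
  proof (intro conjI allI AV A.cvs)
    show "\<forall>x\<in>?A. d j s x \<in> ?A" for j s
    proof (rule inv[OF d_lin])
      fix \<mu> x assume "\<mu> \<in> P" "x \<in> W \<mu>"
      from P[OF this(1), of s] d_W[OF this(2), of j s] show "d j s x \<in> (\<Union>\<mu>\<in>P. W \<mu>)" by blast
    qed
    show "\<forall>x\<in>?A. e m x \<in> ?A" for m
    proof (rule inv[OF e_lin])
      fix \<mu> x assume "\<mu> \<in> P" "x \<in> W \<mu>"
      from P[OF this(1), of m] e_W[OF this(2), of m] show "e m x \<in> (\<Union>\<mu>\<in>P. W \<mu>)" by blast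
    qed
  qed
qed

lemma weight_sum_disjoint:
  assumes "P \<inter> P' = {}"
  shows "cspan sc (\<Union>\<mu>\<in>P. W \<mu>) \<inter> cspan sc (\<Union>\<mu>\<in>P'. W \<mu>) = {0}"
proof (intro subset_antisym subsetI)
  fix x assume x: "x \<in> cspan sc (\<Union>\<mu>\<in>P. W \<mu>) \<inter> cspan sc (\<Union>\<mu>\<in>P'. W \<mu>)"
  obtain F y where F: "finite F" "F \<subseteq> P" "\<And>\<mu>. y \<mu> \<in> W \<mu>" and x_eq: "x = (\<Sum>\<mu>\<in>F. y \<mu>)"
    by (rule group_cspan[OF W_sub W_cvs IntD1[OF x]]) blast
  obtain G z where G: "finite G" "G \<subseteq> P'" "\<And>\<mu>. z \<mu> \<in> W \<mu>" and x_eq': "x = (\<Sum>\<mu>\<in>G. z \<mu>)"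
    by (rule group_cspan[OF W_sub W_cvs IntD2[OF x]]) blast
  \<comment> \<open>The difference of the two expressions of x is a vanishing sum of vectors with
    distinct weights, so every summand is zero.\<close>
  let ?w = "\<lambda>\<mu>. if \<mu> \<in> F then y \<mu> else - z \<mu>"
  have FG: "F \<inter> G = {}" using F G assms by blast
  have "(\<Sum>\<mu>\<in>F \<union> G. ?w \<mu>) = (\<Sum>\<mu>\<in>F. ?w \<mu>) + (\<Sum>\<mu>\<in>G. ?w \<mu>)"
    using F G FG by (intro sum.union_disjoint)
  also have "(\<Sum>\<mu>\<in>G. ?w \<mu>) = - (\<Sum>\<mu>\<in>G. z \<mu>)"
    unfolding sum_negf[symmetric] using FG by (intro sum.cong) auto
  finally have sum0: "(\<Sum>\<mu>\<in>F \<union> G. ?w \<mu>) \<in> {0}" using x_eq x_eq' by simp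
  have w: "?w \<mu> \<in> W \<mu>" for \<mu>
  proof -
    interpret W: cvec sc "W \<mu>" by unfold_locales (rule W_cvs)
    show ?thesis using F(3) G(3) by simp
  qed
  have "y \<mu> = 0" if "\<mu> \<in> F" for \<mu>
  proof -
    have "?w \<mu> \<in> {0}"
      by (rule weight_components_mem[where F = "F \<union> G" and \<mu> = "\<lambda>\<mu>. \<mu>"])
        (use w sum0 F G that cvs_zero clin_on_zero[OF d_lin] in auto)
    then show ?thesis using that by simp
  qed
  then show "x \<in> {0}" unfolding x_eq by simp
next
  fix x :: 'v assume "x \<in> {0}"
  then show "x \<in> cspan sc (\<Union>\<mu>\<in>P. W \<mu>) \<inter> cspan sc (\<Union>\<mu>\<in>P'. W \<mu>)"
    using cspanI[of "{}"] by fastforce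
qed

lemma weight_exists: "V \<noteq> {0} \<Longrightarrow> \<exists>\<mu>. W \<mu> \<noteq> {0}"
proof (rule ccontr)
  assume "V \<noteq> {0}" "\<nexists>\<mu>. W \<mu> \<noteq> {0}"
  then have "V \<subseteq> cspan sc {0}" using weights_span by auto
  also have "\<dots> \<subseteq> {0}" by (rule cspan_least[OF _ cvs_zero]) simp
  finally show False using \<open>V \<noteq> {0}\<close> by auto
qed

text \<open>V is the direct sum of the part with weights in \<open>lam\<close> + Z^n and the part
  with all other weights. Both are submodules and the first is nonzero, so the second
  vanishes.\<close>

lemma indecomposable_single_coset:
  assumes indec: "ops_indecomposable sc V UNIV (Jops d e)" and lam: "W lam \<noteq> {0}"
  shows "V = cspan sc (\<Union>k. W (shift_weight lam k))"
proof -
  let ?P = "range (shift_weight lam)"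
  let ?A = "cspan sc (\<Union>\<mu>\<in>?P. W \<mu>)" and ?B = "cspan sc (\<Union>\<mu>\<in>- ?P. W \<mu>)"
  have sub: "(\<Union>\<mu>\<in>P. W \<mu>) \<subseteq> V" for P using W_sub by blast
  have A: "ops_sub sc V UNIV (Jops d e) ?A"
    by (rule weight_sum_submodule) (auto simp: shift_weight_shift)
  have B: "ops_sub sc V UNIV (Jops d e) ?B"
  proof (rule weight_sum_submodule)
    fix \<mu> s assume \<mu>: "\<mu> \<in> - ?P"
    have "\<mu> \<in> ?P" if "shift_weight \<mu> s \<in> ?P"
    proof -
      obtain k where k: "shift_weight \<mu> s = shift_weight lam k" using \<open>shift_weight \<mu> s \<in> ?P\<close> by blast
      have "\<mu> = shift_weight (shift_weight \<mu> s) (- s)" by simp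
      also have "\<dots> = shift_weight lam (k + - s)" by (simp only: k shift_weight_shift)
      finally have "\<mu> = shift_weight lam (k + - s)" .
      then show ?thesis by blast
    qed
    then show "shift_weight \<mu> s \<in> - ?P" using \<mu> by blast
  qed
  interpret A: cvec sc ?A by unfold_locales (rule cspan_cvs[OF sub])
  interpret B: cvec sc ?B by unfold_locales (rule cspan_cvs[OF sub])
  have dec: "V = {a + b |a b. a \<in> ?A \<and> b \<in> ?B}"
  proof (intro subset_antisym subsetI)
    fix x assume "x \<in> V"
    then have x: "x \<in> cspan sc (\<Union>\<mu>\<in>UNIV. W \<mu>)" using weights_span by auto
    obtain F y where F: "finite F" "\<And>\<mu>. y \<mu> \<in> W \<mu>" and x_eq: "x = (\<Sum>\<mu>\<in>F. y \<mu>)"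
      by (rule group_cspan[OF W_sub W_cvs x]) blast
    have "x = (\<Sum>\<mu>\<in>F \<inter> ?P. y \<mu>) + (\<Sum>\<mu>\<in>F - ?P. y \<mu>)"
      unfolding x_eq using F(1) by (subst sum.union_disjoint[symmetric]) (auto intro: sum.cong)
    moreover have "(\<Sum>\<mu>\<in>F \<inter> ?P. y \<mu>) \<in> ?A"
      using F(2) W_sub by (intro A.sum_mem cspan_base) auto
    moreover have "(\<Sum>\<mu>\<in>F - ?P. y \<mu>) \<in> ?B"
      using F(2) W_sub by (intro B.sum_mem cspan_base) auto
    ultimately show "x \<in> {a + b |a b. a \<in> ?A \<and> b \<in> ?B}" by blast
  next
    fix x assume "x \<in> {a + b |a b. a \<in> ?A \<and> b \<in> ?B}"
    then obtain a b where ab: "x = a + b" "a \<in> ?A" "b \<in> ?B" by blast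
    from ab(2,3) show "x \<in> V"
      unfolding ab(1) by (intro add_mem subsetD[OF cspan_cvs(2)[OF sub]])
  qed
  have "W lam \<subseteq> (\<Union>\<mu>\<in>?P. W \<mu>)" using UN_upper[OF rangeI[of "shift_weight lam" 0], of W] by simp
  then have "W lam \<subseteq> ?A" using cspan_base W_sub by blast
  moreover have "\<exists>x\<in>W lam. x \<noteq> 0"
    using lam cvec.zero_mem[OF cvec.intro[OF W_cvs]] by blast
  ultimately have "?A \<noteq> {0}" by blast
  moreover have "?A \<inter> ?B = {0}" by (rule weight_sum_disjoint) simp
  ultimately have nz: "?A \<noteq> {0}" "?A \<inter> ?B = {0}" .
  have B0: "?B = {0}"
  proof (rule ccontr)
    assume "?B \<noteq> {0}"
    with A B nz dec have "\<exists>A B. ops_sub sc V UNIV (Jops d e) A \<and> ops_sub sc V UNIV (Jops d e) B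
      \<and> A \<noteq> {0} \<and> B \<noteq> {0} \<and> A \<inter> B = {0} \<and> V = {a + b |a b. a \<in> A \<and> b \<in> B}"
      by (intro exI[of _ ?A] exI[of _ ?B] conjI)
    with conjunct2[OF indec[unfolded ops_indecomposable_def]] show False by (rule notE)
  qed
  have "V = {a + b |a b. a \<in> ?A \<and> b \<in> {0}}" unfolding B0[symmetric] by (rule dec)
  then show ?thesis by simp
qed

end

section \<open>Recovering the W_n^+-module from one weight space\<close>

section \<open>Structure of indecomposable modules\<close>

text \<open>The linear extension of e_m \<otimes> u \<mapsto> \<open>E m u\<close>.\<close>

definition FU_map :: "(('n \<Rightarrow> int) \<Rightarrow> 'u::ab_group_add \<Rightarrow> 'w::ab_group_add) \<Rightarrow> (('n \<Rightarrow> int) \<Rightarrow> 'u) \<Rightarrow> 'w" where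
  "FU_map E f = (\<Sum>m | f m \<noteq> 0. E m (f m))"

context cvec
begin

lemma FU_map_superset:
  assumes E: "\<And>m. clin_on sc V sc' (E m)" and S: "finite S" "{m. f m \<noteq> 0} \<subseteq> S"
  shows "FU_map E f = (\<Sum>m\<in>S. E m (f m))"
  unfolding FU_map_def using S by (intro sum.mono_neutral_left) (auto simp: clin_on_zero[OF E])

lemma FU_map_sgl: "(\<And>m. clin_on sc V sc' (E m)) \<Longrightarrow> FU_map E (sgl m u) = E m u"
  by (subst FU_map_superset[where S = "{m}"]) (auto simp: sgl_def)

lemma FU_map_lin:
  fixes E :: "('n \<Rightarrow> int) \<Rightarrow> 'v \<Rightarrow> 'w::ab_group_add"
  assumes E: "\<And>m. clin_on sc V sc' (E m)" "\<And>m u. u \<in> V \<Longrightarrow> E m u \<in> V'" and V': "cvs sc' V'"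
  shows "clin_on (scF sc) (FU V) sc' (FU_map E)"
proof -
  interpret V': cvec sc' V' by unfold_locales fact
  show ?thesis
    unfolding clin_on_def
  proof (intro conjI allI ballI)
    fix f g :: "('n \<Rightarrow> int) \<Rightarrow> 'v" assume f: "f \<in> FU V" and g: "g \<in> FU V"
    let ?S = "{m. f m \<noteq> 0} \<union> {m. g m \<noteq> 0}"
    have S: "finite ?S" using FU_D(2)[OF f] FU_D(2)[OF g] by simp
    have "FU_map E (f + g) = (\<Sum>m\<in>?S. E m (f m) + E m (g m))"
      by (subst FU_map_superset[OF E(1) S]) (auto simp: clin_on_add[OF E(1)] FU_D(1)[OF f] FU_D(1)[OF g])
    also have "\<dots> = FU_map E f + FU_map E g"
      by (simp add: sum.distrib FU_map_superset[OF E(1) S])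
    finally show "FU_map E (f + g) = FU_map E f + FU_map E g" .
  next
    fix c and f :: "('n \<Rightarrow> int) \<Rightarrow> 'v" assume f: "f \<in> FU V"
    let ?S = "{m. f m \<noteq> 0}"
    have "FU_map E (scF sc c f) = (\<Sum>m\<in>?S. sc' c (E m (f m)))"
      by (subst FU_map_superset[OF E(1) FU_D(2)[OF f]])
        (auto simp: scF_def clin_on_scale[OF E(1)] FU_D(1)[OF f])
    also have "\<dots> = sc' c (FU_map E f)"
      unfolding FU_map_def by (rule V'.scale_sum[symmetric]) (simp add: E(2) FU_D(1)[OF f])
    finally show "FU_map E (scF sc c f) = sc' c (FU_map E f)" .
  qed
qed

lemma FU_map_mem:
  assumes "\<And>m u. u \<in> V \<Longrightarrow> E m u \<in> V'" "cvs sc' V'" "f \<in> FU V"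
  shows "FU_map E f \<in> V'"
proof -
  interpret V': cvec sc' V' by unfold_locales fact
  show ?thesis unfolding FU_map_def using assms(1) FU_D(1)[OF assms(3)] by (intro V'.sum_mem) simp
qed

lemma FU_lin_ext:
  fixes \<phi> \<psi> :: "(('n \<Rightarrow> int) \<Rightarrow> 'v) \<Rightarrow> 'w::ab_group_add"
  assumes lin: "clin_on (scF sc) (FU V) sc' \<phi>" "clin_on (scF sc) (FU V) sc' \<psi>"
    and agree: "\<And>m u. u \<in> V \<Longrightarrow> \<phi> (sgl m u) = \<psi> (sgl m u)" and f: "f \<in> FU V"
  shows "\<phi> f = \<psi> f"
proof -
  interpret F: cvec "scF sc" "FU V :: (('n \<Rightarrow> int) \<Rightarrow> 'v) set" by (rule cvec_FU)
  have mem: "sgl m (f m) \<in> FU V" for m using FU_D(1)[OF f] by simp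
  have "\<phi> (\<Sum>m | f m \<noteq> 0. sgl m (f m)) = \<psi> (\<Sum>m | f m \<noteq> 0. sgl m (f m))"
    by (simp only: F.clin_on_sum[OF lin(1) mem] F.clin_on_sum[OF lin(2) mem] agree[OF FU_D(1)[OF f]])
  then show ?thesis using FU_decomp[OF FU_D(2)[OF f]] by metis
qed

end

lemma clin_on_comp:
  "clin_on sc V sc' f \<Longrightarrow> clin_on sc' V' sc'' g \<Longrightarrow> (\<And>x. x \<in> V \<Longrightarrow> f x \<in> V') \<Longrightarrow>
    clin_on sc V sc'' (\<lambda>x. g (f x))"
  unfolding clin_on_def by simp

lemma ops_iso_sym:
  assumes "ops_iso sc V I ops sc' V' ops'" and V: "cvs sc V"
    and closed: "\<And>i x. i \<in> I \<Longrightarrow> x \<in> V \<Longrightarrow> ops i x \<in> V"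
  shows "ops_iso sc' V' I ops' sc V ops"
proof -
  interpret cvec sc V by unfold_locales fact
  obtain f where f: "bij_betw f V V'" "clin_on sc V sc' f"
    and op: "\<And>i x. i \<in> I \<Longrightarrow> x \<in> V \<Longrightarrow> f (ops i x) = ops' i (f x)"
    using assms(1) unfolding ops_iso_def by blast
  let ?g = "inv_into V f"
  have g: "?g y \<in> V" "f (?g y) = y" if "y \<in> V'" for y
    using f(1) that by (auto simp: bij_betw_def inv_into_into f_inv_into_f)
  have gf: "?g (f x) = x" if "x \<in> V" for x
    using f(1) that by (auto simp: bij_betw_def inv_into_f_f)
  have "clin_on sc' V' sc ?g"
    unfolding clin_on_def
  proof (intro conjI allI ballI)
    fix x y assume "x \<in> V'" "y \<in> V'"
    then show "?g (x + y) = ?g x + ?g y"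
      using gf[of "?g x + ?g y"] g by (simp add: clin_on_add[OF f(2)])
  next
    fix c x assume "x \<in> V'"
    then show "?g (sc' c x) = sc c (?g x)"
      using gf[of "sc c (?g x)"] g by (simp add: clin_on_scale[OF f(2)])
  qed
  moreover have "?g (ops' i y) = ops i (?g y)" if "i \<in> I" "y \<in> V'" for i y
    using gf[of "ops i (?g y)"] g[OF that(2)] op[OF that(1)] closed[OF that(1)] by simp
  ultimately show ?thesis
    unfolding ops_iso_def using bij_betw_inv_into[OF f(1)] by blast
qed

context jmod
begin

text \<open>The map e_m \<otimes> u \<mapsto> e_m u is injective because the images of different
  degrees have different weights and \<open>e m\<close> is invertible. It is surjective because
  \<open>e (- k)\<close> carries the weight \<open>lam\<close> + k back to
  \<open>lam\<close>.\<close>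

lemma FU_map_e_bij:
  assumes span: "V = cspan sc (\<Union>k. W (shift_weight lam k))"
  shows "bij_betw (FU_map e) (FU (W lam)) V"
    and "clin_on (scF sc) (FU (W lam)) sc (FU_map e)"
proof -
  interpret U: cvec sc "W lam" by unfold_locales (rule W_cvs)
  interpret F: cvec "scF sc" "FU (W lam) :: (('n \<Rightarrow> int) \<Rightarrow> 'v) set" by (rule U.cvec_FU)
  have e_U: "clin_on sc (W lam) sc (e m)" for m
    using e_lin W_sub unfolding clin_on_def by blast
  have e_sgl: "FU_map e (sgl m u) = e m u" for m u by (rule U.FU_map_sgl[OF e_U])
  have UV: "u \<in> V" if "u \<in> W lam" for u using that W_sub by blast
  have eV: "e m u \<in> V" if "u \<in> W lam" for m u using UV[OF that] by simp
  show lin: "clin_on (scF sc) (FU (W lam)) sc (FU_map e)"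
    by (rule U.FU_map_lin[OF e_U eV cvs])
  have mem: "FU_map e f \<in> V" if "f \<in> FU (W lam)" for f
    by (rule U.FU_map_mem[OF eV cvs that])
  have "f = 0" if f: "f \<in> FU (W lam)" and 0: "FU_map e f = 0" for f
  proof
    fix m
    show "f m = 0 m"
    proof (rule ccontr)
      assume nz: "f m \<noteq> 0 m"
      have "e m (f m) \<in> {0}"
      proof (rule weight_components_mem[where F = "{m. f m \<noteq> 0}" and \<mu> = "shift_weight lam"])
        show "(\<Sum>m | f m \<noteq> 0. e m (f m)) \<in> {0}" using 0 by (simp add: FU_map_def)
        show "e m (f m) \<in> W (shift_weight lam m)" for m using e_W[OF U.FU_D(1)[OF f]] .
        show "inj_on (shift_weight lam) {m. f m \<noteq> 0}"
          by (auto simp: inj_on_def shift_weight_def fun_eq_iff)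
      qed (use U.FU_D(2)[OF f] nz cvs_zero clin_on_zero[OF d_lin] in auto)
      then have "e (- m) (e m (f m)) = 0" using clin_on_zero[OF e_lin] by simp
      then show False using nz UV[OF U.FU_D(1)[OF f]] by simp
    qed
  qed
  then have "inj_on (FU_map e) (FU (W lam))"
    unfolding inj_on_def by (metis F.clin_on_diff[OF lin] F.diff_mem eq_iff_diff_eq_0)
  moreover have "FU_map e ` FU (W lam) = V"
  proof
    show "FU_map e ` FU (W lam) \<subseteq> V" using mem by blast
    have "cvs sc (FU_map e ` FU (W lam))"
    proof (rule cvs_subset)
      show "FU_map e ` FU (W lam) \<subseteq> V" by fact
      show "0 \<in> FU_map e ` FU (W lam)"
        using F.clin_on_zero[OF lin] F.zero_mem by (intro image_eqI[where x = 0]) simp_all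
    next
      fix x y assume "x \<in> FU_map e ` FU (W lam)" "y \<in> FU_map e ` FU (W lam)"
      then obtain f g where "x = FU_map e f" "y = FU_map e g" "f \<in> FU (W lam)" "g \<in> FU (W lam)" by blast
      then show "x + y \<in> FU_map e ` FU (W lam)"
        by (intro image_eqI[of _ _ "f + g"]) (simp_all only: F.clin_on_add[OF lin] F.add_mem)
    next
      fix c x assume "x \<in> FU_map e ` FU (W lam)"
      then obtain f where "x = FU_map e f" "f \<in> FU (W lam)" by blast
      then show "sc c x \<in> FU_map e ` FU (W lam)"
        by (intro image_eqI[of _ _ "scF sc c f"]) (simp_all only: F.clin_on_scale[OF lin] F.scale_mem)
    qed
    moreover have "(\<Union>k. W (shift_weight lam k)) \<subseteq> FU_map e ` FU (W lam)"
    proof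
      fix x assume "x \<in> (\<Union>k. W (shift_weight lam k))"
      then obtain k where x: "x \<in> W (shift_weight lam k)" by blast
      then have xV: "x \<in> V" using W_sub by blast
      have u: "e (- k) x \<in> W lam" using e_W[OF x, of "- k"] by simp
      have "FU_map e (sgl k (e (- k) x)) = x"
        using xV by (simp add: e_sgl)
      then show "x \<in> FU_map e ` FU (W lam)" using U.sgl_FU[OF u] by (intro image_eqI[OF sym])
    qed
    ultimately have "cspan sc (\<Union>k. W (shift_weight lam k)) \<subseteq> FU_map e ` FU (W lam)"
      by (intro cspan_least)
    then show "V \<subseteq> FU_map e ` FU (W lam)" using span by simp
  qed
  ultimately show "bij_betw (FU_map e) (FU (W lam)) V" by (simp add: bij_betw_def)
qed

lemma finitely_generated:
  "\<exists>B. finite B \<and> B \<subseteq> V \<and> (\<forall>x\<in>V. \<exists>c. x = (\<Sum>b\<in>B. \<Sum>m\<in>{m. c b m \<noteq> 0}. sc (c b m) (e m b)))"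
proof -
  have "\<exists>B. finite B \<and> B \<subseteq> V \<and> (\<forall>x\<in>V. \<exists>!c :: 'v \<Rightarrow> ('n \<Rightarrow> int) \<Rightarrow> complex. (\<forall>b m. c b m \<noteq> 0 \<longrightarrow> b \<in> B)
      \<and> (\<forall>b. finite {m. c b m \<noteq> 0}) \<and> x = (\<Sum>b\<in>B. \<Sum>m\<in>{m. c b m \<noteq> 0}. sc (c b m) (e m b)))"
    using jmod unfolding is_Jmod_def by (elim conjE)
  then obtain B where B: "finite B \<and> B \<subseteq> V \<and> (\<forall>x\<in>V. \<exists>!c :: 'v \<Rightarrow> ('n \<Rightarrow> int) \<Rightarrow> complex. (\<forall>b m. c b m \<noteq> 0 \<longrightarrow> b \<in> B)
      \<and> (\<forall>b. finite {m. c b m \<noteq> 0}) \<and> x = (\<Sum>b\<in>B. \<Sum>m\<in>{m. c b m \<noteq> 0}. sc (c b m) (e m b)))" ..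
  show ?thesis
  proof (intro exI[of _ B] conjI ballI)
    fix x assume "x \<in> V"
    from ex1_implies_ex[OF bspec[OF conjunct2[OF conjunct2[OF B]] this]]
    show "\<exists>c. x = (\<Sum>b\<in>B. \<Sum>m\<in>{m. c b m \<noteq> 0}. sc (c b m) (e m b))"
      by (elim exE conjE, intro exI)
  qed (use B in simp_all)
qed

text \<open>Evaluation at the identity of the torus maps the finitely many free generators onto a
  spanning set of the weight space.\<close>

lemma findim_weight_space:
  assumes span: "V = cspan sc (\<Union>k. W (shift_weight lam k))"
  shows "findim sc (W lam)"
proof -
  interpret U: cvec sc "W lam" by unfold_locales (rule W_cvs)
  interpret F: cvec "scF sc" "FU (W lam) :: (('n \<Rightarrow> int) \<Rightarrow> 'v) set" by (rule U.cvec_FU)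
  note bij = FU_map_e_bij(1)[OF span] and lin = FU_map_e_bij(2)[OF span]
  have e_U: "clin_on sc (W lam) sc (e m)" for m
    using e_lin W_sub unfolding clin_on_def by blast
  have e_sgl: "FU_map e (sgl m u) = e m u" for m u by (rule U.FU_map_sgl[OF e_U])
  have UV: "u \<in> V" if "u \<in> W lam" for u using that W_sub by blast
  let ?\<sigma> = "FU_map (\<lambda>_ u. u) :: (('n \<Rightarrow> int) \<Rightarrow> 'v) \<Rightarrow> 'v"
  have id_lin: "clin_on sc (W lam) sc (\<lambda>u. u)" by (simp add: clin_on_def)
  have id_sgl: "?\<sigma> (sgl m u) = u" for m u by (rule U.FU_map_sgl[OF id_lin])
  have s_lin: "clin_on (scF sc) (FU (W lam)) sc ?\<sigma>" by (rule U.FU_map_lin[OF id_lin _ W_cvs])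
  have s_mem: "?\<sigma> f \<in> W lam" if "f \<in> FU (W lam)" for f by (rule U.FU_map_mem[OF _ W_cvs that])
  have sh_lin: "clin_on (scF sc) (FU (W lam)) (scF sc) (shiftE m)" for m :: "'n \<Rightarrow> int"
    by (auto simp: clin_on_def fun_eq_iff scF_def shiftE_def)
  have s_shift: "?\<sigma> (shiftE m f) = ?\<sigma> f" if "f \<in> FU (W lam)" for m f
    by (rule U.FU_lin_ext[OF clin_on_comp[OF sh_lin s_lin] s_lin _ that])
      (auto simp: id_sgl)
  have e_shift: "FU_map e (shiftE m f) = e m (FU_map e f)" if "f \<in> FU (W lam)" for m f
  proof (rule U.FU_lin_ext[OF clin_on_comp[OF sh_lin lin] clin_on_comp[OF lin e_lin] _ that])
    show "FU_map e f \<in> V" if "f \<in> FU (W lam)" for f using bij that by (auto simp: bij_betw_def)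
    show "FU_map e (shiftE m (sgl k u)) = e m (FU_map e (sgl k u))" if "u \<in> W lam" for k u
      using UV[OF that] by (simp add: e_sgl add.commute)
  qed auto
  from finitely_generated obtain B where B: "finite B" "B \<subseteq> V"
    and ex: "\<forall>x\<in>V. \<exists>c. x = (\<Sum>b\<in>B. \<Sum>m\<in>{m. c b m \<noteq> 0}. sc (c b m) (e m b))"
    by blast
  let ?h = "inv_into (FU (W lam)) (FU_map e)"
  have h: "?h x \<in> FU (W lam)" "FU_map e (?h x) = x" if "x \<in> V" for x
    using bij that by (auto simp: bij_betw_def inv_into_into f_inv_into_f)
  have "u \<in> cspan sc ((\<lambda>b. ?\<sigma> (?h b)) ` B)" if u: "u \<in> W lam" for u
  proof -
    let ?C = "cspan sc ((\<lambda>b. ?\<sigma> (?h b)) ` B)"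
    have BW: "(\<lambda>b. ?\<sigma> (?h b)) ` B \<subseteq> W lam" using s_mem h(1) B(2) by blast
    interpret C: cvec sc ?C by unfold_locales (rule U.cspan_cvs[OF BW])
    obtain c where c: "u = (\<Sum>b\<in>B. \<Sum>m\<in>{m. c b m \<noteq> 0}. sc (c b m) (e m b))"
      using bspec[OF ex UV[OF u]] by blast
    let ?f = "\<Sum>b\<in>B. \<Sum>m\<in>{m. c b m \<noteq> 0}. scF sc (c b m) (shiftE m (?h b))"
    have mem: "scF sc (c b m) (shiftE m (?h b)) \<in> FU (W lam)" if "b \<in> B" for b m
      using h(1)[of b] B(2) that by (intro F.scale_mem U.shiftE_FU) blast
    have f: "?f \<in> FU (W lam)" by (intro F.sum_mem mem)
    have hB: "?h b \<in> FU (W lam)" "FU_map e (?h b) = b" if "b \<in> B" for b using h B(2) that by blast+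
    have "FU_map e ?f = u"
      unfolding c using mem
      by (simp add: F.clin_on_sum[OF lin] F.clin_on_scale[OF lin] U.shiftE_FU hB e_shift)
    moreover have "FU_map e (sgl 0 u) = u" using UV[OF u] by (simp add: e_sgl)
    ultimately have "?f = sgl 0 u"
      using inj_onD[OF bij_betw_imp_inj_on[OF bij] _ f U.sgl_FU[OF u]] by simp
    then have "u = ?\<sigma> ?f" by (simp add: id_sgl)
    also have "\<dots> = (\<Sum>b\<in>B. \<Sum>m\<in>{m. c b m \<noteq> 0}. sc (c b m) (?\<sigma> (?h b)))"
      using mem by (simp add: F.clin_on_sum[OF s_lin] F.clin_on_scale[OF s_lin] U.shiftE_FU hB s_shift)
    also have "\<dots> \<in> ?C"
      by (intro C.sum_mem C.scale_mem U.cspan_base imageI subsetD[OF BW])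
    finally show ?thesis .
  qed
  then show ?thesis
    unfolding findim_def using B s_mem h(1)
    by (intro exI[of _ "(\<lambda>b. ?\<sigma> (?h b)) ` B"]) blast
qed

text \<open>Subtracting \<open>lam j\<close> makes the operators vanish at s = 0, as they must to
  represent (e_s - 1) \<partial>_j. The scalars drop out of commutators but supply the differences
  on the right of \<open>D_comm\<close>.\<close>

lemma vanishing_fields_weight_space:
  assumes fd: "findim sc (W lam)"
  shows "vanishing_fields sc (W lam) (\<lambda>j s u. e (- s) (d j s u) - sc (lam j) u)"
proof -
  interpret U: cvec sc "W lam" by unfold_locales (rule W_cvs)
  let ?F = "\<lambda>j s u. e (- s) (d j s u)"
  have F_mem: "?F j s u \<in> W lam" if "u \<in> W lam" for j s u
    using e_W[OF d_W[OF that], of "- s" j s] by simp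
  have UV: "u \<in> V" if "u \<in> W lam" for u using that W_sub by blast
  have F_add: "?F j s (x + y) = ?F j s x + ?F j s y" if "x \<in> V" "y \<in> V" for j s x y
    using that by (simp add: clin_on_add[OF d_lin] clin_on_add[OF e_lin])
  have F_scale: "?F j s (sc c x) = sc c (?F j s x)" if "x \<in> V" for j s c x
    using that by (simp add: clin_on_scale[OF d_lin] clin_on_scale[OF e_lin])
  have F_diff: "?F j s (x - y) = ?F j s x - ?F j s y" if "x \<in> V" "y \<in> V" for j s x y
    using that by (simp add: clin_on_diff[OF d_lin] clin_on_diff[OF e_lin])
  \<comment> \<open>Moving \<open>e (- m)\<close> past \<open>d j s\<close> costs the scalar -m_j by
    the Leibniz rule; this is the origin of the terms with index m alone, and symmetrically with s
    alone, in \<open>D_comm\<close>.\<close>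
  have FF: "?F j s (?F k m u) = e (- (s + m)) (d j s (d k m u)) - sc (of_int (m j)) (?F k m u)"
    if u: "u \<in> V" for j k s m u
  proof -
    have "?F j s (?F k m u) = e (- s) (sc (of_int ((- m) j)) (e (- m + s) (d k m u)) + e (- m) (d j s (d k m u)))"
      using d_e[of "d k m u" j s "- m"] u by simp
    also have "\<dots> = sc (of_int ((- m) j)) (e (- s + (- m + s)) (d k m u)) + e (- s + - m) (d j s (d k m u))"
      using u by (simp only: clin_on_add[OF e_lin] clin_on_scale[OF e_lin] e_e d_mem e_mem scale_mem)
    also have "- s + (- m + s) = - m" by simp
    also have "- s + - m = - (s + m)" by simp
    also have "complex_of_int ((- m) j) = - of_int (m j)" by simp
    also have "sc (- of_int (m j)) (?F k m u) = - sc (of_int (m j)) (?F k m u)"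
      using u by (intro scale_minus_left e_mem d_mem)
    finally show ?thesis by (simp only: uminus_add_conv_diff)
  qed
  show ?thesis
  proof (unfold_locales, goal_cases)
    case 1 show ?case by (rule fd)
  next
    case (2 u j s) then show ?case using F_mem by simp
  next
    case (3 j s)
    show ?case
      unfolding clin_on_def using UV
      by (auto simp: F_add F_scale scale_add scale_diff mult.commute)
  next
    case (4 u j) then show ?case using UV by (simp add: W_iff)
  next
    case (5 u j s k m)
    have u: "u \<in> V" using 5 UV by blast
    have "?F j s (?F k m u) - ?F k m (?F j s u)
      = e (- (s + m)) (d j s (d k m u) - d k m (d j s u)) - sc (of_int (m j)) (?F k m u) + sc (of_int (s k)) (?F j s u)"
      using u by (simp add: FF clin_on_diff[OF e_lin] add.commute)
    also have "e (- (s + m)) (d j s (d k m u) - d k m (d j s u))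
      = sc (of_int (m j)) (?F k (s + m) u) - sc (of_int (s k)) (?F j (s + m) u)"
      using u by (simp add: d_d clin_on_diff[OF e_lin] clin_on_scale[OF e_lin])
    finally have "?F j s (?F k m u) - ?F k m (?F j s u)
      = sc (of_int (m j)) (?F k (s + m) u) - sc (of_int (s k)) (?F j (s + m) u)
        - sc (of_int (m j)) (?F k m u) + sc (of_int (s k)) (?F j s u)" .
    then show ?case
      using u by (simp add: F_diff F_scale scale_diff mult.commute)
  qed
qed

end

lemma (in cvec) D_expansion_unique:
  fixes d :: "'n::finite \<Rightarrow> ('n \<Rightarrow> int) \<Rightarrow> 'v \<Rightarrow> 'v"
  assumes D: "D_expansion sc d e lam V D" "D_expansion sc d e lam V D'"
    and a: "\<alpha> \<noteq> 0" and u: "u \<in> V"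
  shows "D' j \<alpha> u = D j \<alpha> u"
proof -
  have mem: "D j \<alpha> u \<in> V" "D' j \<alpha> u \<in> V" if "\<alpha> \<noteq> 0" for \<alpha>
    using D u that by (auto simp: D_expansion_def)
  obtain A where A: "finite A" "0 \<notin> A" "\<And>\<alpha>. \<alpha> \<notin> A \<Longrightarrow> \<alpha> \<noteq> 0 \<Longrightarrow> D j \<alpha> u = 0"
    "\<And>s. e (- s) (d j s u) = sc (lam j) u + (\<Sum>\<alpha>\<in>A. sc (mono s \<alpha> / mfact \<alpha>) (D j \<alpha> u))"
    using D(1) u by (auto simp: D_expansion_def)
  obtain A' where A': "finite A'" "0 \<notin> A'" "\<And>\<alpha>. \<alpha> \<notin> A' \<Longrightarrow> \<alpha> \<noteq> 0 \<Longrightarrow> D' j \<alpha> u = 0"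
    "\<And>s. e (- s) (d j s u) = sc (lam j) u + (\<Sum>\<alpha>\<in>A'. sc (mono s \<alpha> / mfact \<alpha>) (D' j \<alpha> u))"
    using D(2) u by (auto simp: D_expansion_def)
  show ?thesis
  proof (cases "\<alpha> \<in> A \<union> A'")
    case False
    then show ?thesis using A(3) A'(3) a by simp
  next
    case True
    show ?thesis
    proof (rule expansion_unique[where A = "A \<union> A'" and R = "\<lambda>\<alpha>. D' j \<alpha> u" and R' = "\<lambda>\<alpha>. D j \<alpha> u", OF _ _ _ _ True])
      fix s :: "'n \<Rightarrow> int"
      have nz: "\<alpha> \<noteq> 0" if "\<alpha> \<in> A \<union> A'" for \<alpha> using that A(2) A'(2) by auto
      have "(\<Sum>\<alpha>\<in>A. sc (mono s \<alpha> / mfact \<alpha>) (D j \<alpha> u)) = (\<Sum>\<alpha>\<in>A \<union> A'. sc (mono s \<alpha> / mfact \<alpha>) (D j \<alpha> u))"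
        by (rule sum.mono_neutral_left) (use A A' nz in auto)
      moreover have "(\<Sum>\<alpha>\<in>A'. sc (mono s \<alpha> / mfact \<alpha>) (D' j \<alpha> u)) = (\<Sum>\<alpha>\<in>A \<union> A'. sc (mono s \<alpha> / mfact \<alpha>) (D' j \<alpha> u))"
        by (rule sum.mono_neutral_left) (use A A' nz in auto)
      ultimately show "(\<Sum>\<alpha>\<in>A \<union> A'. sc (mono s \<alpha> / mfact \<alpha>) (D' j \<alpha> u))
        = (\<Sum>\<alpha>\<in>A \<union> A'. sc (mono s \<alpha> / mfact \<alpha>) (D j \<alpha> u))"
        using A(4)[of s] A'(4)[of s] by simp
    next
      fix \<beta> assume "\<beta> \<in> A \<union> A'"
      then have "\<beta> \<noteq> 0" using A(2) A'(2) by auto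
      then show "D' j \<beta> u \<in> V" "D j \<beta> u \<in> V" using mem by auto
    qed (use A A' in auto)
  qed
qed

lemma (in jmod) weight_space_rep:
  assumes indec: "ops_indecomposable sc V UNIV (Jops d e)" and lam: "W lam \<noteq> {0}"
  obtains C K where "wplus_module_fd sc (W lam) C" "wplus_module.supported (W lam) C K"
    "\<And>j s u. u \<in> W lam \<Longrightarrow> e (- s) (d j s u) = sc (lam j) u + cvec.expand sc (mbox K) (C j) s u"
proof -
  note span = indecomposable_single_coset[OF indec lam]
  note fd = findim_weight_space[OF span]
  interpret vf: vanishing_fields sc "W lam" "\<lambda>j s u. e (- s) (d j s u) - sc (lam j) u"
    by (rule vanishing_fields_weight_space[OF fd])
  from vf.D_wplus_rep obtain K C where rep: "Wplus_rep sc (W lam) C"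
    and supp: "\<forall>j. Wp_supp (W lam) C j \<subseteq> mbox K"
    and D: "\<forall>j s. \<forall>u\<in>W lam. e (- s) (d j s u) - sc (lam j) u = vf.expand (mbox K) (C j) s u"
    by (elim exE conjE)
  interpret C: wplus_module_fd sc "W lam" C by unfold_locales (fact rep fd)+
  have "C.supported K" using supp by (simp add: C.supported_def)
  moreover have "e (- s) (d j s u) = sc (lam j) u + vf.expand (mbox K) (C j) s u" if "u \<in> W lam" for j s u
    using D that by (simp add: diff_eq_eq add.commute)
  ultimately show thesis using that C.wplus_module_fd_axioms by blast
qed

lemma (in jmod) weight_space_D_expansion:
  assumes indec: "ops_indecomposable sc V UNIV (Jops d e)" and lam: "W lam \<noteq> {0}"
  shows "findim sc (W lam) \<and>
    (\<exists>D. D_expansion sc d e lam (W lam) D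
       \<and> (\<forall>D'. D_expansion sc d e lam (W lam) D' \<longrightarrow> (\<forall>j \<alpha>. \<alpha> \<noteq> 0 \<longrightarrow> (\<forall>u\<in>W lam. D' j \<alpha> u = D j \<alpha> u)))
       \<and> Wplus_rep sc (W lam) D)"
proof -
  obtain C K where C: "wplus_module_fd sc (W lam) C" and K: "wplus_module.supported (W lam) C K"
    and D: "\<And>j s u. u \<in> W lam \<Longrightarrow> e (- s) (d j s u) = sc (lam j) u + cvec.expand sc (mbox K) (C j) s u"
    using weight_space_rep[OF indec lam] by blast
  interpret C: wplus_module_fd sc "W lam" C by fact
  have DC: "D_expansion sc d e lam (W lam) C"
    unfolding D_expansion_def
  proof (intro conjI exI[of _ "mbox K"])
    show "\<forall>j \<alpha>. \<alpha> \<notin> mbox K \<longrightarrow> \<alpha> \<noteq> 0 \<longrightarrow> (\<forall>u\<in>W lam. C j \<alpha> u = 0)"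
      using C.supportedD[OF K] by blast
    show "\<forall>j s. \<forall>u\<in>W lam. e (- s) (d j s u) = sc (lam j) u + (\<Sum>\<alpha>\<in>mbox K. sc (mono s \<alpha> / mfact \<alpha>) (C j \<alpha> u))"
      using D unfolding C.expand_def by blast
  qed auto
  show ?thesis using C.fd C.rep DC C.D_expansion_unique[OF DC] by blast
qed

lemma (in wplus_module_fd) Jops_closed:
  "x \<in> FU U \<Longrightarrow> Jops (Jd lam) shiftE i x \<in> FU U"
  by (cases i) (auto simp: Jops_def)

lemma ops_iso_preimage:
  assumes f: "bij_betw f V V'" "clin_on sc V sc' f"
    and op: "\<And>i x. i \<in> I \<Longrightarrow> x \<in> V \<Longrightarrow> f (ops i x) = ops' i (f x)"
    and closed: "\<And>i x. i \<in> I \<Longrightarrow> x \<in> V \<Longrightarrow> ops i x \<in> V"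
    and V: "cvs sc V" and A: "ops_sub sc' V' I ops' A"
  shows "ops_sub sc V I ops {x\<in>V. f x \<in> A}"
proof -
  interpret cvec sc V by unfold_locales fact
  have A': "cvs sc' A" "\<And>i x. i \<in> I \<Longrightarrow> x \<in> A \<Longrightarrow> ops' i x \<in> A" using A by (auto simp: ops_sub_def)
  interpret A: cvec sc' A by unfold_locales fact
  have "cvs sc {x\<in>V. f x \<in> A}"
    by (rule cvs_subset) (auto simp: clin_on_zero[OF f(2)] clin_on_add[OF f(2)] clin_on_scale[OF f(2)])
  then show ?thesis using op closed A' by (auto simp: ops_sub_def)
qed

lemma ops_iso_zero:
  assumes "bij_betw f V V'" "clin_on sc V sc' f" "cvs sc V"
  shows "V = {0} \<longleftrightarrow> V' = {0}"
proof -
  interpret cvec sc V by unfold_locales fact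
  have "f 0 = 0" by (rule clin_on_zero[OF assms(2)])
  show ?thesis
  proof
    assume "V = {0}" then show "V' = {0}" using assms(1) \<open>f 0 = 0\<close> by (auto simp: bij_betw_def)
  next
    assume "V' = {0}"
    then have "x = 0" if "x \<in> V" for x
      using inj_onD[OF bij_betw_imp_inj_on[OF assms(1)], of x 0] that bij_betwE[OF assms(1)] \<open>f 0 = 0\<close> by simp
    then show "V = {0}" using zero_mem by blast
  qed
qed

lemma ops_iso_indecomposable:
  assumes iso: "ops_iso sc V I ops sc' V' ops'" and V: "cvs sc V"
    and closed: "\<And>i x. i \<in> I \<Longrightarrow> x \<in> V \<Longrightarrow> ops i x \<in> V"
    and indec: "ops_indecomposable sc V I ops"
  shows "ops_indecomposable sc' V' I ops'"
proof -
  interpret cvec sc V by unfold_locales fact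
  obtain f where f: "bij_betw f V V'" "clin_on sc V sc' f"
    and op: "\<And>i x. i \<in> I \<Longrightarrow> x \<in> V \<Longrightarrow> f (ops i x) = ops' i (f x)"
    using iso unfolding ops_iso_def by blast
  have nz: "V' \<noteq> {0}" using indec ops_iso_zero[OF f V] by (simp add: ops_indecomposable_def)
  show ?thesis
    unfolding ops_indecomposable_def
  proof (intro conjI nz notI, elim exE conjE)
    fix A B
    assume A: "ops_sub sc' V' I ops' A" and B: "ops_sub sc' V' I ops' B"
      and ne: "A \<noteq> {0}" "B \<noteq> {0}" and int: "A \<inter> B = {0}" and dec: "V' = {a + b |a b. a \<in> A \<and> b \<in> B}"
    let ?p = "\<lambda>A. {x\<in>V. f x \<in> A}"
    have AV: "A \<subseteq> V'" "B \<subseteq> V'" and zA: "0 \<in> A" "0 \<in> B" using A B by (auto simp: ops_sub_def cvs_def)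
    have surj: "\<exists>x\<in>V. f x = y" if "y \<in> V'" for y using f(1) that by (auto simp: bij_betw_def)
    have inj: "x = y" if "x \<in> V" "y \<in> V" "f x = f y" for x y
      using f(1) that by (auto simp: bij_betw_def inj_on_def)
    have f0: "f 0 = 0" by (rule clin_on_zero[OF f(2)])
    have p_ne: "?p A \<noteq> {0}" if A: "A \<noteq> {0}" "0 \<in> A" "A \<subseteq> V'" for A
    proof -
      obtain y where "y \<in> A" "y \<noteq> 0" using A by blast
      then obtain x where "x \<in> V" "f x = y" using A surj by blast
      then have "x \<in> ?p A" "x \<noteq> 0" using \<open>y \<in> A\<close> \<open>y \<noteq> 0\<close> f0 by auto
      then show ?thesis by blast
    qed
    have "?p A \<inter> ?p B = {0}"
    proof (intro subset_antisym subsetI)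
      fix x assume "x \<in> ?p A \<inter> ?p B"
      then have "x \<in> V" "f x \<in> A \<inter> B" by auto
      then show "x \<in> {0}" using int inj[of x 0] f0 by simp
    qed (use f0 zA in auto)
    moreover have "V = {a + b |a b. a \<in> ?p A \<and> b \<in> ?p B}"
    proof (intro subset_antisym subsetI)
      fix x assume x: "x \<in> V"
      then have "f x \<in> V'" using f(1) by (auto simp: bij_betw_def)
      then obtain a b where ab: "f x = a + b" "a \<in> A" "b \<in> B" using dec by blast
      obtain a' b' where a': "a' \<in> V" "f a' = a" and b': "b' \<in> V" "f b' = b" using surj ab AV by blast
      have "f x = f (a' + b')" using ab a' b' by (simp add: clin_on_add[OF f(2)])
      then have "x = a' + b'" using inj x a' b' by simp
      then show "x \<in> {a + b |a b. a \<in> ?p A \<and> b \<in> ?p B}" using a' b' ab by blast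
    qed auto
    moreover note ops_iso_preimage[OF f op closed V A] ops_iso_preimage[OF f op closed V B]
    moreover note p_ne[OF ne(1) zA(1) AV(1)] p_ne[OF ne(2) zA(2) AV(2)]
    ultimately have "\<exists>A B. ops_sub sc V I ops A \<and> ops_sub sc V I ops B \<and> A \<noteq> {0} \<and> B \<noteq> {0}
            \<and> A \<inter> B = {0} \<and> V = {a + b |a b. a \<in> A \<and> b \<in> B}"
      by (intro exI[of _ "?p A"] exI[of _ "?p B"] conjI)
    with conjunct2[OF indec[unfolded ops_indecomposable_def]] show False by (rule notE)
  qed
qed

lemma ops_iso_irreducible:
  assumes iso: "ops_iso sc V I ops sc' V' ops'" and V: "cvs sc V"
    and closed: "\<And>i x. i \<in> I \<Longrightarrow> x \<in> V \<Longrightarrow> ops i x \<in> V"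
    and irr: "ops_irreducible sc V I ops"
  shows "ops_irreducible sc' V' I ops'"
proof -
  interpret cvec sc V by unfold_locales fact
  obtain f where f: "bij_betw f V V'" "clin_on sc V sc' f"
    and op: "\<And>i x. i \<in> I \<Longrightarrow> x \<in> V \<Longrightarrow> f (ops i x) = ops' i (f x)"
    using iso unfolding ops_iso_def by blast
  have nz: "V' \<noteq> {0}" using irr ops_iso_zero[OF f V] by (simp add: ops_irreducible_def)
  show ?thesis
    unfolding ops_irreducible_def
  proof (intro conjI nz allI impI)
    fix A assume A: "ops_sub sc' V' I ops' A"
    have AV: "A \<subseteq> V'" and zA: "0 \<in> A" using A by (auto simp: ops_sub_def cvs_def)
    have im: "f ` {x\<in>V. f x \<in> A} = A" using AV f(1) by (auto simp: bij_betw_def)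
    have "{x\<in>V. f x \<in> A} = {0} \<or> {x\<in>V. f x \<in> A} = V"
      using irr ops_iso_preimage[OF f op closed V A] by (simp add: ops_irreducible_def)
    then show "A = {0} \<or> A = V'"
    proof
      assume "{x\<in>V. f x \<in> A} = {0}"
      then show ?thesis using im clin_on_zero[OF f(2)] by auto
    next
      assume "{x\<in>V. f x \<in> A} = V"
      then show ?thesis using im f(1) by (simp add: bij_betw_def)
    qed
  qed
qed

lemma irreducible_imp_indecomposable:
  assumes "ops_irreducible sc V I ops" shows "ops_indecomposable sc V I ops"
  unfolding ops_indecomposable_def
proof (intro conjI notI, goal_cases)
  case 1 then show ?case using assms by (simp add: ops_irreducible_def)
next
  case 2
  then obtain A B where *: "ops_sub sc V I ops A" "ops_sub sc V I ops B" "A \<noteq> {0}" "B \<noteq> {0}" "A \<inter> B = {0}"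
    by (elim exE conjE)
  then have "A = V" "B = V" using assms unfolding ops_irreducible_def by blast+
  then show ?case using * by simp
qed

text \<open>The isomorphism is the inverse of \<open>FU_map e\<close>. Intertwining is checked on
  pure tensors, where d_j(s) u = e_s (\<lambda>_j u + \<open>Dw j s u\<close>) and the Leibniz rule
  supplies m_j.\<close>

theorem (in jmod) indecomposable_structure:
  assumes indec: "ops_indecomposable sc V UNIV (Jops d e)"
  obtains lam U \<rho> where "wplus_module_fd sc U \<rho>"
    "ops_iso sc V UNIV (Jops d e) (scF sc) (FU U) (Jops (Jind lam sc U \<rho>) shiftE)"
proof -
  obtain lam where lam: "W lam \<noteq> {0}" using weight_exists indec by (auto simp: ops_indecomposable_def)
  obtain C K where C: "wplus_module_fd sc (W lam) C" and K: "wplus_module.supported (W lam) C K"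
    and D: "\<And>j s u. u \<in> W lam \<Longrightarrow> e (- s) (d j s u) = sc (lam j) u + cvec.expand sc (mbox K) (C j) s u"
    using weight_space_rep[OF indec lam] by blast
  interpret C: wplus_module_fd sc "W lam" C by fact
  note span = indecomposable_single_coset[OF indec lam]
  note bij = FU_map_e_bij(1)[OF span] and lin = FU_map_e_bij(2)[OF span]
  have UV: "u \<in> V" if "u \<in> W lam" for u using that W_sub by blast
  have e_U: "clin_on sc (W lam) sc (e m)" for m
    using e_lin W_sub unfolding clin_on_def by blast
  have e_sgl: "FU_map e (sgl m u) = e m u" for m u by (rule C.FU_map_sgl[OF e_U])
  have map_mem: "FU_map e f \<in> V" if "f \<in> FU (W lam)" for f using bij that by (auto simp: bij_betw_def)
  have e_shift: "FU_map e (shiftE m f) = e m (FU_map e f)" if "f \<in> FU (W lam)" for m f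
  proof (rule C.FU_lin_ext[OF clin_on_comp[OF C.shiftE_lin lin] clin_on_comp[OF lin e_lin map_mem] _ that])
    show "FU_map e (shiftE m (sgl k u)) = e m (FU_map e (sgl k u))" if "u \<in> W lam" for k u
      using UV[OF that] by (simp add: e_sgl add.commute)
  qed auto
  have d_map: "FU_map e (C.Jd lam j s f) = d j s (FU_map e f)" if "f \<in> FU (W lam)" for j s f
  proof (rule C.FU_lin_ext[OF clin_on_comp[OF C.Jd_lin lin] clin_on_comp[OF lin d_lin map_mem] _ that])
    fix m u assume u: "u \<in> W lam"
    have uV: "u \<in> V" and DV: "C.Dw j s u \<in> V" using UV u by auto
    have "e s (e (- s) (d j s u)) = e s (sc (lam j) u + C.Dw j s u)"
      unfolding D[OF u] C.Dw_eq[OF K u] ..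
    then have du: "d j s u = e s (sc (lam j) u + C.Dw j s u)" using uV by simp
    have "d j s (e m u) = sc (of_int (m j)) (e (m + s) u) + e (m + s) (sc (lam j) u + C.Dw j s u)"
      unfolding d_e[OF uV] du using uV DV by simp
    also have "\<dots> = e (m + s) (sc (of_int (m j) + lam j) u + C.Dw j s u)"
      using uV DV by (simp add: clin_on_add[OF e_lin] clin_on_scale[OF e_lin] scale_left_add)
    finally show "FU_map e (C.Jd lam j s (sgl m u)) = d j s (FU_map e (sgl m u))"
      unfolding C.Jd_sgl[OF u] e_sgl ..
  qed auto
  have "ops_iso (scF sc) (FU (W lam)) UNIV (Jops (C.Jd lam) shiftE) sc V (Jops d e)"
    unfolding ops_iso_Jops using bij lin e_shift d_map by blast
  then have "ops_iso sc V UNIV (Jops d e) (scF sc) (FU (W lam)) (Jops (C.Jd lam) shiftE)"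
    by (rule ops_iso_sym) (simp_all add: cvec.cvs[OF C.cvec_FU] C.Jops_closed)
  then show thesis using that C by blast
qed

lemma (in jmod) Jops_d_e_closed: "x \<in> V \<Longrightarrow> Jops d e i x \<in> V"
  by (cases i) (auto simp: Jops_def)

section \<open>When two parameter pairs give isomorphic modules\<close>

section \<open>Isomorphisms between the modules \<open>F(T\<^sup>n) \<otimes> U\<close>\<close>

locale wplus_module_pair =
  M: wplus_module_fd sc U \<rho> + M': wplus_module_fd sc' U' \<rho>'
  for sc :: "complex \<Rightarrow> 'u::ab_group_add \<Rightarrow> 'u" and U and \<rho> :: "'n::finite \<Rightarrow> ('n \<Rightarrow> nat) \<Rightarrow> 'u \<Rightarrow> 'u"
    and sc' :: "complex \<Rightarrow> 'w::ab_group_add \<Rightarrow> 'w" and U' and \<rho>' :: "'n \<Rightarrow> ('n \<Rightarrow> nat) \<Rightarrow> 'w \<Rightarrow> 'w"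
begin

lemma common_support: obtains K where "M.supported K" "M'.supported K"
proof -
  obtain K where K: "M.supported K" using M.finite_support[OF M.fd] by blast
  obtain K' where K': "M'.supported K'" using M'.finite_support[OF M'.fd] by blast
  have "mbox K \<subseteq> mbox (max K K')" "mbox K' \<subseteq> mbox (max K K')" for K K' by (simp_all add: mbox_mono)
  then have "M.supported (max K K')" "M'.supported (max K K')"
    using K K' unfolding M.supported_def M'.supported_def by (blast intro: subset_trans)+
  then show thesis by (rule that)
qed

lemma intertwine_Dw:
  assumes h: "clin_on sc U sc' h" "\<And>u. u \<in> U \<Longrightarrow> h u \<in> U'"
    and rho: "\<And>j \<alpha> u. \<alpha> \<noteq> 0 \<Longrightarrow> u \<in> U \<Longrightarrow> h (\<rho> j \<alpha> u) = \<rho>' j \<alpha> (h u)" and u: "u \<in> U"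
  shows "h (M.Dw j s u) = M'.Dw j s (h u)"
proof -
  obtain K where K: "M.supported K" "M'.supported K" by (rule common_support)
  have "h (M.Dw j s u) = (\<Sum>\<alpha>\<in>mbox K. sc' (mono s \<alpha> / mfact \<alpha>) (h (\<rho> j \<alpha> u)))"
    unfolding M.Dw_eq[OF K(1) u] M.expand_def
    by (rule M.clin_on_lincomb[OF h(1)]) (use u in \<open>auto dest: mbox_nonzero\<close>)
  also have "\<dots> = M'.Dw j s (h u)"
    unfolding M'.Dw_eq[OF K(2) h(2)[OF u]] M'.expand_def
    by (intro sum.cong refl) (use u rho in \<open>auto dest: mbox_nonzero\<close>)
  finally show ?thesis .
qed

text \<open>The converse of \<open>intertwine_Dw\<close>, by comparing coefficients in s over a
  common box.\<close>

lemma intertwine_rho: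
  assumes h: "clin_on sc U sc' h" "\<And>u. u \<in> U \<Longrightarrow> h u \<in> U'"
    and Dw: "\<And>j s u. u \<in> U \<Longrightarrow> h (M.Dw j s u) = M'.Dw j s (h u)" and a: "\<alpha> \<noteq> 0" and u: "u \<in> U"
  shows "h (\<rho> j \<alpha> u) = \<rho>' j \<alpha> (h u)"
proof -
  obtain K where K: "M.supported K" "M'.supported K" by (rule common_support)
  show ?thesis
  proof (cases "\<alpha> \<in> mbox K")
    case False
    then show ?thesis
      using M.supportedD[OF K(1) a False u] M'.supportedD[OF K(2) a False h(2)[OF u]] M.clin_on_zero[OF h(1)]
      by simp
  next
    case True
    show ?thesis
    proof (rule M'.expansion_unique[where A = "mbox K" and R = "\<lambda>\<alpha>. h (\<rho> j \<alpha> u)" and R' = "\<lambda>\<alpha>. \<rho>' j \<alpha> (h u)",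
          OF finite_mbox _ _ _ True])
      fix s
      have "(\<Sum>\<alpha>\<in>mbox K. sc' (mono s \<alpha> / mfact \<alpha>) (h (\<rho> j \<alpha> u))) = h (M.Dw j s u)"
        unfolding M.Dw_eq[OF K(1) u] M.expand_def
        by (rule M.clin_on_lincomb[OF h(1), symmetric]) (use u in \<open>auto dest: mbox_nonzero\<close>)
      also have "\<dots> = (\<Sum>\<alpha>\<in>mbox K. sc' (mono s \<alpha> / mfact \<alpha>) (\<rho>' j \<alpha> (h u)))"
        unfolding Dw[OF u] M'.Dw_eq[OF K(2) h(2)[OF u]] M'.expand_def ..
      finally show "(\<Sum>\<alpha>\<in>mbox K. sc' (mono s \<alpha> / mfact \<alpha>) (h (\<rho> j \<alpha> u)))
        = (\<Sum>\<alpha>\<in>mbox K. sc' (mono s \<alpha> / mfact \<alpha>) (\<rho>' j \<alpha> (h u)))" .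
    qed (use h(2) u in \<open>auto dest: mbox_nonzero\<close>)
  qed
qed

lemma iso_if:
  assumes lat: "lat_equiv lam lam'" and iso: "ops_iso sc U Wp_idx (Wp_ops \<rho>) sc' U' (Wp_ops \<rho>')"
  shows "ops_iso (scF sc) (FU U) UNIV (Jops (M.Jd lam) shiftE) (scF sc') (FU U') (Jops (M'.Jd lam') shiftE)"
proof -
  obtain k :: "'n \<Rightarrow> int" where k: "\<And>i. lam i - lam' i = of_int (k i)" using lat by (auto simp: lat_equiv_def)
  obtain h where h: "bij_betw h U U'" "clin_on sc U sc' h"
    and rho: "\<And>j \<alpha> u. \<alpha> \<noteq> 0 \<Longrightarrow> u \<in> U \<Longrightarrow> h (\<rho> j \<alpha> u) = \<rho>' j \<alpha> (h u)"
    using iso unfolding ops_iso_Wp by blast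
  have hU: "h u \<in> U'" if "u \<in> U" for u using bij_betwE[OF h(1)] that by blast
  have hDw: "h (M.Dw j s u) = M'.Dw j s (h u)" if "u \<in> U" for j s u
    by (rule intertwine_Dw) (use h hU rho that in auto)
  have h0: "h 0 = 0" by (rule M.clin_on_zero[OF h(2)])
  have h0_iff: "h u = 0 \<longleftrightarrow> u = 0" if "u \<in> U" for u
    using inj_onD[OF bij_betw_imp_inj_on[OF h(1)], of u 0] that h0 by auto
  \<comment> \<open>This is e_m \<otimes> u \<mapsto> e_(m+k) \<otimes> h(u). The degree shift k
    compensates for \<lambda> - \<lambda>', so weights are preserved.\<close>
  let ?f = "\<lambda>g p. h (g (p - k))"
  let ?g = "\<lambda>g p. inv_into U h (g (p + k))"
  have inv: "inv_into U h v \<in> U" "h (inv_into U h v) = v" if "v \<in> U'" for v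
    using h(1) that by (auto simp: bij_betw_def inv_into_into f_inv_into_f)
  have inv_h: "inv_into U h (h u) = u" if "u \<in> U" for u
    using h(1) that by (auto simp: bij_betw_def inv_into_f_f)
  have inv0: "inv_into U h 0 = 0" using inv_h[of 0] h0 by simp
  have f_FU: "?f g \<in> FU U'" if g: "g \<in> FU U" for g
  proof -
    have "{p. h (g (p - k)) \<noteq> 0} \<subseteq> {p. g (p - k) \<noteq> 0}" using h0 by auto
    then have "finite {p. h (g (p - k)) \<noteq> 0}"
      by (rule finite_subset) (rule finite_shift_support[OF M.FU_D(2)[OF g]])
    then show ?thesis using hU M.FU_D(1)[OF g] by (simp add: FU_def)
  qed
  have g_FU: "?g g \<in> FU U" if g: "g \<in> FU U'" for g
  proof -
    have "{p. inv_into U h (g (p + k)) \<noteq> 0} \<subseteq> {p. g (p - (- k)) \<noteq> 0}" using inv0 by auto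
    then have "finite {p. inv_into U h (g (p + k)) \<noteq> 0}"
      by (rule finite_subset) (rule finite_shift_support[OF M'.FU_D(2)[OF g]])
    then show ?thesis using inv M'.FU_D(1)[OF g] by (simp add: FU_def)
  qed
  have "bij_betw ?f (FU U) (FU U')"
  proof (rule bij_betw_byWitness[where f' = ?g])
    show "\<forall>g\<in>FU U. ?g (?f g) = g" by (auto simp: inv_h M.FU_D)
    show "\<forall>g\<in>FU U'. ?f (?g g) = g" by (auto simp: inv M'.FU_D)
  qed (use f_FU g_FU in auto)
  moreover have "clin_on (scF sc) (FU U) (scF sc') ?f"
    unfolding clin_on_def
    by (auto simp: fun_eq_iff scF_def M.FU_D M.clin_on_add[OF h(2)] M.clin_on_scale[OF h(2)])
  moreover have "?f (M.Jd lam j s g) = M'.Jd lam' j s (?f g)" if g: "g \<in> FU U" for j s g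
  proof
    fix p
    define q where "q = p - s - k"
    have q: "p - k - s = q" "p - s - k = q" by (simp_all add: q_def diff_diff_eq add.commute)
    have lam: "lam j = lam' j + of_int (k j)" using k[of j] by (simp add: algebra_simps)
    have coeff: "complex_of_int (q j) + lam j = of_int ((p - s) j) + lam' j"
      by (simp add: q_def lam)
    have gq: "g q \<in> U" using M.FU_D(1)[OF g] .
    have "h (sc (of_int ((p - s) j) + lam' j) (g q) + M.Dw j s (g q))
      = sc' (of_int ((p - s) j) + lam' j) (h (g q)) + M'.Dw j s (h (g q))"
      using gq hDw
      by (simp only: M.clin_on_add[OF h(2)] M.clin_on_scale[OF h(2)] M.scale_mem M.Dw_mem)
    then show "h (M.Jd lam j s g (p - k)) = M'.Jd lam' j s (?f g) p"
      by (simp only: M.Jind_Dw M'.Jind_Dw coeff q)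
  qed
  moreover have "?f (shiftE m g) = shiftE m (?f g)" for m g
    by (simp add: shiftE_def fun_eq_iff diff_diff_eq add.commute)
  ultimately show ?thesis unfolding ops_iso_Jops by (intro exI[of _ ?f]) blast
qed

lemma (in wplus_module_fd) weight_vector_support:
  assumes f: "f \<in> FU U" and eig: "\<And>j. Jd lam j 0 f = scF sc (c j) f" and m: "f m \<noteq> 0"
  shows "c j = of_int (m j) + lam j"
proof -
  have fm: "f m \<in> U" using FU_D(1)[OF f] .
  have "sc (of_int (m j) + lam j) (f m) = sc (c j) (f m)"
    using fun_cong[OF eig[of j], of m] fm by (simp add: Jind_Dw scF_def)
  then have "sc (of_int (m j) + lam j - c j) (f m) = 0"
    using fm by (simp only: scale_left_diff) simp
  then show ?thesis using scale_eq_0D[OF fm] m by fastforce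
qed

text \<open>An isomorphism preserves weights, so it carries degree 0, of weight \<lambda>, into the
  only degree k with k + \<lambda>' = \<lambda>. Since it commutes with shifts, it is determined by
  the map \<open>h\<close> between these two copies of U and U'.\<close>

lemma iso_only_if:
  assumes U: "U \<noteq> {0}"
    and iso: "ops_iso (scF sc) (FU U) UNIV (Jops (M.Jd lam) shiftE) (scF sc') (FU U') (Jops (M'.Jd lam') shiftE)"
  shows "lat_equiv lam lam' \<and> ops_iso sc U Wp_idx (Wp_ops \<rho>) sc' U' (Wp_ops \<rho>')"
proof -
  interpret F: cvec "scF sc" "FU U :: (('n \<Rightarrow> int) \<Rightarrow> 'u) set" by (rule M.cvec_FU)
  obtain f where bij: "bij_betw f (FU U) (FU U')" and lin: "clin_on (scF sc) (FU U) (scF sc') f"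
    and fd: "\<And>j s x. x \<in> FU U \<Longrightarrow> f (M.Jd lam j s x) = M'.Jd lam' j s (f x)"
    and fe: "\<And>m x. x \<in> FU U \<Longrightarrow> f (shiftE m x) = shiftE m (f x)"
    using iso unfolding ops_iso_Jops by blast
  have fF: "f x \<in> FU U'" if "x \<in> FU U" for x using bij_betwE[OF bij] that by blast
  have f_inj: "x = y" if "x \<in> FU U" "y \<in> FU U" "f x = f y" for x y
    using inj_onD[OF bij_betw_imp_inj_on[OF bij]] that by blast
  have f0: "f 0 = 0" by (rule F.clin_on_zero[OF lin])
  have eig: "M'.Jd lam' j 0 (f (sgl 0 u)) = scF sc' (lam j) (f (sgl 0 u))" if "u \<in> U" for j u
    using fd[of "sgl 0 u" j 0] that by (simp add: M.Jd_0_sgl F.clin_on_scale[OF lin])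
  have supp: "lam j = of_int (m j) + lam' j" if u: "u \<in> U" and "f (sgl 0 u) m \<noteq> 0" for u m j
    by (rule M'.weight_vector_support[OF fF[OF M.sgl_FU[OF u]] eig[OF u]]) fact
  \<comment> \<open>A nonzero vector has a nonzero image, and any degree occurring in that image
    serves as k.\<close>
  obtain u where u: "u \<in> U" "u \<noteq> 0" using U M.zero_mem by blast
  have "f (sgl 0 u) \<noteq> 0"
    using f_inj[of "sgl 0 u" 0] u f0 F.zero_mem M.sgl_FU[OF u(1)] sgl_eq_iff[of 0 u 0] by (metis sgl_zero)
  then obtain k where "f (sgl 0 u) k \<noteq> 0" by (auto simp: fun_eq_iff)
  from supp[OF u(1) this] have lam: "lam j = of_int (k j) + lam' j" for j .
  then have lat: "lat_equiv lam lam'" by (auto simp: lat_equiv_def)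
  define h where "h u = f (sgl 0 u) k" for u
  have hU: "h u \<in> U'" if "u \<in> U" for u
    unfolding h_def by (rule M'.FU_D(1)[OF fF[OF M.sgl_FU[OF that]]])
  have f_sgl0: "f (sgl 0 u) = sgl k (h u)" if u: "u \<in> U" for u
  proof
    fix m
    show "f (sgl 0 u) m = sgl k (h u) m"
    proof (cases "m = k")
      case False
      have "f (sgl 0 u) m = 0"
      proof (rule ccontr)
        assume "f (sgl 0 u) m \<noteq> 0"
        from supp[OF u this] lam have "m = k" by (auto simp: fun_eq_iff)
        then show False using False by simp
      qed
      then show ?thesis using False by (simp add: sgl_def)
    qed (simp add: sgl_def h_def)
  qed
  have f_sgl: "f (sgl m u) = sgl (k + m) (h u)" if u: "u \<in> U" for m u
    using fe[of "sgl 0 u" m] u by (simp add: f_sgl0)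
  have h_lin: "clin_on sc U sc' h"
    unfolding clin_on_def h_def
  proof (intro conjI allI ballI)
    fix c u assume "u \<in> U"
    then have "f (sgl 0 (sc c u)) = scF sc' c (f (sgl 0 u))"
      by (simp only: M.scF_sgl[symmetric] F.clin_on_scale[OF lin] M.sgl_FU)
    then show "f (sgl 0 (sc c u)) k = sc' c (f (sgl 0 u) k)" by (simp add: scF_def)
  qed (simp add: sgl_add F.clin_on_add[OF lin])
  have h_inj: "inj_on h U"
  proof (rule inj_onI)
    fix u v assume uv: "u \<in> U" "v \<in> U" "h u = h v"
    then have "f (sgl 0 u) = f (sgl 0 v)" by (simp add: f_sgl0)
    then have "sgl (0 :: 'n \<Rightarrow> int) u = sgl 0 v" using uv by (intro f_inj) auto
    then show "u = v" by simp
  qed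
  have h_surj: "\<exists>u\<in>U. h u = v" if v: "v \<in> U'" for v
  proof -
    have "sgl k v \<in> f ` FU U" using v unfolding bij_betw_imp_surj_on[OF bij] by simp
    then obtain g where g: "g \<in> FU U" "f g = sgl k v" by (metis imageE)
    \<comment> \<open>The preimage of a vector of degree k has weight \<lambda> and hence lives in
      degree 0.\<close>
    have "M.Jd lam j 0 g = scF sc (lam j) g" for j
    proof (rule f_inj)
      show "f (M.Jd lam j 0 g) = f (scF sc (lam j) g)"
        using g v by (simp add: fd F.clin_on_scale[OF lin] M'.Jd_0_sgl lam)
    qed (use g F.scale_mem in auto)
    from M.weight_vector_support[OF g(1) this] have "m = 0" if "g m \<noteq> 0" for m
      using that by (auto simp: fun_eq_iff)
    then have "g p = 0" if "p \<noteq> 0" for p using that by blast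
    then have "g = sgl 0 (g 0)" by (intro ext) (simp add: sgl_def)
    then have "sgl k v = sgl k (h (g 0))" using g(2) f_sgl0[OF M.FU_D(1)[OF g(1)], of 0] by metis
    then show ?thesis using M.FU_D(1)[OF g(1)] by auto
  qed
  have h_Dw: "h (M.Dw j s u) = M'.Dw j s (h u)" if u: "u \<in> U" for j s u
  proof -
    have "f (M.Jd lam j s (sgl 0 u)) = sgl (k + s) (h (sc (lam j) u + M.Dw j s u))"
      using u by (simp add: M.Jd_sgl f_sgl)
    moreover have "f (M.Jd lam j s (sgl 0 u)) = sgl (k + s) (sc' (lam j) (h u) + M'.Dw j s (h u))"
      using u by (simp add: fd f_sgl0 M'.Jd_sgl hU lam)
    ultimately have "h (sc (lam j) u + M.Dw j s u) = sc' (lam j) (h u) + M'.Dw j s (h u)" by simp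
    then show ?thesis using u by (simp add: M.clin_on_add[OF h_lin] M.clin_on_scale[OF h_lin])
  qed
  have "bij_betw h U U'"
    using h_inj h_surj hU by (auto simp: bij_betw_def)
  moreover have "h (\<rho> j \<alpha> u) = \<rho>' j \<alpha> (h u)" if "\<alpha> \<noteq> 0" "u \<in> U" for j \<alpha> u
    by (rule intertwine_rho) (use h_lin hU h_Dw that in auto)
  ultimately have "ops_iso sc U Wp_idx (Wp_ops \<rho>) sc' U' (Wp_ops \<rho>')"
    unfolding ops_iso_Wp using h_lin by blast
  then show ?thesis using lat by blast
qed

end

section \<open>Descent from W_n^+ to gl_n in the irreducible case\<close>

section \<open>Irreducible modules and \<open>gl_n\<close>\<close>

lemma eps_inject [simp]: "eps p = (eps q :: 'n \<Rightarrow> nat) \<longleftrightarrow> p = q"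
  by (auto simp: eps_def fun_eq_iff split: if_splits)

lemma sum_eps [simp]: "sum (eps p) UNIV = (1 :: nat)" for p :: "'n::finite"
  by (simp add: eps_def)

lemma sum_pos_index: "\<alpha> \<noteq> 0 \<Longrightarrow> 0 < sum \<alpha> UNIV" for \<alpha> :: "'n::finite \<Rightarrow> nat"
  by (auto simp: fun_eq_iff intro!: Nat.gr0I)

lemma sum_eq_1_iff: "sum \<alpha> UNIV = 1 \<longleftrightarrow> (\<exists>p. \<alpha> = eps p)" for \<alpha> :: "'n::finite \<Rightarrow> nat"
proof
  assume 1: "sum \<alpha> UNIV = 1"
  then obtain p where p: "\<alpha> p \<noteq> 0" by fastforce
  have "sum \<alpha> UNIV = \<alpha> p + sum \<alpha> (UNIV - {p})" by (rule sum.remove) auto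
  then have "\<alpha> p = 1" "sum \<alpha> (UNIV - {p}) = 0" using 1 p by linarith+
  then have "\<alpha> i = eps p i" for i by (cases "i = p") (auto simp: eps_def)
  then show "\<exists>p. \<alpha> = eps p" by blast
qed auto

text \<open>As \<beta>_j \<noteq> 0, the subtraction of \<epsilon>_j is not truncated.\<close>

lemma sum_shift_index:
  fixes \<alpha> \<beta> :: "'n::finite \<Rightarrow> nat"
  assumes "\<beta> j \<noteq> 0"
  shows "sum (\<alpha> + \<beta> - eps j) UNIV + 1 = sum \<alpha> UNIV + sum \<beta> UNIV"
proof -
  have "sum (\<alpha> + \<beta> - eps j) UNIV + sum (eps j) UNIV = (\<Sum>i\<in>UNIV. (\<alpha> + \<beta> - eps j) i + eps j i)"
    by (simp only: sum.distrib)
  also have "\<dots> = (\<Sum>i\<in>UNIV. \<alpha> i + \<beta> i)"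
    using assms by (intro sum.cong) (auto simp: eps_def)
  finally show ?thesis by (simp add: sum.distrib)
qed

text \<open>The pullback of a gl_n-module along the quotient map W_n^+ -> gl_n that sends z_p
  \<partial>/\<partial>z_j to E^p_j and all z^\<alpha> \<partial>/\<partial>z_j with |\<alpha>|
  \<ge> 2 to zero.\<close>

definition gl_wplus :: "('n \<Rightarrow> 'n \<Rightarrow> 'u \<Rightarrow> 'u::zero) \<Rightarrow> 'n \<Rightarrow> ('n \<Rightarrow> nat) \<Rightarrow> 'u \<Rightarrow> 'u" where
  "gl_wplus g j \<alpha> = (if \<exists>p. \<alpha> = eps p then g (THE p. \<alpha> = eps p) j else (\<lambda>_. 0))"

lemma gl_wplus_eps [simp]: "gl_wplus g j (eps p) = g p j"
  by (simp add: gl_wplus_def)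

lemma gl_wplus_other: "(\<And>p. \<alpha> \<noteq> eps p) \<Longrightarrow> gl_wplus g j \<alpha> u = 0"
  by (simp add: gl_wplus_def)

locale gl_module = cvec sc U for sc :: "complex \<Rightarrow> 'u::ab_group_add \<Rightarrow> 'u" and U +
  fixes g :: "'n::finite \<Rightarrow> 'n \<Rightarrow> 'u \<Rightarrow> 'u"
  assumes gl: "gl_rep sc U g"
begin

lemma g_mem [simp]: "u \<in> U \<Longrightarrow> g p q u \<in> U"
  and g_lin: "clin_on sc U sc (g p q)"
  and g_comm: "u \<in> U \<Longrightarrow> g p q (g r s u) - g r s (g p q u)
          = (if q = r then g p s u else 0) - (if s = p then g r q u else 0)"
  using gl unfolding gl_rep_def by auto

lemma gl_wplus_mem [simp]: "u \<in> U \<Longrightarrow> gl_wplus g j \<alpha> u \<in> U"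
  by (auto simp: gl_wplus_def)

lemma gl_wplus_lin: "clin_on sc U sc (gl_wplus g j \<alpha>)"
  using g_lin by (auto simp: gl_wplus_def clin_on_def)

lemma g_zero [simp]: "g p q 0 = 0"
  by (rule clin_on_zero[OF g_lin])

lemma gl_wplus_zero [simp]: "gl_wplus g j \<alpha> 0 = 0"
  by (rule clin_on_zero[OF gl_wplus_lin])

text \<open>The exponent in the bracket has total degree |\<alpha>| + |\<beta>| - 1, which is 1 only
  when |\<alpha>| + |\<beta>| = 2.\<close>

lemma gl_wplus_shift_zero:
  assumes a: "\<alpha> \<noteq> 0" "\<beta> \<noteq> 0" and u: "u \<in> U"
    and deg: "sum \<alpha> UNIV + sum \<beta> UNIV \<noteq> 2"
  shows "sc (of_nat (\<beta> j)) (gl_wplus g k (\<alpha> + \<beta> - eps j) u) = 0"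
proof (cases "\<beta> j = 0")
  case False
  have "\<alpha> + \<beta> - eps j \<noteq> eps p" for p
  proof
    assume "\<alpha> + \<beta> - eps j = eps p"
    then have "sum (\<alpha> + \<beta> - eps j) UNIV = 1" by simp
    then show False using sum_shift_index[of \<beta> j \<alpha>] False deg by simp
  qed
  then show ?thesis by (simp add: gl_wplus_other)
qed (use u in simp)

lemma gl_wplus_rep: "Wplus_rep sc U (gl_wplus g)"
  unfolding Wplus_rep_def
proof (intro conjI allI impI ballI cvs gl_wplus_lin gl_wplus_mem)
  fix j k :: 'n and \<alpha> \<beta> :: "'n \<Rightarrow> nat" and u
  assume ab: "\<alpha> \<noteq> 0" "\<beta> \<noteq> 0" and u: "u \<in> U"
  show "gl_wplus g j \<alpha> (gl_wplus g k \<beta> u) - gl_wplus g k \<beta> (gl_wplus g j \<alpha> u)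
    = sc (of_nat (\<beta> j)) (gl_wplus g k (\<alpha> + \<beta> - eps j) u) - sc (of_nat (\<alpha> k)) (gl_wplus g j (\<alpha> + \<beta> - eps k) u)"
  proof (cases "sum \<alpha> UNIV = 1 \<and> sum \<beta> UNIV = 1")
    case True
    then obtain p r where p: "\<alpha> = eps p" and r: "\<beta> = eps r" using sum_eq_1_iff by metis
    have "sc (of_nat (eps r j)) (gl_wplus g k (eps p + eps r - eps j) u) = (if j = r then g p k u else 0)"
      using u by (auto simp: eps_def[of r])
    moreover have "sc (of_nat (eps p k)) (gl_wplus g j (eps p + eps r - eps k) u) = (if k = p then g r j u else 0)"
      using u by (auto simp: eps_def[of p])
    ultimately show ?thesis unfolding p r using g_comm[OF u, of p j r k] by simp
  next
    case False
    have "sum \<alpha> UNIV + sum \<beta> UNIV \<noteq> 2"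
      using False sum_pos_index[OF ab(1)] sum_pos_index[OF ab(2)] by arith
    then have "sc (of_nat (\<beta> j)) (gl_wplus g k (\<alpha> + \<beta> - eps j) u) = 0"
      "sc (of_nat (\<alpha> k)) (gl_wplus g j (\<alpha> + \<beta> - eps k) u) = 0"
      using gl_wplus_shift_zero[OF ab u] gl_wplus_shift_zero[OF ab(2,1) u] by (simp_all add: add.commute)
    moreover have "gl_wplus g j \<alpha> (gl_wplus g k \<beta> u) = 0 \<and> gl_wplus g k \<beta> (gl_wplus g j \<alpha> u) = 0"
    proof -
      have "(\<forall>p. \<alpha> \<noteq> eps p) \<or> (\<forall>p. \<beta> \<noteq> eps p)" using False sum_eq_1_iff by metis
      then show ?thesis by (auto simp: gl_wplus_other)
    qed
    ultimately show ?thesis by simp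
  qed
qed

lemma gl_wplus_ops_sub: "ops_sub sc U Wp_idx (Wp_ops (gl_wplus g)) A \<longleftrightarrow> ops_sub sc U UNIV (gl_ops g) A"
proof -
  have "(\<forall>j \<alpha>. \<alpha> \<noteq> 0 \<longrightarrow> (\<forall>x\<in>A. gl_wplus g j \<alpha> x \<in> A)) \<longleftrightarrow> (\<forall>p q. \<forall>x\<in>A. g p q x \<in> A)" if "cvs sc A"
  proof
    assume *: "\<forall>p q. \<forall>x\<in>A. g p q x \<in> A"
    have "0 \<in> A" using that by (simp add: cvs_def)
    then show "\<forall>j \<alpha>. \<alpha> \<noteq> 0 \<longrightarrow> (\<forall>x\<in>A. gl_wplus g j \<alpha> x \<in> A)"
      using * by (auto simp: gl_wplus_def)
  next
    assume *: "\<forall>j \<alpha>. \<alpha> \<noteq> 0 \<longrightarrow> (\<forall>x\<in>A. gl_wplus g j \<alpha> x \<in> A)"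
    show "\<forall>p q. \<forall>x\<in>A. g p q x \<in> A"
      using *[rule_format, of "eps _"] by simp
  qed
  then show ?thesis unfolding ops_sub_Wp by (auto simp: ops_sub_def gl_ops_def)
qed

lemma gl_wplus_irreducible:
  "ops_irreducible sc U Wp_idx (Wp_ops (gl_wplus g)) \<longleftrightarrow> ops_irreducible sc U UNIV (gl_ops g)"
  by (simp add: ops_irreducible_def gl_wplus_ops_sub)

text \<open>The only exponents in the support are the \<epsilon>_p, for which s^(\<epsilon>_p) = s_p
  and the factorial is 1.\<close>

lemma Jgl_eq:
  assumes f: "f \<in> FU U"
  shows "Jgl lam sc g j s f = Jind lam sc U (gl_wplus g) j s f"
proof
  fix k
  let ?x = "f (k - s)"
  have x: "?x \<in> U" by (rule FU_D(1)[OF f])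
  have mono_eps: "mono s (eps p) = of_int (s p)" for p
  proof -
    have "mono s (eps p) = (\<Prod>i\<in>UNIV. if i = p then of_int (s p) else 1)"
      unfolding mono_def by (intro prod.cong) (auto simp: eps_def)
    then show ?thesis by simp
  qed
  have mfact_eps: "mfact (eps p) = 1" for p :: 'n
    unfolding mfact_def by (intro prod.neutral) (auto simp: eps_def)
  have "(\<Sum>\<beta>\<in>Wp_supp U (gl_wplus g) j. sc (mono s \<beta> / mfact \<beta>) (gl_wplus g j \<beta> ?x))
    = (\<Sum>\<beta>\<in>range eps. sc (mono s \<beta> / mfact \<beta>) (gl_wplus g j \<beta> ?x))"
  proof (rule sum.mono_neutral_left)
    show "Wp_supp U (gl_wplus g) j \<subseteq> range eps" by (auto simp: Wp_supp_def gl_wplus_def split: if_splits)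
    have "gl_wplus g j \<beta> ?x = 0" if "\<beta> \<in> range eps - Wp_supp U (gl_wplus g) j" for \<beta>
    proof -
      have "\<beta> \<noteq> 0" using that by auto
      then show ?thesis using that x unfolding Wp_supp_def by blast
    qed
    then show "\<forall>\<beta>\<in>range eps - Wp_supp U (gl_wplus g) j. sc (mono s \<beta> / mfact \<beta>) (gl_wplus g j \<beta> ?x) = 0"
      by simp
  qed simp
  also have "\<dots> = (\<Sum>p\<in>UNIV. sc (of_int (s p)) (g p j ?x))"
    by (subst sum.reindex) (simp_all add: inj_on_def mono_eps mfact_eps)
  finally show "Jgl lam sc g j s f k = Jind lam sc U (gl_wplus g) j s f k"
    by (simp add: Jgl_def Jind_def)
qed

end

lemma gl_wplus_iso:
  assumes "gl_module sc U g" "gl_module sc' U' g'"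
  shows "ops_iso sc U Wp_idx (Wp_ops (gl_wplus g)) sc' U' (Wp_ops (gl_wplus g'))
    \<longleftrightarrow> ops_iso sc U UNIV (gl_ops g) sc' U' (gl_ops g')"
proof -
  interpret M: gl_module sc U g by fact
  interpret M': gl_module sc' U' g' by fact
  have "(\<forall>j \<alpha>. \<alpha> \<noteq> 0 \<longrightarrow> (\<forall>x\<in>U. f (gl_wplus g j \<alpha> x) = gl_wplus g' j \<alpha> (f x)))
    \<longleftrightarrow> (\<forall>p q. \<forall>x\<in>U. f (g p q x) = g' p q (f x))" if "clin_on sc U sc' f" for f
  proof
    assume *: "\<forall>p q. \<forall>x\<in>U. f (g p q x) = g' p q (f x)"
    then show "\<forall>j \<alpha>. \<alpha> \<noteq> 0 \<longrightarrow> (\<forall>x\<in>U. f (gl_wplus g j \<alpha> x) = gl_wplus g' j \<alpha> (f x))"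
      using M.clin_on_zero[OF that] by (auto simp: gl_wplus_def)
  next
    assume *: "\<forall>j \<alpha>. \<alpha> \<noteq> 0 \<longrightarrow> (\<forall>x\<in>U. f (gl_wplus g j \<alpha> x) = gl_wplus g' j \<alpha> (f x))"
    show "\<forall>p q. \<forall>x\<in>U. f (g p q x) = g' p q (f x)"
      using *[rule_format, of "eps _"] by simp
  qed
  then have "(bij_betw f U U' \<and> clin_on sc U sc' f
      \<and> (\<forall>j \<alpha>. \<alpha> \<noteq> 0 \<longrightarrow> (\<forall>x\<in>U. f (gl_wplus g j \<alpha> x) = gl_wplus g' j \<alpha> (f x))))
    \<longleftrightarrow> (bij_betw f U U' \<and> clin_on sc U sc' f \<and> (\<forall>p q. \<forall>x\<in>U. f (g p q x) = g' p q (f x)))" for f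
    by blast
  then show ?thesis by (simp add: ops_iso_Wp ops_iso_def[of _ _ UNIV] gl_ops_def)
qed

subsection \<open>Irreducible \<open>W_n\<^sup>+\<close>-modules\<close>

context wplus_module_fd
begin

text \<open>Operators of positive degree raise the eigenvalue of \<open>ad euler\<close>, so long words in them vanish.\<close>

lemma singular_vector:
  assumes "U \<noteq> {0}"
  shows "\<exists>u\<in>U. u \<noteq> 0 \<and> (\<forall>j \<alpha>. 2 \<le> sum \<alpha> UNIV \<longrightarrow> \<rho> j \<alpha> u = 0)"
proof (rule ccontr)
  assume none: "\<not> ?thesis"
  have step: "\<exists>j \<alpha>. 2 \<le> sum \<alpha> UNIV \<and> \<rho> j \<alpha> u \<noteq> 0" if "u \<in> U" "u \<noteq> 0" for u
    using none that by blast
  obtain N :: nat where N: "\<And>a X. N \<le> a \<Longrightarrow> (\<And>x. x \<in> U \<Longrightarrow> X x \<in> U) \<Longrightarrow> clin_on sc U sc X \<Longrightarrow>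
      (\<And>x. x \<in> U \<Longrightarrow> euler (X x) - X (euler x) = sc (of_nat a) (X x)) \<Longrightarrow> \<forall>x\<in>U. X x = 0"
    using euler_eigen_vanish[OF fd] by blast
  obtain u0 where u0: "u0 \<in> U" "u0 \<noteq> 0" using assms zero_mem by blast
  \<comment> \<open>\<open>X\<close> is a product of n operators of positive degree that does not
    kill \<open>u0\<close>, and \<open>a\<close> is its total degree. Another factor can always be
    put in front, which contradicts the bound N.\<close>
  have "\<exists>X a. n \<le> a \<and> (\<forall>x\<in>U. X x \<in> U) \<and> clin_on sc U sc X
      \<and> (\<forall>x\<in>U. euler (X x) - X (euler x) = sc (of_nat a) (X x)) \<and> X u0 \<noteq> 0" for n :: nat
  proof (induction n)
    case 0
    show ?case using u0 by (intro exI[of _ "\<lambda>x. x"] exI[of _ 0]) (auto simp: clin_on_def)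
  next
    case (Suc n)
    then obtain X a where X: "n \<le> a" "\<And>x. x \<in> U \<Longrightarrow> X x \<in> U" "clin_on sc U sc X"
      "\<And>x. x \<in> U \<Longrightarrow> euler (X x) - X (euler x) = sc (of_nat a) (X x)" "X u0 \<noteq> 0" by blast
    obtain j \<alpha> where ja: "2 \<le> sum \<alpha> UNIV" "\<rho> j \<alpha> (X u0) \<noteq> 0" using step X(2)[OF u0(1)] X(5) by blast
    have a0: "\<alpha> \<noteq> 0" using ja(1) by auto
    let ?b = "sum \<alpha> UNIV - 1"
    have "euler (\<rho> j \<alpha> (X x)) - \<rho> j \<alpha> (X (euler x)) = sc (of_nat (?b + a)) (\<rho> j \<alpha> (X x))" if x: "x \<in> U" for x
    proof -
      have "\<rho> j \<alpha> (euler (X x)) - \<rho> j \<alpha> (X (euler x)) = sc (of_nat a) (\<rho> j \<alpha> (X x))"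
        using x X(2) X(4)[OF x]
        by (simp add: clin_on_diff[OF rho_lin[OF a0], symmetric] clin_on_scale[OF rho_lin[OF a0]])
      moreover have "euler (\<rho> j \<alpha> (X x)) - \<rho> j \<alpha> (euler (X x)) = sc (of_nat ?b) (\<rho> j \<alpha> (X x))"
        by (rule euler_comm[OF a0 X(2)[OF x]])
      ultimately have "euler (\<rho> j \<alpha> (X x)) - \<rho> j \<alpha> (X (euler x))
        = sc (of_nat ?b) (\<rho> j \<alpha> (X x)) + sc (of_nat a) (\<rho> j \<alpha> (X x))"
        by (simp add: algebra_simps)
      also have "\<dots> = sc (of_nat (?b + a)) (\<rho> j \<alpha> (X x))"
        unfolding of_nat_add by (rule scale_left_add[symmetric]) (use x X a0 in simp)
      finally show ?thesis .
    qed
    moreover have "clin_on sc U sc (\<lambda>x. \<rho> j \<alpha> (X x))"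
      by (rule clin_on_comp[OF X(3) rho_lin[OF a0] X(2)])
    moreover have "Suc n \<le> ?b + a" using X(1) ja(1) by simp
    moreover have "\<forall>x\<in>U. \<rho> j \<alpha> (X x) \<in> U" using X(2) a0 by simp
    ultimately show ?case using ja(2) by (intro exI[of _ "\<lambda>x. \<rho> j \<alpha> (X x)"] exI[of _ "?b + a"]) blast
  qed
  from this[of N] obtain X a where X: "N \<le> a" "\<forall>x\<in>U. X x \<in> U" "clin_on sc U sc X"
      "\<forall>x\<in>U. euler (X x) - X (euler x) = sc (of_nat a) (X x)" "X u0 \<noteq> 0" by blast
  from X(2,4) have "\<forall>x\<in>U. X x = 0" by (intro N[OF X(1) _ X(3)]) blast+
  then show False using X(5) u0(1) by blast
qed

text \<open>The fields z^\<alpha> \<partial>/\<partial>z_j with |\<alpha>| \<ge> 2 span an ideal of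
  W_n^+, so the vectors killed by them are stable. There are nonzero ones by
  \<open>singular_vector\<close>, and irreducibility leaves only the whole space.\<close>

lemma irreducible_higher_zero:
  assumes irr: "ops_irreducible sc U Wp_idx (Wp_ops \<rho>)" and deg: "2 \<le> sum \<alpha> UNIV" and u: "u \<in> U"
  shows "\<rho> j \<alpha> u = 0"
proof -
  define A where "A = {u\<in>U. \<forall>j \<alpha>. 2 \<le> sum \<alpha> UNIV \<longrightarrow> \<rho> j \<alpha> u = 0}"
  have nz: "\<alpha> \<noteq> 0" if "2 \<le> sum \<alpha> UNIV" for \<alpha> :: "'n \<Rightarrow> nat" using that by auto
  have AU: "A \<subseteq> U" by (auto simp: A_def)
  have A: "cvs sc A"
    by (rule cvs_subset[OF AU])
      (auto simp: A_def nz clin_on_zero[OF rho_lin] clin_on_add[OF rho_lin] clin_on_scale[OF rho_lin])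
  have shift0: "sc (of_nat (\<beta> i)) (\<rho> k (\<alpha> + \<beta> - eps i) u) = 0"
    if "u \<in> A" "sum \<alpha> UNIV + sum \<beta> UNIV \<ge> 3" "\<alpha> \<noteq> 0" "\<beta> \<noteq> 0" for \<alpha> \<beta> i k u
  proof (cases "\<beta> i = 0")
    case True
    then show ?thesis using that AU index_nonzero[OF that(3,4), of i] by auto
  next
    case False
    have "2 \<le> sum (\<alpha> + \<beta> - eps i) UNIV" using sum_shift_index[of \<beta> i \<alpha>] False that(2) by linarith
    then show ?thesis using that(1) by (simp add: A_def)
  qed
  have "\<rho> k \<beta> u \<in> A" if b: "\<beta> \<noteq> 0" and uA: "u \<in> A" for k \<beta> u
  proof -
    have uU: "u \<in> U" using uA AU by blast
    have "\<rho> j \<alpha> (\<rho> k \<beta> u) = 0" if a: "2 \<le> sum \<alpha> UNIV" for j \<alpha>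
    proof -
      have d: "sum \<alpha> UNIV + sum \<beta> UNIV \<ge> 3" using a sum_pos_index[OF b] by simp
      have "\<rho> j \<alpha> u = 0" using uA a by (simp add: A_def)
      then have "\<rho> j \<alpha> (\<rho> k \<beta> u) = sc (of_nat (\<beta> j)) (\<rho> k (\<alpha> + \<beta> - eps j) u) - sc (of_nat (\<alpha> k)) (\<rho> j (\<beta> + \<alpha> - eps k) u)"
        using rho_comm[OF nz[OF a] b uU, of j k] clin_on_zero[OF rho_lin[OF b]] by (simp add: add.commute)
      also have "\<dots> = 0"
        using shift0[OF uA d nz[OF a] b] shift0[OF uA _ b nz[OF a]] d by (simp add: add.commute)
      finally show ?thesis .
    qed
    then show ?thesis using b uU by (simp add: A_def)
  qed
  then have "ops_sub sc U Wp_idx (Wp_ops \<rho>) A" using A AU by (simp add: ops_sub_Wp)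
  then have "A = {0} \<or> A = U" using irr by (simp add: ops_irreducible_def)
  moreover have "A \<noteq> {0}"
    using singular_vector irr unfolding ops_irreducible_def A_def by blast
  ultimately have "A = U" by blast
  then show ?thesis using u deg by (auto simp: A_def)
qed

text \<open>The linear fields z_p \<partial>/\<partial>z_q obey the relations of the matrix units
  E^p_q, hence the exchange of indices. Together with the vanishing of the higher fields this says
  that \<rho> is a pullback from gl_n.\<close>

lemma irreducible_gl:
  assumes irr: "ops_irreducible sc U Wp_idx (Wp_ops \<rho>)"
  shows "gl_module sc U (\<lambda>p q. \<rho> q (eps p))"
    and "\<And>j \<alpha> u. \<alpha> \<noteq> 0 \<Longrightarrow> u \<in> U \<Longrightarrow> gl_wplus (\<lambda>p q. \<rho> q (eps p)) j \<alpha> u = \<rho> j \<alpha> u"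
proof -
  show "gl_module sc U (\<lambda>p q. \<rho> q (eps p))"
  proof
    show "gl_rep sc U (\<lambda>p q. \<rho> q (eps p))"
      unfolding gl_rep_def
    proof (intro conjI allI ballI cvs)
      fix p q r s u assume u: "u \<in> U"
      have "sc (of_nat (eps r q)) (\<rho> s (eps p + eps r - eps q) u) = (if q = r then \<rho> s (eps p) u else 0)"
        using u index_nonzero[OF eps_nonzero eps_nonzero, of p r q] by (auto simp: eps_def[of r])
      moreover have "sc (of_nat (eps p s)) (\<rho> q (eps p + eps r - eps s) u) = (if s = p then \<rho> q (eps r) u else 0)"
        using u index_nonzero[OF eps_nonzero eps_nonzero, of p r s] by (auto simp: eps_def[of p])
      ultimately show "\<rho> q (eps p) (\<rho> s (eps r) u) - \<rho> s (eps r) (\<rho> q (eps p) u)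
        = (if q = r then \<rho> s (eps p) u else 0) - (if s = p then \<rho> q (eps r) u else 0)"
        using rho_comm[OF eps_nonzero eps_nonzero u, of q p s r] by simp
    qed (auto intro: rho_lin)
  qed
  fix j \<alpha> u assume a: "\<alpha> \<noteq> (0 :: 'n \<Rightarrow> nat)" and u: "u \<in> U"
  show "gl_wplus (\<lambda>p q. \<rho> q (eps p)) j \<alpha> u = \<rho> j \<alpha> u"
  proof (cases "sum \<alpha> UNIV = 1")
    case True
    then obtain p where "\<alpha> = eps p" using sum_eq_1_iff by blast
    then show ?thesis by simp
  next
    case False
    then have "2 \<le> sum \<alpha> UNIV" using sum_pos_index[OF a] by arith
    then have "\<rho> j \<alpha> u = 0" by (rule irreducible_higher_zero[OF irr _ u])
    moreover have "\<alpha> \<noteq> eps p" for p using False sum_eq_1_iff by blast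
    ultimately show ?thesis by (simp add: gl_wplus_other)
  qed
qed

end

section \<open>Replacing operators that agree on the carrier, and assembly of the
  classification\<close>

lemma ops_irreducible_cong:
  assumes "\<And>i x. i \<in> I \<Longrightarrow> x \<in> V \<Longrightarrow> ops i x = ops' i x"
  shows "ops_irreducible sc V I ops \<longleftrightarrow> ops_irreducible sc V I ops'"
proof -
  have "ops_sub sc V I ops W \<longleftrightarrow> ops_sub sc V I ops' W" for W
    using assms unfolding ops_sub_def by (metis subsetD)
  then show ?thesis by (simp add: ops_irreducible_def)
qed

lemma is_Jmod_cong:
  assumes J: "is_Jmod sc V d e" and eq: "\<And>j s x. x \<in> V \<Longrightarrow> d' j s x = d j s x"
  shows "is_Jmod sc V d' e"
proof -
  interpret jmod sc V d e by unfold_locales fact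
  have "clin_on sc V sc (d' j s)" for j s
    using d_lin[of j s] eq unfolding clin_on_def by simp
  moreover have "{x\<in>V. \<exists>c. d' j 0 x = sc c x} = {x\<in>V. \<exists>c. d j 0 x = sc c x}" for j
    using eq by auto
  moreover note J[unfolded is_Jmod_def]
  ultimately show ?thesis
    unfolding is_Jmod_def by (simp add: eq)
qed

lemma ops_iso_cong:
  assumes l: "\<And>i x. i \<in> I \<Longrightarrow> x \<in> V \<Longrightarrow> ops i x = ops2 i x"
    and r: "\<And>i x. i \<in> I \<Longrightarrow> x \<in> V' \<Longrightarrow> ops' i x = ops2' i x"
  shows "ops_iso sc V I ops sc' V' ops' \<longleftrightarrow> ops_iso sc V I ops2 sc' V' ops2'"
proof -
  have "(bij_betw f V V' \<and> clin_on sc V sc' f \<and> (\<forall>i\<in>I. \<forall>x\<in>V. f (ops i x) = ops' i (f x)))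
    \<longleftrightarrow> (bij_betw f V V' \<and> clin_on sc V sc' f \<and> (\<forall>i\<in>I. \<forall>x\<in>V. f (ops2 i x) = ops2' i (f x)))" for f
    using l r bij_betwE[of f V V'] by auto
  then show ?thesis by (simp add: ops_iso_def)
qed

lemma Jind_cong:
  fixes \<rho> \<rho>' :: "'n::finite \<Rightarrow> ('n \<Rightarrow> nat) \<Rightarrow> 'u::ab_group_add \<Rightarrow> 'u"
  assumes eq: "\<And>j \<alpha> u. \<alpha> \<noteq> 0 \<Longrightarrow> u \<in> U \<Longrightarrow> \<rho> j \<alpha> u = \<rho>' j \<alpha> u" and f: "f \<in> FU U"
  shows "Jind lam sc U \<rho> j s f = Jind lam sc U \<rho>' j s f"
proof -
  have "f k \<in> U" for k using f by (simp add: FU_def)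
  moreover have "Wp_supp U \<rho> j = Wp_supp U \<rho>' j" using eq by (auto simp: Wp_supp_def)
  ultimately show ?thesis
    unfolding Jind_def by (intro ext arg_cong2[of _ _ _ _ "(+)"] refl sum.cong) (auto simp: eq Wp_supp_def)
qed

lemma (in gl_module) Jops_Jgl: "x \<in> FU U \<Longrightarrow> Jops (Jgl lam sc g) shiftE i x = Jops (Jind lam sc U (gl_wplus g)) shiftE i x"
  by (cases i) (auto simp: Jops_def Jgl_eq)

lemma (in gl_module) gl_wplus_fd: "findim sc U \<Longrightarrow> wplus_module_fd sc U (gl_wplus g)"
  using gl_wplus_rep by unfold_locales

lemma wplus_module_fdI: "Wplus_rep sc U \<rho> \<Longrightarrow> findim sc U \<Longrightarrow> wplus_module_fd sc U \<rho>"
  by unfold_locales (auto simp: Wplus_rep_def)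

lemma gl_moduleI: "gl_rep sc U g \<Longrightarrow> gl_module sc U g"
  by unfold_locales (auto simp: gl_rep_def)

lemma Jind_iso_iff:
  assumes M: "wplus_module_fd sc U \<rho>" and M': "wplus_module_fd sc' U' \<rho>'" and U: "U \<noteq> {0}"
  shows "ops_iso (scF sc) (FU U) UNIV (Jops (Jind lam sc U \<rho>) shiftE)
               (scF sc') (FU U') (Jops (Jind lam' sc' U' \<rho>') shiftE)
       \<longleftrightarrow> lat_equiv lam lam' \<and> ops_iso sc U Wp_idx (Wp_ops \<rho>) sc' U' (Wp_ops \<rho>')"
proof -
  interpret M: wplus_module_fd sc U \<rho> by fact
  interpret M': wplus_module_fd sc' U' \<rho>' by fact
  interpret wplus_module_pair sc U \<rho> sc' U' \<rho>' ..
  show ?thesis using iso_if iso_only_if[OF U] by blast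
qed

lemma Jgl_iso_iff:
  assumes g: "gl_rep sc V g" "findim sc V" and g': "gl_rep sc' V' g'" "findim sc' V'" and V: "V \<noteq> {0}"
  shows "ops_iso (scF sc) (FU V) UNIV (Jops (Jgl lam sc g) shiftE)
               (scF sc') (FU V') (Jops (Jgl lam' sc' g') shiftE)
       \<longleftrightarrow> lat_equiv lam lam' \<and> ops_iso sc V UNIV (gl_ops g) sc' V' (gl_ops g')"
proof -
  interpret G: gl_module sc V g by (rule gl_moduleI[OF g(1)])
  interpret G': gl_module sc' V' g' by (rule gl_moduleI[OF g'(1)])
  have "ops_iso (scF sc) (FU V) UNIV (Jops (Jgl lam sc g) shiftE)
               (scF sc') (FU V') (Jops (Jgl lam' sc' g') shiftE)
    \<longleftrightarrow> ops_iso (scF sc) (FU V) UNIV (Jops (Jind lam sc V (gl_wplus g)) shiftE)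
               (scF sc') (FU V') (Jops (Jind lam' sc' V' (gl_wplus g')) shiftE)"
    by (intro ops_iso_cong G.Jops_Jgl G'.Jops_Jgl)
  also have "\<dots> \<longleftrightarrow> lat_equiv lam lam' \<and> ops_iso sc V UNIV (gl_ops g) sc' V' (gl_ops g')"
    unfolding Jind_iso_iff[OF G.gl_wplus_fd[OF g(2)] G'.gl_wplus_fd[OF g'(2)] V]
    by (simp add: gl_wplus_iso[OF G.gl_module_axioms G'.gl_module_axioms])
  finally show ?thesis .
qed

lemma Jgl_irreducible_Jmod:
  assumes g: "gl_rep sc V g" "findim sc V" and irr: "ops_irreducible sc V UNIV (gl_ops g)"
  shows "is_Jmod (scF sc) (FU V) (Jgl lam sc g) shiftE
      \<and> ops_irreducible (scF sc) (FU V) UNIV (Jops (Jgl lam sc g) shiftE)"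
proof -
  interpret G: gl_module sc V g by (rule gl_moduleI[OF g(1)])
  interpret M: wplus_module_fd sc V "gl_wplus g" by (rule G.gl_wplus_fd[OF g(2)])
  have "ops_irreducible (scF sc) (FU V) UNIV (Jops (Jgl lam sc g) shiftE)
    \<longleftrightarrow> ops_irreducible (scF sc) (FU V) UNIV (Jops (M.Jd lam) shiftE)"
    by (intro ops_irreducible_cong G.Jops_Jgl)
  then show ?thesis
    using is_Jmod_cong[OF M.Jd_is_Jmod G.Jgl_eq] M.irreducible_iff G.gl_wplus_irreducible irr by blast
qed

text \<open>An irreducible module is indecomposable, hence isomorphic to F \<otimes> U for some U.
  Irreducibility passes to U, where the action comes from gl_n, and then the two formulas for d_j(s)
  coincide.\<close>

lemma (in jmod) irreducible_structure:
  assumes irr: "ops_irreducible sc V UNIV (Jops d e)"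
  shows "\<exists>lam (U :: 'v set) g. gl_rep sc U g \<and> findim sc U \<and> ops_irreducible sc U UNIV (gl_ops g)
         \<and> ops_iso sc V UNIV (Jops d e) (scF sc) (FU U) (Jops (Jgl lam sc g) shiftE)"
proof -
  obtain lam U \<rho> where M: "wplus_module_fd sc U \<rho>"
    and iso: "ops_iso sc V UNIV (Jops d e) (scF sc) (FU U) (Jops (Jind lam sc U \<rho>) shiftE)"
    by (rule indecomposable_structure[OF irreducible_imp_indecomposable[OF irr]])
  interpret M: wplus_module_fd sc U \<rho> by fact
  let ?g = "\<lambda>p q. \<rho> q (eps p)"
  have "ops_irreducible (scF sc) (FU U) UNIV (Jops (M.Jd lam) shiftE)"
    by (rule ops_iso_irreducible[OF iso cvs Jops_d_e_closed irr])
  then have irrU: "ops_irreducible sc U Wp_idx (Wp_ops \<rho>)" by (simp only: M.irreducible_iff)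
  interpret G: gl_module sc U ?g by (rule M.irreducible_gl(1)[OF irrU])
  note eq = M.irreducible_gl(2)[OF irrU]
  have "ops_irreducible sc U Wp_idx (Wp_ops (gl_wplus ?g)) \<longleftrightarrow> ops_irreducible sc U Wp_idx (Wp_ops \<rho>)"
    by (rule ops_irreducible_cong) (auto simp: Wp_idx_def Wp_ops_def eq)
  then have "ops_irreducible sc U UNIV (gl_ops ?g)" using irrU by (simp only: G.gl_wplus_irreducible)
  moreover have "Jops (M.Jd lam) shiftE i x = Jops (Jgl lam sc ?g) shiftE i x" if "x \<in> FU U" for i x
    unfolding G.Jops_Jgl[OF that]
    using Jind_cong[OF eq that] by (cases i) (auto simp: Jops_def)
  then have "ops_iso sc V UNIV (Jops d e) (scF sc) (FU U) (Jops (Jgl lam sc ?g) shiftE)"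
    using iso ops_iso_cong[of UNIV V "Jops d e" "Jops d e" "FU U" "Jops (M.Jd lam) shiftE" "Jops (Jgl lam sc ?g) shiftE"]
    by simp
  ultimately show ?thesis using G.gl M.fd by blast
qed

lemma (in jmod) indecomposable_structure_wplus:
  assumes indec: "ops_indecomposable sc V UNIV (Jops d e)"
  shows "\<exists>lam (U :: 'v set) \<rho>. Wplus_rep sc U \<rho> \<and> findim sc U \<and> ops_indecomposable sc U Wp_idx (Wp_ops \<rho>)
         \<and> ops_iso sc V UNIV (Jops d e) (scF sc) (FU U) (Jops (Jind lam sc U \<rho>) shiftE)"
proof -
  obtain lam U \<rho> where M: "wplus_module_fd sc U \<rho>"
    and iso: "ops_iso sc V UNIV (Jops d e) (scF sc) (FU U) (Jops (Jind lam sc U \<rho>) shiftE)"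
    by (rule indecomposable_structure[OF indec])
  interpret M: wplus_module_fd sc U \<rho> by fact
  have "ops_indecomposable (scF sc) (FU U) UNIV (Jops (M.Jd lam) shiftE)"
    by (rule ops_iso_indecomposable[OF iso cvs Jops_d_e_closed indec])
  then have "ops_indecomposable sc U Wp_idx (Wp_ops \<rho>)" by (simp only: M.indecomposable_iff)
  then show ?thesis using M.rep M.fd iso by blast
qed

lemma ops_irreducible_nonzero: "ops_irreducible sc V I ops \<Longrightarrow> V \<noteq> {0}"
  by (simp add: ops_irreducible_def)

lemma ops_indecomposable_nonzero: "ops_indecomposable sc V I ops \<Longrightarrow> V \<noteq> {0}"
  by (simp add: ops_indecomposable_def)

theorem theorem3:
  shows
  \<comment> \<open>(a)\<close>
  "(\<forall>(sc :: complex \<Rightarrow> 'v::ab_group_add \<Rightarrow> 'v) V (d :: 'n::finite \<Rightarrow> ('n \<Rightarrow> int) \<Rightarrow> 'v \<Rightarrow> 'v) e lam.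
      is_Jmod sc V d e \<and> ops_indecomposable sc V UNIV (Jops d e) \<and> weight_space sc V d lam \<noteq> {0} \<longrightarrow>
      (let U = weight_space sc V d lam in
        findim sc U \<and>
        (\<exists>D. D_expansion sc d e lam U D
           \<and> (\<forall>D'. D_expansion sc d e lam U D' \<longrightarrow> (\<forall>j \<alpha>. \<alpha> \<noteq> 0 \<longrightarrow> (\<forall>u\<in>U. D' j \<alpha> u = D j \<alpha> u)))
           \<and> Wplus_rep sc U D)))
  \<comment> \<open>(b), first claim\<close>
   \<and> (\<forall>(sc :: complex \<Rightarrow> 'u::ab_group_add \<Rightarrow> 'u) U (\<rho> :: 'n \<Rightarrow> ('n \<Rightarrow> nat) \<Rightarrow> 'u \<Rightarrow> 'u).
      Wplus_rep sc U \<rho> \<and> findim sc U \<longrightarrow> (\<forall>j. finite (Wp_supp U \<rho> j)))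
  \<comment> \<open>(b), the construction lands in indecomposable modules of category J\<close>
   \<and> (\<forall>(sc :: complex \<Rightarrow> 'u \<Rightarrow> 'u) U (\<rho> :: 'n \<Rightarrow> ('n \<Rightarrow> nat) \<Rightarrow> 'u \<Rightarrow> 'u) lam.
      Wplus_rep sc U \<rho> \<and> findim sc U \<and> ops_indecomposable sc U Wp_idx (Wp_ops \<rho>) \<longrightarrow>
      is_Jmod (scF sc) (FU U) (Jind lam sc U \<rho>) shiftE
      \<and> ops_indecomposable (scF sc) (FU U) UNIV (Jops (Jind lam sc U \<rho>) shiftE))
  \<comment> \<open>(b), surjectivity\<close>
   \<and> (\<forall>(sc :: complex \<Rightarrow> 'v \<Rightarrow> 'v) V (d :: 'n \<Rightarrow> ('n \<Rightarrow> int) \<Rightarrow> 'v \<Rightarrow> 'v) e.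
      is_Jmod sc V d e \<and> ops_indecomposable sc V UNIV (Jops d e) \<longrightarrow>
      (\<exists>lam (U :: 'v set) \<rho>. Wplus_rep sc U \<rho> \<and> findim sc U \<and> ops_indecomposable sc U Wp_idx (Wp_ops \<rho>)
         \<and> ops_iso sc V UNIV (Jops d e) (scF sc) (FU U) (Jops (Jind lam sc U \<rho>) shiftE)))
  \<comment> \<open>(b), injectivity and independence of the representative\<close>
   \<and> (\<forall>(sc :: complex \<Rightarrow> 'u \<Rightarrow> 'u) U (\<rho> :: 'n \<Rightarrow> ('n \<Rightarrow> nat) \<Rightarrow> 'u \<Rightarrow> 'u) lam
       (sc' :: complex \<Rightarrow> 'w::ab_group_add \<Rightarrow> 'w) U' (\<rho>' :: 'n \<Rightarrow> ('n \<Rightarrow> nat) \<Rightarrow> 'w \<Rightarrow> 'w) lam'.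
      Wplus_rep sc U \<rho> \<and> findim sc U \<and> ops_indecomposable sc U Wp_idx (Wp_ops \<rho>) \<and>
      Wplus_rep sc' U' \<rho>' \<and> findim sc' U' \<and> ops_indecomposable sc' U' Wp_idx (Wp_ops \<rho>') \<longrightarrow>
      (ops_iso (scF sc) (FU U) UNIV (Jops (Jind lam sc U \<rho>) shiftE)
               (scF sc') (FU U') (Jops (Jind lam' sc' U' \<rho>') shiftE)
       \<longleftrightarrow> lat_equiv lam lam' \<and> ops_iso sc U Wp_idx (Wp_ops \<rho>) sc' U' (Wp_ops \<rho>')))
  \<comment> \<open>(c), the construction lands in irreducible modules of category J\<close>
   \<and> (\<forall>(sc :: complex \<Rightarrow> 'u \<Rightarrow> 'u) V (g :: 'n \<Rightarrow> 'n \<Rightarrow> 'u \<Rightarrow> 'u) lam.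
      gl_rep sc V g \<and> findim sc V \<and> ops_irreducible sc V UNIV (gl_ops g) \<longrightarrow>
      is_Jmod (scF sc) (FU V) (Jgl lam sc g) shiftE
      \<and> ops_irreducible (scF sc) (FU V) UNIV (Jops (Jgl lam sc g) shiftE))
  \<comment> \<open>(c), surjectivity\<close>
   \<and> (\<forall>(sc :: complex \<Rightarrow> 'v \<Rightarrow> 'v) V (d :: 'n \<Rightarrow> ('n \<Rightarrow> int) \<Rightarrow> 'v \<Rightarrow> 'v) e.
      is_Jmod sc V d e \<and> ops_irreducible sc V UNIV (Jops d e) \<longrightarrow>
      (\<exists>lam (W :: 'v set) g. gl_rep sc W g \<and> findim sc W \<and> ops_irreducible sc W UNIV (gl_ops g)
         \<and> ops_iso sc V UNIV (Jops d e) (scF sc) (FU W) (Jops (Jgl lam sc g) shiftE)))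
  \<comment> \<open>(c), injectivity and independence of the representative\<close>
   \<and> (\<forall>(sc :: complex \<Rightarrow> 'u \<Rightarrow> 'u) V (g :: 'n \<Rightarrow> 'n \<Rightarrow> 'u \<Rightarrow> 'u) lam
       (sc' :: complex \<Rightarrow> 'w \<Rightarrow> 'w) V' (g' :: 'n \<Rightarrow> 'n \<Rightarrow> 'w \<Rightarrow> 'w) lam'.
      gl_rep sc V g \<and> findim sc V \<and> ops_irreducible sc V UNIV (gl_ops g) \<and>
      gl_rep sc' V' g' \<and> findim sc' V' \<and> ops_irreducible sc' V' UNIV (gl_ops g') \<longrightarrow>
      (ops_iso (scF sc) (FU V) UNIV (Jops (Jgl lam sc g) shiftE)
               (scF sc') (FU V') (Jops (Jgl lam' sc' g') shiftE)
       \<longleftrightarrow> lat_equiv lam lam' \<and> ops_iso sc V UNIV (gl_ops g) sc' V' (gl_ops g')))"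
proof ((intro conjI; intro allI impI), goal_cases)
  case (1 sc V d e lam)
  then interpret jmod sc V d e by unfold_locales blast
  show ?case unfolding Let_def by (rule weight_space_D_expansion) (use 1 in blast)+
next
  case (2 sc U \<rho> j)
  then interpret M: wplus_module_fd sc U \<rho> by (intro wplus_module_fdI) blast+
  obtain K where "M.supported K" using M.finite_support[OF M.fd] by blast
  then show ?case unfolding M.supported_def using finite_mbox finite_subset by blast
next
  case (3 sc U \<rho> lam)
  then interpret M: wplus_module_fd sc U \<rho> by (intro wplus_module_fdI) blast+
  show ?case using M.Jd_is_Jmod M.indecomposable_iff 3 by blast
next
  case (4 sc V d e)
  then interpret jmod sc V d e by unfold_locales blast
  show ?case by (rule indecomposable_structure_wplus) (use 4 in blast)
next
  case (5 sc U \<rho> lam sc' U' \<rho>' lam')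
  then show ?case
    by (intro Jind_iso_iff wplus_module_fdI) (auto dest: ops_indecomposable_nonzero)
next
  case (6 sc V g lam)
  then show ?case by (intro Jgl_irreducible_Jmod) blast+
next
  case (7 sc V d e)
  then interpret jmod sc V d e by unfold_locales blast
  show ?case by (rule irreducible_structure) (use 7 in blast)
next
  case (8 sc V g lam sc' V' g' lam')
  then show ?case by (intro Jgl_iso_iff) (auto dest: ops_irreducible_nonzero)
qed

end
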